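(* There is an absolute constant $C>0$ such that the following holds. Let $K,\varepsilon>0$, let $n\ge 1$, and let $\mathcal{A}\subset\{0,1\}^n$ be nonempty with $$|\partial_e(\mathcal{A})|\le |\mathcal{A}|\Big(\log_2\big(2^n/|\mathcal{A}|\big)+K\Big).$$ Then there are pairwise disjoint subcubes $C_1,\ldots,C_L$ of $Q_n$ with $$\big|\mathcal{A}\,\triangle\,(C_1\cup\cdots\cup C_L)\big|\le \varepsilon|\mathcal{A}|,$$ where $L\le L(K,\varepsilon)=2^{2^{C(K/\varepsilon)^2}}$.
   Context: $Q_n$ is the graph on vertex set $\{0,1\}^n$ in which two vertices are adjacent iff they differ in exactly one coordinate. For $\mathcal{A}\subset\{0,1\}^n$, the edge boundary $\partial_e(\mathcal{A})$ is the set of edges $xy$ of $Q_n$ with $x\in\mathcal{A}$, $y\notin\mathcal{A}$. A subcube of $Q_n$ is a set of the form $\{x\in\{0,1\}^n: x_i=a_i \text{ for all } i\in T\}$ for some $T\subset[n]$ and $a\in\{0,1\}^T$. $\triangle$ denotes symmetric difference. *)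

theory Defs
  imports Complex_Main "HOL-Library.FuncSet" "HOL-Library.Disjoint_Sets"
begin

text \<open>
  The dimension is a natural number rather than a type because the absolute constant in the
  theorem must not depend on it. Points of the cube are extensional functions, so distinct
  points differ in some coordinate of \<open>{1..n}\<close> and cardinalities of sets of points are the
  intended ones.
\<close>

definition cube :: "nat \<Rightarrow> (nat \<Rightarrow> nat) set" where
  "cube n = {1..n} \<rightarrow>\<^sub>E {0, 1}"

definition cube_edges :: "nat \<Rightarrow> (nat \<Rightarrow> nat) set set" where
  "cube_edges n =
     {{x, y} | x y. x \<in> cube n \<and> y \<in> cube n \<and> card {i \<in> {1..n}. x i \<noteq> y i} = 1}"

definition edge_boundary :: "nat \<Rightarrow> (nat \<Rightarrow> nat) set \<Rightarrow> (nat \<Rightarrow> nat) set set" where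
  "edge_boundary n A = {{x, y} | x y. {x, y} \<in> cube_edges n \<and> x \<in> A \<and> y \<notin> A}"

definition subcube :: "nat \<Rightarrow> (nat \<Rightarrow> nat) set \<Rightarrow> bool" where
  "subcube n S \<longleftrightarrow>
     (\<exists>T a. T \<subseteq> {1..n} \<and> a \<in> T \<rightarrow>\<^sub>E {0, 1} \<and> S = {x \<in> cube n. \<forall>i\<in>T. x i = a i})"

end

theory Submission
  imports Defs "HOL-Analysis.Harmonic_Numbers"
begin

text \<open>
  For a set \<open>A\<close> of vertices let \<open>X\<close> be uniform on \<open>A\<close>. The excess
  \<open>|\<partial>A| - |A| log\<^sub>2(2\<^sup>n/|A|)\<close> is \<open>|A|\<close> times \<open>H(X) - \<Sum>\<^sub>i H(X\<^sub>i | X\<^sub>j, j \<noteq> i)\<close>; it is nonnegative, and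
  splitting \<open>A\<close> along a coordinate lowers the total excess by a nonnegative gain. If \<open>A\<close> has excess
  at most \<open>M r |A|\<close> but differs from every subcube in at least \<open>r |A|\<close> points, then some coordinate
  gains at least \<open>2\<^bsup>-O(M\<^sup>2+1)\<^esup> r |A|\<close>. Hence splitting all parts that are far from a subcube and have
  excess at most \<open>2K/\<epsilon>\<close> times their distance must stop after \<open>2\<^bsup>O((K/\<epsilon>)\<^sup>2)\<^esup>\<close> rounds.

  If no coordinate gains, each coordinate is either very biased or has tiny influence. Fixing
  the biased ones costs little. For the remaining face of \<open>A\<close>, of density \<open>2\<^bsup>-t\<^esup>\<close>, the inequality of
  Falik and Samorodnitsky contradicts tiny influences as long as \<open>t = O(M\<^sup>2+1)\<close>. For larger \<open>t\<close>,
  expose \<open>X\<close> on a suitable set \<open>R\<close> of coordinates: conditionally on \<open>X\<^sub>R\<close> some bounded number of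
  further coordinates is almost determined, while the mutual information between \<open>X\<^sub>R\<close> and the rest is
  at most the excess. So a pattern of \<open>k\<close> coordinates has probability well above \<open>2\<^bsup>-k\<^esup>\<close>,
  which is impossible when all influences are tiny.
\<close>

section \<open>Flipping a coordinate\<close>

text \<open>The quadratic exponent comes from the codimension. For density at most 1/2 and
  influences at most \<delta>, the inequality of Falik and Samorodnitsky bounds the logarithm of
  1/\<delta> by a multiple of the total influence, which is about the codimension t plus the excess
  per point. It contradicts a tiny \<delta> only once t is bounded in terms of M alone. Exposure
  supplies that bound: gains and relative entropy in a good fibre are O(M + 1), so a fibre of
  codimension of order (M + 1)^2 has k = O(M + 1) unexposed coordinates that are almost constant on
  it. Hence t = O(M^2 + 1), and \<open>2 powr (- \<Gamma>)\<close> with \<Gamma> a large multiple of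
  M^2 + 1 is small enough for \<delta>. The number of parts at most doubles per round, which turns
  the number of rounds into a double exponential. Errors are measured by the distance to the nearest
  subcube: it is superadditive under splitting, like the excess, so gains proportional to it add up
  over all parts. The final bound has no additive constant in its exponent, so tiny values of K /
  \<epsilon> need separate care when rounds are counted.\<close>

text \<open>Vertices of the cube are represented by subsets of the set \<open>J\<close> of coordinates.\<close>

definition flip :: "'a \<Rightarrow> 'a set \<Rightarrow> 'a set" where
  "flip i x = (if i \<in> x then x - {i} else insert i x)"

lemma flip_flip [simp]: "flip i (flip i x) = x"
  by (auto simp: flip_def)

lemma mem_flip_iff: "j \<in> flip i x \<longleftrightarrow> (if j = i then i \<notin> x else j \<in> x)"
  by (auto simp: flip_def)

lemma flip_subset: "x \<subseteq> J \<Longrightarrow> i \<in> J \<Longrightarrow> flip i x \<subseteq> J"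
  by (auto simp: flip_def)

lemma flip_Int: "i \<notin> R \<Longrightarrow> flip i x \<inter> R = x \<inter> R"
  by (auto simp: flip_def)

lemma flip_insert: "j \<noteq> i \<Longrightarrow> flip j (insert i x) = insert i (flip j x)"
  by (auto simp: flip_def)

section \<open>Averages over the cube and the inequality of Falik and Samorodnitsky\<close>

definition av :: "'a set \<Rightarrow> ('a set \<Rightarrow> real) \<Rightarrow> real" where
  "av J f = (\<Sum>x\<in>Pow J. f x) / 2 ^ card J"

lemma av_insert:
  assumes "finite J" "i \<notin> J"
  shows "av (insert i J) f = (av J f + av J (\<lambda>x. f (insert i x))) / 2"
proof -
  have inj: "inj_on (insert i) (Pow J)"
    using assms(2) by (auto simp: inj_on_def)
  have "(\<Sum>x\<in>Pow (insert i J). f x) = (\<Sum>x\<in>Pow J. f x) + (\<Sum>x\<in>insert i ` Pow J. f x)"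
    unfolding Pow_insert by (rule sum.union_disjoint) (use assms in auto)
  also have "(\<Sum>x\<in>insert i ` Pow J. f x) = (\<Sum>x\<in>Pow J. f (insert i x))"
    using sum.reindex[OF inj] by simp
  finally show ?thesis
    using assms by (simp add: av_def field_simps)
qed

lemma av_add: "av J (\<lambda>x. f x + g x) = av J f + av J g"
  by (simp add: av_def sum.distrib add_divide_distrib)

lemma av_diff: "av J (\<lambda>x. f x - g x) = av J f - av J g"
  by (simp add: av_def sum_subtractf diff_divide_distrib)

lemma av_cmult: "av J (\<lambda>x. c * f x) = c * av J f"
  by (simp add: av_def sum_distrib_left)

lemma av_divide: "av J (\<lambda>x. f x / c) = av J f / c"
  by (simp add: av_def sum_divide_distrib mult.commute)

lemma av_mono: "(\<And>x. x \<subseteq> J \<Longrightarrow> f x \<le> g x) \<Longrightarrow> av J f \<le> av J g"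
  unfolding av_def by (intro divide_right_mono sum_mono) auto

lemma av_nonneg: "(\<And>x. x \<subseteq> J \<Longrightarrow> 0 \<le> f x) \<Longrightarrow> 0 \<le> av J f"
  unfolding av_def by (intro divide_nonneg_nonneg sum_nonneg) auto

lemma av_cong: "(\<And>x. x \<subseteq> J \<Longrightarrow> f x = g x) \<Longrightarrow> av J f = av J g"
  unfolding av_def by (intro arg_cong2[where f = "(/)"] sum.cong) auto

lemma av_empty [simp]: "av {} f = f {}"
  by (simp add: av_def)

lemma av_flip:
  assumes "i \<in> J"
  shows "av J (\<lambda>x. f (flip i x)) = av J f"
proof -
  have "bij_betw (flip i) (Pow J) (Pow J)"
    by (rule bij_betw_byWitness[where f' = "flip i"]) (use assms in \<open>auto simp: flip_def\<close>)
  then show ?thesis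
    unfolding av_def using sum.reindex_bij_betw[of "flip i" "Pow J" "Pow J" f] by simp
qed

lemma av_Cauchy_Schwarz: "(av J (\<lambda>x. f x * g x))\<^sup>2 \<le> av J (\<lambda>x. (f x)\<^sup>2) * av J (\<lambda>x. (g x)\<^sup>2)"
proof -
  define a b c where "a = av J (\<lambda>x. (f x)\<^sup>2)" and "b = av J (\<lambda>x. f x * g x)"
    and "c = av J (\<lambda>x. (g x)\<^sup>2)"
  have q: "a * s\<^sup>2 - 2 * s * b * r + c * r\<^sup>2 \<ge> 0" for s r
  proof -
    have "0 \<le> av J (\<lambda>x. (s * f x - r * g x)\<^sup>2)"
      by (rule av_nonneg) simp
    also have "(\<lambda>x. (s * f x - r * g x)\<^sup>2)
        = (\<lambda>x. s\<^sup>2 * (f x)\<^sup>2 - (2 * s * r) * (f x * g x) + r\<^sup>2 * (g x)\<^sup>2)"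
      by (simp add: power2_eq_square algebra_simps)
    also have "av J \<dots> = s\<^sup>2 * a - (2 * s * r) * b + r\<^sup>2 * c"
      by (simp only: av_add av_diff av_cmult a_def b_def c_def)
    finally show ?thesis by (simp add: algebra_simps)
  qed
  have "a \<ge> 0" "c \<ge> 0"
    unfolding a_def c_def by (auto intro: av_nonneg)
  have "b\<^sup>2 \<le> a * c"
  proof (cases "a = 0")
    case True
    have "b = 0"
    proof (rule ccontr)
      assume "b \<noteq> 0"
      then show False
        using q[of "(c + 1) / b" 1] True \<open>c \<ge> 0\<close> by simp
    qed
    then show ?thesis using True by simp
  next
    case False
    have "a * (a * c - b\<^sup>2) \<ge> 0"
      using q[of b a] by (simp add: power2_eq_square algebra_simps)
    then have "a * c - b\<^sup>2 \<ge> 0"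
      using False \<open>a \<ge> 0\<close> by (simp add: zero_le_mult_iff)
    then show ?thesis by simp
  qed
  then show ?thesis by (simp add: a_def b_def c_def)
qed

section \<open>The logarithmic Sobolev inequality on the cube\<close>

definition energy :: "'a set \<Rightarrow> ('a set \<Rightarrow> real) \<Rightarrow> real" where
  "energy J f = (\<Sum>j\<in>J. av J (\<lambda>x. (f x - f (flip j x))\<^sup>2))"

lemma energy_insert:
  assumes "finite J" "i \<notin> J"
  shows "energy (insert i J) f = (energy J f + energy J (\<lambda>x. f (insert i x))) / 2
    + av J (\<lambda>x. (f x - f (insert i x))\<^sup>2)"
proof -
  have 1: "av (insert i J) (\<lambda>x. (f x - f (flip i x))\<^sup>2) = av J (\<lambda>x. (f x - f (insert i x))\<^sup>2)"
  proof -
    have "av J (\<lambda>x. (f x - f (flip i x))\<^sup>2) = av J (\<lambda>x. (f x - f (insert i x))\<^sup>2)"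
      by (rule av_cong) (use assms in \<open>auto simp: flip_def\<close>)
    moreover have "av J (\<lambda>x. (f (insert i x) - f (flip i (insert i x)))\<^sup>2) = av J (\<lambda>x. (f x - f (insert i x))\<^sup>2)"
    proof (rule av_cong)
      fix x assume "x \<subseteq> J"
      then have "flip i (insert i x) = x" using assms by (auto simp: flip_def)
      then show "(f (insert i x) - f (flip i (insert i x)))\<^sup>2 = (f x - f (insert i x))\<^sup>2"
        by (simp add: power2_commute)
    qed
    ultimately show ?thesis by (simp add: av_insert[OF assms])
  qed
  have 2: "av (insert i J) (\<lambda>x. (f x - f (flip j x))\<^sup>2)
    = (av J (\<lambda>x. (f x - f (flip j x))\<^sup>2) + av J (\<lambda>x. (f (insert i x) - f (insert i (flip j x)))\<^sup>2)) / 2"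
    if "j \<in> J" for j
  proof -
    have "j \<noteq> i" using that assms by auto
    then show ?thesis by (simp add: av_insert[OF assms] flip_insert)
  qed
  have "energy (insert i J) f = av (insert i J) (\<lambda>x. (f x - f (flip i x))\<^sup>2)
    + (\<Sum>j\<in>J. av (insert i J) (\<lambda>x. (f x - f (flip j x))\<^sup>2))"
    unfolding energy_def using assms by simp
  also have "(\<Sum>j\<in>J. av (insert i J) (\<lambda>x. (f x - f (flip j x))\<^sup>2))
     = (energy J f + energy J (\<lambda>x. f (insert i x))) / 2"
    unfolding energy_def by (simp add: 2 sum.distrib sum_divide_distrib[symmetric])
  finally show ?thesis using 1 by simp
qed

text \<open>The tangent bound \<open>ln z \<le> z - 1\<close> at \<open>z = x / y\<close>,
  multiplied by \<open>x\<close>. With \<open>y\<close> the mean of two values it turns an entropy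
  into a quadratic expression.\<close>

lemma ln_mult_ge: "(x::real) \<ge> 0 \<Longrightarrow> y > 0 \<Longrightarrow> x * ln x \<le> x * ln y + x * (x / y - 1)"
proof (cases "x = 0")
  case False
  assume "x \<ge> 0" "y > 0"
  then have "x > 0" using False by simp
  have "ln (x / y) \<le> x / y - 1"
    using \<open>x > 0\<close> \<open>y > 0\<close> by (intro ln_le_minus_one) simp
  then have "ln x \<le> ln y + (x / y - 1)"
    using \<open>x > 0\<close> \<open>y > 0\<close> by (simp add: ln_div)
  then have "x * ln x \<le> x * (ln y + (x / y - 1))"
    using \<open>x > 0\<close> by (intro mult_left_mono) auto
  then show ?thesis by (simp add: algebra_simps)
qed simp

text \<open>Tangents at the mean bound the entropy by
  \<open>(u - v)\<^sup>2 / (2 * (u + v))\<close>; factoring \<open>u - v\<close> through the square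
  roots leaves a factor at most 1. The constant is not sharp, which keeps the argument
  elementary.\<close>

lemma two_point_log_Sobolev:
  fixes u v :: real
  assumes "u \<ge> 0" "v \<ge> 0"
  shows "(u * ln u + v * ln v) / 2 - (u + v) / 2 * ln ((u + v) / 2) \<le> (sqrt u - sqrt v)\<^sup>2"
proof (cases "u + v = 0")
  case True
  then have "u = 0" "v = 0" using assms by auto
  then show ?thesis by simp
next
  case False
  define w where "w = (u + v) / 2"
  have "w > 0" using False assms by (simp add: w_def)
  have uv: "u + v > 0" using False assms by simp
  have "u * ln u \<le> u * ln w + u * (u / w - 1)" "v * ln v \<le> v * ln w + v * (v / w - 1)"
    using ln_mult_ge \<open>w > 0\<close> assms by auto
  then have "(u * ln u + v * ln v) / 2 - (u * ln w + v * ln w) / 2 \<le> (u * (u / w - 1) + v * (v / w - 1)) / 2"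
    unfolding diff_divide_distrib[symmetric] by (intro divide_right_mono) linarith+
  also have "\<dots> = (u - v)\<^sup>2 / (2 * (u + v))"
  proof -
    have "(u * (u / w - 1) + v * (v / w - 1)) / 2 = (u\<^sup>2 + v\<^sup>2 - (u + v) * w) / (2 * w)"
      using \<open>w > 0\<close> by (simp add: field_simps power2_eq_square)
    also have "u\<^sup>2 + v\<^sup>2 - (u + v) * w = (u - v)\<^sup>2 / 2"
      by (simp add: w_def field_simps power2_eq_square)
    finally show ?thesis
      using uv by (simp add: w_def divide_simps)
  qed
  also have "\<dots> \<le> (sqrt u - sqrt v)\<^sup>2"
  proof -
    have e: "u - v = (sqrt u - sqrt v) * (sqrt u + sqrt v)"
      using assms by (simp add: algebra_simps)
    have "(sqrt u + sqrt v)\<^sup>2 + (sqrt u - sqrt v)\<^sup>2 = 2 * (u + v)"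
      using assms by (simp add: power2_eq_square algebra_simps)
    then have "(sqrt u + sqrt v)\<^sup>2 \<le> 2 * (u + v)"
      using zero_le_power2[of "sqrt u - sqrt v"] by linarith
    then have "(sqrt u - sqrt v)\<^sup>2 * (sqrt u + sqrt v)\<^sup>2 \<le> (sqrt u - sqrt v)\<^sup>2 * (2 * (u + v))"
      by (intro mult_left_mono) auto
    then show ?thesis
      using uv by (subst e) (simp add: power_mult_distrib pos_divide_le_eq)
  qed
  finally show ?thesis by (simp add: w_def algebra_simps)
qed

text \<open>Tensorisation: with one more coordinate the entropy of the square of \<open>f\<close> is
  the mean of the entropies on the two faces plus the two-point entropy of the squared norms
  \<open>u\<close>, \<open>v\<close>. The reverse triangle inequality for these norms bounds the
  latter by the energy in the new direction.\<close>

lemma log_Sobolev_cube: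
  assumes "finite J"
  shows "av J (\<lambda>x. (f x)\<^sup>2 * ln ((f x)\<^sup>2)) - av J (\<lambda>x. (f x)\<^sup>2) * ln (av J (\<lambda>x. (f x)\<^sup>2)) \<le> energy J f"
  using assms
proof (induction J arbitrary: f rule: finite_induct)
  case empty
  then show ?case by (simp add: energy_def)
next
  case (insert i J)
  define g where "g = (\<lambda>x. f (insert i x))"
  define u v where "u = av J (\<lambda>x. (f x)\<^sup>2)" and "v = av J (\<lambda>x. (g x)\<^sup>2)"
  have uv: "u \<ge> 0" "v \<ge> 0" unfolding u_def v_def by (auto intro: av_nonneg)
  have "av J (\<lambda>x. f x * g x) \<le> sqrt (u * v)"
    using av_Cauchy_Schwarz[of J f g] unfolding u_def v_def by (rule real_le_rsqrt)
  then have "(sqrt u - sqrt v)\<^sup>2 \<le> u + v - 2 * av J (\<lambda>x. f x * g x)"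
    using uv by (simp add: power2_eq_square algebra_simps real_sqrt_mult)
  also have "\<dots> = av J (\<lambda>x. (f x)\<^sup>2 + (g x)\<^sup>2 - 2 * (f x * g x))"
    by (simp add: av_add av_diff av_cmult u_def v_def)
  also have "(\<lambda>x. (f x)\<^sup>2 + (g x)\<^sup>2 - 2 * (f x * g x)) = (\<lambda>x. (f x - g x)\<^sup>2)"
    by (auto simp: power2_eq_square algebra_simps)
  finally have 1: "(sqrt u - sqrt v)\<^sup>2 \<le> av J (\<lambda>x. (f x - g x)\<^sup>2)" .
  have 2: "av J (\<lambda>x. (f x)\<^sup>2 * ln ((f x)\<^sup>2)) - u * ln u \<le> energy J f"
    unfolding u_def by (rule insert.IH)
  have 3: "av J (\<lambda>x. (g x)\<^sup>2 * ln ((g x)\<^sup>2)) - v * ln v \<le> energy J g"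
    unfolding v_def by (rule insert.IH)
  have "av (insert i J) (\<lambda>x. (f x)\<^sup>2 * ln ((f x)\<^sup>2)) - av (insert i J) (\<lambda>x. (f x)\<^sup>2) * ln (av (insert i J) (\<lambda>x. (f x)\<^sup>2))
     = (av J (\<lambda>x. (f x)\<^sup>2 * ln ((f x)\<^sup>2)) + av J (\<lambda>x. (g x)\<^sup>2 * ln ((g x)\<^sup>2))) / 2 - (u + v) / 2 * ln ((u + v) / 2)"
    by (simp add: av_insert[OF insert.hyps] g_def u_def v_def)
  also have "\<dots> \<le> (energy J f + energy J g) / 2 + (sqrt u - sqrt v)\<^sup>2"
    using two_point_log_Sobolev[OF uv] 2 3 by (simp add: field_simps)
  also have "\<dots> \<le> (energy J f + energy J g) / 2 + av J (\<lambda>x. (f x - g x)\<^sup>2)"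
    using 1 by simp
  also have "\<dots> = energy (insert i J) f"
    by (simp add: energy_insert[OF insert.hyps] g_def)
  finally show ?case .
qed

text \<open>The logarithmic Sobolev inequality and convexity give
  \<open>energy J g \<ge> A * ln (A / a\<^sup>2)\<close>, where \<open>A\<close> is the squared L2
  norm and \<open>a\<close> the L1 norm. Linearising the logarithm with a free parameter
  \<open>s\<close> makes such bounds additive when one \<open>s\<close> serves several
  functions.\<close>

lemma energy_ge_L2_L1:
  assumes "finite J" "s > 0"
  shows "av J (\<lambda>x. (g x)\<^sup>2) * (ln s + 1) - s * (av J (\<lambda>x. \<bar>g x\<bar>))\<^sup>2 \<le> energy J g"
proof -
  define A a where "A = av J (\<lambda>x. (g x)\<^sup>2)" and "a = av J (\<lambda>x. \<bar>g x\<bar>)"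
  have "energy J g \<ge> 0"
    unfolding energy_def by (intro sum_nonneg av_nonneg) auto
  have "A \<ge> 0" "a \<ge> 0"
    unfolding A_def a_def by (auto intro: av_nonneg)
  show ?thesis
  proof (cases "A = 0")
    case True
    then show ?thesis
      using \<open>energy J g \<ge> 0\<close> assms by (simp add: A_def[symmetric]) (smt (verit) zero_le_power2 mult_nonneg_nonneg)
  next
    case False
    then have "A > 0" using \<open>A \<ge> 0\<close> by simp
    have "a > 0"
    proof (rule ccontr)
      assume "\<not> a > 0"
      then have "a = 0" using \<open>a \<ge> 0\<close> by simp
      then have "(\<Sum>x\<in>Pow J. \<bar>g x\<bar>) = 0" by (simp add: a_def av_def)
      then have "\<forall>x\<in>Pow J. g x = 0"
        using sum_nonneg_eq_0_iff[of "Pow J" "\<lambda>x. \<bar>g x\<bar>"] assms by simp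
      then have "A = 0" by (simp add: A_def av_def)
      then show False using False by simp
    qed
    \<comment> \<open>For this value the last two terms of the pointwise bound cancel after
      averaging.\<close>
    define \<tau> where "\<tau> = A / a"
    have "\<tau> > 0" using \<open>A > 0\<close> \<open>a > 0\<close> by (simp add: \<tau>_def)
    have pt: "(g x)\<^sup>2 * ln ((g x)\<^sup>2) \<ge> 2 * ln \<tau> * (g x)\<^sup>2 + 2 * (g x)\<^sup>2 - 2 * \<tau> * \<bar>g x\<bar>" for x
    proof (cases "g x = 0")
      case False
      define y where "y = \<bar>g x\<bar>"
      have "y > 0" using False by (simp add: y_def)
      have "ln (\<tau> / y) \<le> \<tau> / y - 1" using \<open>y > 0\<close> \<open>\<tau> > 0\<close> by (intro ln_le_minus_one) simp
      then have "ln y \<ge> ln \<tau> + 1 - \<tau> / y" using \<open>y > 0\<close> \<open>\<tau> > 0\<close> by (simp add: ln_div)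
      then have "y\<^sup>2 * (2 * ln y) \<ge> y\<^sup>2 * (2 * (ln \<tau> + 1 - \<tau> / y))"
        by (intro mult_left_mono) auto
      moreover have "ln (y\<^sup>2) = 2 * ln y" using \<open>y > 0\<close> by (simp add: ln_realpow)
      ultimately have "y\<^sup>2 * ln (y\<^sup>2) \<ge> 2 * ln \<tau> * y\<^sup>2 + 2 * y\<^sup>2 - 2 * \<tau> * y"
        using \<open>y > 0\<close> by (simp add: algebra_simps power2_eq_square)
      then show ?thesis by (simp add: y_def)
    qed simp
    have "2 * ln \<tau> * A + 2 * A - 2 * \<tau> * a = av J (\<lambda>x. 2 * ln \<tau> * (g x)\<^sup>2 + 2 * (g x)\<^sup>2 - 2 * \<tau> * \<bar>g x\<bar>)"
      by (simp only: av_add av_diff av_cmult A_def a_def)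
    also have "\<dots> \<le> av J (\<lambda>x. (g x)\<^sup>2 * ln ((g x)\<^sup>2))"
      using pt by (intro av_mono) auto
    finally have "2 * ln \<tau> * A \<le> av J (\<lambda>x. (g x)\<^sup>2 * ln ((g x)\<^sup>2))"
      using \<open>a > 0\<close> by (simp add: \<tau>_def)
    moreover have "av J (\<lambda>x. (g x)\<^sup>2 * ln ((g x)\<^sup>2)) - A * ln A \<le> energy J g"
      unfolding A_def by (rule log_Sobolev_cube[OF assms(1)])
    moreover have "A * (ln s + 1) - s * a\<^sup>2 \<le> 2 * ln \<tau> * A - A * ln A"
    proof -
      have "ln (s * a\<^sup>2 / A) \<le> s * a\<^sup>2 / A - 1"
        using assms \<open>a > 0\<close> \<open>A > 0\<close> by (intro ln_le_minus_one) simp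
      then have "ln s + 2 * ln a - ln A \<le> s * a\<^sup>2 / A - 1"
        using assms \<open>a > 0\<close> \<open>A > 0\<close> by (simp add: ln_div ln_mult ln_realpow)
      then have "A * (ln s + 2 * ln a - ln A) \<le> A * (s * a\<^sup>2 / A - 1)"
        using \<open>A > 0\<close> by (intro mult_left_mono) auto
      then show ?thesis
        using \<open>a > 0\<close> \<open>A > 0\<close> by (simp add: \<tau>_def ln_div algebra_simps)
    qed
    ultimately show ?thesis by (simp add: A_def a_def)
  qed
qed

text \<open>Peeling off coordinate \<open>i\<close> writes \<open>f\<close> as \<open>m + h\<close>
  and \<open>m - h\<close> on the two faces, so the functions \<open>h\<close> are the martingale
  differences of \<open>f\<close>. The variance splits, the energy splits up to the discarded term
  of direction \<open>i\<close>, and \<open>B i\<close> is twice the L1 norm of \<open>h\<close>.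
  The logarithmic Sobolev inequality is thus applied to each difference instead of to
  \<open>f\<close>.\<close>

theorem Falik_Samorodnitsky:
  assumes "finite J" "s > 0"
  shows "(av J (\<lambda>x. (f x)\<^sup>2) - (av J f)\<^sup>2) * (ln s + 1)
      - s / 4 * (\<Sum>j\<in>J. (av J (\<lambda>x. \<bar>f x - f (flip j x)\<bar>))\<^sup>2) \<le> energy J f"
  using assms(1)
proof (induction J arbitrary: f rule: finite_induct)
  case empty
  then show ?case by (simp add: energy_def)
next
  case (insert i J)
  define f1 where "f1 = (\<lambda>x. f (insert i x))"
  define m where "m = (\<lambda>x. (f x + f1 x) / 2)"
  define h where "h = (\<lambda>x. (f x - f1 x) / 2)"
  define b where "b = (\<lambda>j. av J (\<lambda>x. \<bar>m x - m (flip j x)\<bar>))"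
  define B where "B = (\<lambda>j. av (insert i J) (\<lambda>x. \<bar>f x - f (flip j x)\<bar>))"
  have var: "av (insert i J) (\<lambda>x. (f x)\<^sup>2) - (av (insert i J) f)\<^sup>2
     = (av J (\<lambda>x. (m x)\<^sup>2) - (av J m)\<^sup>2) + av J (\<lambda>x. (h x)\<^sup>2)"
  proof -
    have "(\<lambda>x. (m x)\<^sup>2 + (h x)\<^sup>2) = (\<lambda>x. ((f x)\<^sup>2 + (f1 x)\<^sup>2) / 2)"
      by (auto simp: m_def h_def power2_eq_square field_simps)
    then have "av J (\<lambda>x. (m x)\<^sup>2) + av J (\<lambda>x. (h x)\<^sup>2) = av (insert i J) (\<lambda>x. (f x)\<^sup>2)"
      by (simp add: av_add[symmetric] av_divide av_insert[OF insert.hyps] f1_def)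
    moreover have "av J m = av (insert i J) f"
      by (simp add: m_def av_divide av_add av_insert[OF insert.hyps] f1_def)
    ultimately show ?thesis by simp
  qed
  have Bi: "(B i)\<^sup>2 = 4 * (av J (\<lambda>x. \<bar>h x\<bar>))\<^sup>2"
  proof -
    have "av J (\<lambda>x. \<bar>f x - f (flip i x)\<bar>) = av J (\<lambda>x. 2 * \<bar>h x\<bar>)"
      by (rule av_cong) (use insert.hyps in \<open>auto simp: flip_def h_def f1_def\<close>)
    moreover have "av J (\<lambda>x. \<bar>f (insert i x) - f (flip i (insert i x))\<bar>) = av J (\<lambda>x. 2 * \<bar>h x\<bar>)"
    proof (rule av_cong)
      fix x assume "x \<subseteq> J"
      then have "flip i (insert i x) = x" using insert.hyps by (auto simp: flip_def)
      then show "\<bar>f (insert i x) - f (flip i (insert i x))\<bar> = 2 * \<bar>h x\<bar>"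
        by (simp add: h_def f1_def)
    qed
    ultimately have "B i = 2 * av J (\<lambda>x. \<bar>h x\<bar>)"
      by (simp add: B_def av_insert[OF insert.hyps] av_cmult)
    then show ?thesis by (simp add: power_mult_distrib)
  qed
  have Bj: "(b j)\<^sup>2 \<le> (B j)\<^sup>2" if "j \<in> J" for j
  proof (rule power_mono)
    have "j \<noteq> i" using that insert.hyps by auto
    have "b j \<le> av J (\<lambda>x. (\<bar>f x - f (flip j x)\<bar> + \<bar>f1 x - f1 (flip j x)\<bar>) / 2)"
      unfolding b_def
    proof (rule av_mono)
      fix x
      have "m x - m (flip j x) = ((f x - f (flip j x)) + (f1 x - f1 (flip j x))) / 2"
        by (simp add: m_def field_simps)
      then show "\<bar>m x - m (flip j x)\<bar> \<le> (\<bar>f x - f (flip j x)\<bar> + \<bar>f1 x - f1 (flip j x)\<bar>) / 2"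
        by (simp add: abs_if)
    qed
    also have "\<dots> = B j"
      using \<open>j \<noteq> i\<close> by (simp add: B_def av_insert[OF insert.hyps] f1_def av_divide av_add flip_insert)
    finally show "b j \<le> B j" .
    show "0 \<le> b j" unfolding b_def by (rule av_nonneg) simp
  qed
  have en: "energy (insert i J) f \<ge> energy J m + energy J h"
  proof -
    have "energy J m + energy J h = (\<Sum>j\<in>J. av J (\<lambda>x. (m x - m (flip j x))\<^sup>2 + (h x - h (flip j x))\<^sup>2))"
      by (simp add: energy_def sum.distrib av_add)
    also have "\<dots> = (\<Sum>j\<in>J. av J (\<lambda>x. ((f x - f (flip j x))\<^sup>2 + (f1 x - f1 (flip j x))\<^sup>2) / 2))"
      by (rule sum.cong[OF refl], rule av_cong) (simp add: m_def h_def power2_eq_square field_simps)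
    also have "\<dots> = (energy J f + energy J f1) / 2"
      by (simp add: energy_def sum.distrib av_add av_divide sum_divide_distrib[symmetric])
    also have "\<dots> \<le> energy (insert i J) f"
      unfolding energy_insert[OF insert.hyps] f1_def by (simp add: av_nonneg)
    finally show ?thesis .
  qed
  have "s / 4 * (\<Sum>j\<in>J. (b j)\<^sup>2) \<le> s / 4 * (\<Sum>j\<in>J. (B j)\<^sup>2)"
    using assms(2) Bj by (intro mult_left_mono sum_mono) auto
  then have "(av (insert i J) (\<lambda>x. (f x)\<^sup>2) - (av (insert i J) f)\<^sup>2) * (ln s + 1)
      - s / 4 * (\<Sum>j\<in>insert i J. (B j)\<^sup>2)
    \<le> ((av J (\<lambda>x. (m x)\<^sup>2) - (av J m)\<^sup>2) * (ln s + 1) - s / 4 * (\<Sum>j\<in>J. (b j)\<^sup>2))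
      + (av J (\<lambda>x. (h x)\<^sup>2) * (ln s + 1) - s * (av J (\<lambda>x. \<bar>h x\<bar>))\<^sup>2)"
    unfolding var using insert.hyps Bi by (simp add: algebra_simps)
  also have "\<dots> \<le> energy J m + energy J h"
    using insert.IH[of m] energy_ge_L2_L1[OF insert.hyps(1) assms(2), of h]
    unfolding b_def by (intro add_mono) auto
  finally show ?case
    using en by (simp add: B_def)
qed

section \<open>Binary entropy\<close>

definition binent :: "real \<Rightarrow> real" where
  "binent q = - (q * log 2 q) - (1 - q) * log 2 (1 - q)"

lemma binent_sym: "binent (1 - q) = binent q"
  by (simp add: binent_def)

lemma log2_le: "z > 0 \<Longrightarrow> log 2 z \<le> 3 / 2 * z"
proof -
  assume "z > 0"
  have "ln z \<le> z" using ln_le_minus_one[OF \<open>z > 0\<close>] by simp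
  also have "z * 1 \<le> z * (3 / 2 * ln 2)"
    using ln2_ge_two_thirds \<open>z > 0\<close> by (intro mult_left_mono) auto
  finally show ?thesis by (simp add: log_def divide_simps)
qed

text \<open>Both logarithms are replaced by their tangents at 1/2; the factor 3/2 comes from
  \<open>ln 2 \<ge> 2 / 3\<close>.\<close>

lemma binent_ge_quadratic:
  assumes "0 \<le> q" "q \<le> 1"
  shows "binent q \<ge> 1 - 3 / 2 * (1 - 2 * q)\<^sup>2"
proof -
  have "q * ln q \<le> q * ln (1 / 2) + q * (q / (1 / 2) - 1)"
    "(1 - q) * ln (1 - q) \<le> (1 - q) * ln (1 / 2) + (1 - q) * ((1 - q) / (1 / 2) - 1)"
    using assms by (intro ln_mult_ge; simp)+
  then have "q * ln q + (1 - q) * ln (1 - q) \<le> - ln 2 + (1 - 2 * q)\<^sup>2"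
    by (simp add: ln_div algebra_simps power2_eq_square)
  moreover have "(1 - 2 * q)\<^sup>2 * 1 \<le> (1 - 2 * q)\<^sup>2 * (3 / 2 * ln 2)"
    using ln2_ge_two_thirds by (intro mult_left_mono) auto
  ultimately have "q * ln q + (1 - q) * ln (1 - q) \<le> ln 2 * (3 / 2 * (1 - 2 * q)\<^sup>2 - 1)"
    by (simp add: algebra_simps)
  moreover have "q * ln q + (1 - q) * ln (1 - q) = ln 2 * (- binent q)"
    by (simp add: binent_def log_def field_simps)
  ultimately have "ln 2 * (- binent q) \<le> ln 2 * (3 / 2 * (1 - 2 * q)\<^sup>2 - 1)"
    by linarith
  then have "- binent q \<le> 3 / 2 * (1 - 2 * q)\<^sup>2 - 1"
    by (rule mult_left_le_imp_le) simp
  then show ?thesis by simp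
qed

lemma binent_ge_log:
  assumes "0 < q" "q \<le> 1"
  shows "binent q \<ge> q * log 2 (1 / q)"
proof -
  have "(1 - q) * log 2 (1 - q) \<le> 0"
  proof (cases "q = 1")
    case False
    then show ?thesis using assms by (intro mult_nonneg_nonpos) auto
  qed simp
  then show ?thesis using assms by (simp add: binent_def log_divide)
qed

text \<open>The first term of the entropy gives \<open>2 * q\<close> because
  \<open>q \<le> 1 / 4\<close>, the second gives \<open>q\<close> because
  \<open>1 - q \<ge> 3 / 4 > ln 2\<close>.\<close>

lemma binent_ge_triple:
  assumes "0 \<le> q" "q \<le> 1 / 4"
  shows "binent q \<ge> 3 * q"
proof (cases "q = 0")
  case True
  then show ?thesis by (simp add: binent_def)
next
  case False
  have "log 2 q \<le> log 2 (2 powr (-2))"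
    using False assms by (subst log_le_cancel_iff) (auto simp: powr_minus)
  then have "log 2 q \<le> - 2" by simp
  then have 1: "q * log 2 q \<le> q * (- 2)" using assms by (intro mult_left_mono) auto
  have "ln (1 - q) \<le> - q" using ln_le_minus_one[of "1 - q"] assms by simp
  then have "(1 - q) * ln (1 - q) \<le> (1 - q) * (- q)" using assms by (intro mult_left_mono) auto
  also have "\<dots> \<le> (3 / 4) * (- q)" using assms by (intro mult_right_mono_neg) auto
  also have "\<dots> \<le> ln 2 * (- q)" using assms ln2_le_25_over_36 by (intro mult_right_mono_neg) auto
  finally have "(1 - q) * log 2 (1 - q) \<le> - q"
    by (simp add: log_def pos_divide_le_eq mult.commute)
  then show ?thesis using 1 by (simp add: binent_def)
qed

text \<open>Here and in the next lemma \<open>q\<close> is the fraction of a set containing a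
  coordinate and \<open>p\<close> the fraction that leaves the set when it is flipped. Points that
  stay come in pairs, whence the two hypotheses on \<open>1 - p\<close>. They force
  \<open>\<bar>1 - 2 * q\<bar> \<le> p\<close>, and the quadratic entropy bound leaves
  \<open>p - 3 / 2 * p\<^sup>2\<close>.\<close>

lemma gain_ge_of_small_influence:
  assumes "0 \<le> q" "q \<le> 1" "1 - p \<le> 2 * q" "1 - p \<le> 2 * (1 - q)" "p < 1 / 2"
  shows "p / 4 \<le> binent q - (1 - p)"
proof -
  have "(1 - 2 * q)\<^sup>2 \<le> p\<^sup>2" using assms by (intro abs_le_square_iff[THEN iffD1]) auto
  also have "\<dots> \<le> p * (1 / 2)" unfolding power2_eq_square using assms by (intro mult_left_mono) auto
  finally show ?thesis using binent_ge_quadratic[OF assms(1,2)] by simp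
qed

text \<open>For \<open>q \<le> 1 / 4\<close> the entropy is at least \<open>3 * q\<close> and
  staying points take at most \<open>2 * q\<close> of it. For \<open>q\<close> between 1/4 and 1/2
  the entropy is at least 5/8 and \<open>1 - p\<close> at most 1/2, which contradicts a gain below
  1/8. Values above 1/2 follow by symmetry.\<close>

lemma min_le_gain_of_large_influence:
  assumes "0 \<le> q" "q \<le> 1" "1 - p \<le> 2 * q" "1 - p \<le> 2 * (1 - q)" "p \<ge> 1 / 2"
    and "binent q - (1 - p) < 1 / 8"
  shows "min q (1 - q) \<le> binent q - (1 - p)"
proof -
  have *: "min q (1 - q) \<le> binent q - (1 - p)"
    if "0 \<le> q" "q \<le> 1 / 2" "1 - p \<le> 2 * q" "binent q - (1 - p) < 1 / 8" for q
  proof (cases "q \<le> 1 / 4")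
    case True
    then show ?thesis using binent_ge_triple[of q] that by simp
  next
    case False
    then have "(1 - 2 * q)\<^sup>2 \<le> (1 / 2)\<^sup>2" using that by (intro power_mono) auto
    then show ?thesis using binent_ge_quadratic[of q] that assms(5) by (simp add: power2_eq_square)
  qed
  show ?thesis
  proof (cases "q \<le> 1 / 2")
    case True
    then show ?thesis using *[of q] assms by simp
  next
    case False
    then show ?thesis using *[of "1 - q"] assms by (simp add: binent_sym min.commute)
  qed
qed

section \<open>Excess boundary and marginal entropies\<close>

definition stay :: "'a \<Rightarrow> 'a set set \<Rightarrow> 'a set set" where
  "stay i A = {x \<in> A. flip i x \<in> A}"

text \<open>The dimension has cancelled: the number of boundary edges is
  \<open>card J * card A\<close> minus the sum, and the first term is removed by
  \<open>log 2 (2 ^ card J)\<close>.\<close>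

definition excess :: "'a set \<Rightarrow> 'a set set \<Rightarrow> real" where
  "excess J A = card A * log 2 (card A) - (\<Sum>i\<in>J. real (card (stay i A)))"

text \<open>The two terms are the entropy of \<open>X_i\<close> and its conditional entropy given
  all other coordinates, which is one bit exactly at the points of \<open>stay i A\<close>. The gain
  is the mutual information between coordinate \<open>i\<close> and the rest.\<close>

definition gain :: "'a \<Rightarrow> 'a set set \<Rightarrow> real" where
  "gain i A = binent (card {x \<in> A. i \<in> x} / card A) - card (stay i A) / card A"

definition cls :: "'a set set \<Rightarrow> 'a set \<Rightarrow> 'a set \<Rightarrow> 'a set set" where
  "cls A R x = {u \<in> A. u \<inter> R = x \<inter> R}"

text \<open>\<open>|A|\<close> times the Shannon entropy of \<open>X \<inter> R\<close>, for \<open>X\<close> uniform on \<open>A\<close>.\<close>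

definition margent :: "'a set set \<Rightarrow> 'a set \<Rightarrow> real" where
  "margent A R = (\<Sum>x\<in>A. log 2 (card A / card (cls A R x)))"

text \<open>Interpolates between 0 and the excess. The subtracted conditional entropies are given
  all other coordinates, not only those in \<open>R\<close>; this makes the function both monotone
  and submodular in \<open>R\<close>.\<close>

definition partial_excess :: "'a set set \<Rightarrow> 'a set \<Rightarrow> real" where
  "partial_excess A R = margent A R - (\<Sum>i\<in>R. real (card (stay i A)))"

section \<open>Splitting along one coordinate\<close>

lemma sum_split_mem:
  fixes f :: "'a set \<Rightarrow> real"
  assumes "finite A"
  shows "sum f A = sum f {x \<in> A. i \<in> x} + sum f {x \<in> A. i \<notin> x}"
proof -
  have "sum f ({x \<in> A. i \<in> x} \<union> {x \<in> A. i \<notin> x}) = sum f {x \<in> A. i \<in> x} + sum f {x \<in> A. i \<notin> x}"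
    using assms by (intro sum.union_disjoint) auto
  moreover have "{x \<in> A. i \<in> x} \<union> {x \<in> A. i \<notin> x} = A" by auto
  ultimately show ?thesis by simp
qed

lemma card_split_mem:
  assumes "finite A"
  shows "card A = card {x \<in> A. i \<in> x} + card {x \<in> A. i \<notin> x}"
proof -
  have "real (card A) = real (card {x \<in> A. i \<in> x} + card {x \<in> A. i \<notin> x})"
    using sum_split_mem[OF assms, of "\<lambda>_. 1"] by simp
  then show ?thesis by (rule of_nat_eq_iff[THEN iffD1])
qed

text \<open>Flipping \<open>i\<close> matches the points of \<open>stay i A\<close> that contain
  \<open>i\<close> with those that do not.\<close>

lemma card_stay_le:
  assumes "finite A"
  shows "card (stay i A) \<le> 2 * card {x \<in> A. i \<in> x}" "card (stay i A) \<le> 2 * card {x \<in> A. i \<notin> x}"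
proof -
  have s: "card (stay i A) = card {x \<in> stay i A. i \<in> x} + card {x \<in> stay i A. i \<notin> x}"
    using assms by (intro card_split_mem) (auto simp: stay_def)
  have "bij_betw (flip i) {x \<in> stay i A. i \<in> x} {x \<in> stay i A. i \<notin> x}"
    by (rule bij_betw_byWitness[where f' = "flip i"]) (auto simp: stay_def mem_flip_iff)
  then have e: "card {x \<in> stay i A. i \<in> x} = card {x \<in> stay i A. i \<notin> x}"
    by (rule bij_betw_same_card)
  have "card {x \<in> stay i A. i \<in> x} \<le> card {x \<in> A. i \<in> x}"
    "card {x \<in> stay i A. i \<notin> x} \<le> card {x \<in> A. i \<notin> x}"
    using assms by (auto intro!: card_mono simp: stay_def)
  with s e show "card (stay i A) \<le> 2 * card {x \<in> A. i \<in> x}" "card (stay i A) \<le> 2 * card {x \<in> A. i \<notin> x}"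
    by auto
qed

lemma gain_bounds:
  assumes "finite A" "A \<noteq> {}" and q: "q = card {x \<in> A. i \<in> x} / card A"
    and p: "p = 1 - card (stay i A) / card A"
  shows "0 \<le> q" "q \<le> 1" "1 - p \<le> 2 * q" "1 - p \<le> 2 * (1 - q)" "gain i A = binent q - (1 - p)" "0 \<le> p" "p \<le> 1"
proof -
  have A: "real (card A) > 0" using assms by (simp add: card_gt_0_iff)
  have s: "real (card A) = card {x \<in> A. i \<in> x} + real (card {x \<in> A. i \<notin> x})"
    using card_split_mem[OF assms(1)] by (metis of_nat_add)
  have l: "real (card (stay i A)) \<le> 2 * card {x \<in> A. i \<in> x}" "real (card (stay i A)) \<le> 2 * card {x \<in> A. i \<notin> x}"
    using card_stay_le[OF assms(1)] by (metis of_nat_le_iff of_nat_mult of_nat_numeral)+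
  show "0 \<le> q" using q by simp
  show "q \<le> 1" using A s unfolding q by (simp add: divide_le_eq)
  show "1 - p \<le> 2 * q" using A l(1) unfolding p q by (simp add: field_simps)
  have "1 - q = card {x \<in> A. i \<notin> x} / card A" using A s unfolding q by (simp add: diff_divide_eq_iff)
  then show "1 - p \<le> 2 * (1 - q)" using A l(2) unfolding p by (simp add: field_simps)
  show "gain i A = binent q - (1 - p)" by (simp add: gain_def q p)
  have "card (stay i A) \<le> card A" using assms by (intro card_mono) (auto simp: stay_def)
  then show "0 \<le> p" using A by (simp add: p)
  show "p \<le> 1" by (simp add: p)
qed

lemma gain_nonneg:
  assumes "finite A" "A \<noteq> {}"
  shows "0 \<le> gain i A"
proof -
  note h = gain_bounds[OF assms refl refl, of i]
  show ?thesis
    using gain_ge_of_small_influence[OF h(1-4)] min_le_gain_of_large_influence[OF h(1-4)] h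
    by (smt (verit) divide_nonneg_nonneg)
qed

lemma binent_card:
  assumes "finite A" "A \<noteq> {}"
  shows "card A * binent (card {x \<in> A. i \<in> x} / card A)
    = card A * log 2 (card A) - card {x \<in> A. i \<in> x} * log 2 (card {x \<in> A. i \<in> x})
      - card {x \<in> A. i \<notin> x} * log 2 (card {x \<in> A. i \<notin> x})"
proof -
  define N a b where "N = real (card A)" and "a = real (card {x \<in> A. i \<in> x})" and "b = real (card {x \<in> A. i \<notin> x})"
  have N: "N > 0" using assms by (simp add: N_def card_gt_0_iff)
  have s: "N = a + b" using card_split_mem[OF assms(1), of i] by (simp add: N_def a_def b_def)
  have ab: "a \<ge> 0" "b \<ge> 0" by (auto simp: a_def b_def)
  have c: "1 - a / N = b / N" using s N by (simp add: field_simps)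
  have l: "N * (y / N * log 2 (y / N)) = y * log 2 y - y * log 2 N" if "y \<ge> 0" for y
    using that N by (cases "y = 0") (auto simp: log_divide algebra_simps)
  have "N * binent (a / N) = - (N * (a / N * log 2 (a / N))) - N * (b / N * log 2 (b / N))"
    by (simp add: binent_def c algebra_simps)
  also have "\<dots> = N * log 2 N - a * log 2 a - b * log 2 b"
    unfolding l[OF ab(1)] l[OF ab(2)] using s by (simp add: algebra_simps)
  finally show ?thesis unfolding N_def a_def b_def .
qed

text \<open>Flips of \<open>j \<noteq> i\<close> respect the two halves, so their staying points are
  shared out between the halves, while within a half nothing stays in direction \<open>i\<close>.
  What remains is the entropy of the split minus the points of \<open>stay i A\<close>.\<close>

lemma excess_split:
  assumes "finite J" "i \<in> J" "finite A" "A \<noteq> {}"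
  shows "excess J A = excess J {x \<in> A. i \<in> x} + excess J {x \<in> A. i \<notin> x} + card A * gain i A"
proof -
  define A1 A0 where "A1 = {x \<in> A. i \<in> x}" and "A0 = {x \<in> A. i \<notin> x}"
  have st: "real (card (stay j A)) = card (stay j A1) + card (stay j A0)" if "j \<noteq> i" for j
  proof -
    have "stay j A1 = {x \<in> stay j A. i \<in> x}" "stay j A0 = {x \<in> stay j A. i \<notin> x}"
      using that by (auto simp: stay_def A1_def A0_def mem_flip_iff)
    moreover have "finite (stay j A)" using assms by (simp add: stay_def)
    ultimately show ?thesis using card_split_mem[of "stay j A" i] by simp
  qed
  have si: "stay i A1 = {}" "stay i A0 = {}"
    by (auto simp: stay_def A1_def A0_def mem_flip_iff)
  have sum: "(\<Sum>j\<in>J. real (card (stay j B))) = card (stay i B) + (\<Sum>j\<in>J - {i}. real (card (stay j B)))" for B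
    using assms by (simp add: sum.remove)
  have "(\<Sum>j\<in>J. real (card (stay j A))) = card (stay i A) + (\<Sum>j\<in>J. real (card (stay j A1))) + (\<Sum>j\<in>J. real (card (stay j A0)))"
    unfolding sum si by (simp add: sum.distrib[symmetric]) (rule sum.cong, auto simp: st)
  moreover have "card A * gain i A = card A * binent (card A1 / card A) - card (stay i A)"
    using assms by (simp add: gain_def A1_def right_diff_distrib)
  ultimately show ?thesis
    unfolding A1_def[symmetric] A0_def[symmetric]
    using binent_card[OF assms(3,4), of i] by (simp add: excess_def A1_def A0_def)
qed

lemma excess_empty [simp]: "excess J {} = 0"
  by (simp add: excess_def stay_def)

section \<open>Fibres over a set of coordinates and their Shannon inequalities\<close>

locale cube_set =
  fixes J :: "'a set" and A :: "'a set set"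
  assumes fin_J: "finite J" and A_subset: "A \<subseteq> Pow J" and A_nonempty: "A \<noteq> {}"
begin

lemma fin_A: "finite A"
  using A_subset fin_J finite_subset by auto

lemma card_A_pos: "real (card A) > 0"
  using fin_A A_nonempty by (simp add: card_gt_0_iff)

lemma fin_cls [simp]: "finite (cls A R x)"
  using fin_A by (simp add: cls_def)

lemma card_cls_pos: "x \<in> A \<Longrightarrow> real (card (cls A R x)) > 0"
  by (simp add: card_gt_0_iff) (auto simp: cls_def)

lemma cls_eq: "u \<in> cls A R x \<Longrightarrow> cls A R u = cls A R x"
  by (auto simp: cls_def)

lemma cls_sym: "x \<in> A \<Longrightarrow> u \<in> A \<Longrightarrow> u \<in> cls A R x \<longleftrightarrow> x \<in> cls A R u"
  by (auto simp: cls_def)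

lemma cls_full: "x \<in> A \<Longrightarrow> cls A J x = {x}"
  using A_subset by (auto simp: cls_def)

lemma cls_empty: "cls A {} x = A"
  by (auto simp: cls_def)

text \<open>The tower property of conditional expectation, from exchanging the two sums.\<close>

lemma sum_cls:
  fixes F :: "'a set \<Rightarrow> real"
  shows "(\<Sum>x\<in>A. F x) = (\<Sum>x\<in>A. (\<Sum>u\<in>cls A R x. F u) / card (cls A R x))"
proof -
  have "(\<Sum>x\<in>A. (\<Sum>u\<in>cls A R x. F u) / card (cls A R x))
    = (\<Sum>x\<in>A. \<Sum>u\<in>A. if u \<in> cls A R x then F u / card (cls A R x) else 0)"
  proof (rule sum.cong[OF refl])
    fix x assume "x \<in> A"
    have "cls A R x = A \<inter> {u. u \<in> cls A R x}" by (auto simp: cls_def)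
    then have "(\<Sum>u\<in>cls A R x. F u / card (cls A R x)) = (\<Sum>u\<in>A. if u \<in> cls A R x then F u / card (cls A R x) else 0)"
      using fin_A by (simp add: sum.inter_restrict[symmetric] Int_def)
    then show "(\<Sum>u\<in>cls A R x. F u) / card (cls A R x) = (\<Sum>u\<in>A. if u \<in> cls A R x then F u / card (cls A R x) else 0)"
      by (simp add: sum_divide_distrib)
  qed
  also have "\<dots> = (\<Sum>u\<in>A. \<Sum>x\<in>A. if u \<in> cls A R x then F u / card (cls A R x) else 0)"
    by (rule sum.swap)
  also have "\<dots> = (\<Sum>u\<in>A. F u)"
  proof (rule sum.cong[OF refl])
    fix u assume u: "u \<in> A"
    have "(\<Sum>x\<in>A. if u \<in> cls A R x then F u / card (cls A R x) else 0)
      = (\<Sum>x\<in>A. if x \<in> cls A R u then F u / card (cls A R u) else 0)"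
    proof (rule sum.cong[OF refl])
      fix x assume "x \<in> A"
      then show "(if u \<in> cls A R x then F u / card (cls A R x) else 0)
        = (if x \<in> cls A R u then F u / card (cls A R u) else 0)"
        using cls_sym[OF _ u, of x R] cls_eq[of u R x] by auto
    qed
    also have "\<dots> = (\<Sum>x\<in>{x \<in> A. x \<in> cls A R u}. F u / card (cls A R u))"
      by (rule sum.inter_filter[OF fin_A, symmetric])
    also have "{x \<in> A. x \<in> cls A R u} = cls A R u"
      by (auto simp: cls_def)
    finally show "(\<Sum>x\<in>A. if u \<in> cls A R x then F u / card (cls A R x) else 0) = F u"
      using card_cls_pos[OF u, of R] by (auto simp: card_gt_0_iff)
  qed
  finally show ?thesis by simp
qed

text \<open>For \<open>c\<^sub>R(x) = |cls A R x|\<close>, the product \<open>c\<^sub>P(x) c\<^sub>Q(x)\<close> counts pairs \<open>(u, w)\<close> that agree with \<open>x\<close> on \<open>P\<close> and on \<open>Q\<close> respectively; for a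
  fixed pair all such \<open>x\<close> lie in one class of \<open>P \<union> Q\<close>.\<close>

lemma sum_card_cls_ratio_le:
  "(\<Sum>x\<in>A. card (cls A P x) * card (cls A Q x) / (real (card (cls A (P \<union> Q) x)) * card (cls A (P \<inter> Q) x))) \<le> card A"
proof -
  define c where "c = (\<lambda>R x. real (card (cls A R x)))"
  define r where "r = (\<lambda>R x u. of_bool (u \<in> cls A R x) :: real)"
  have c_sum: "c R x = (\<Sum>u\<in>A. r R x u)" for R x
  proof -
    have "(\<Sum>u\<in>A. r R x u) = card (A \<inter> {u. u \<in> cls A R x})"
      using fin_A by (simp add: r_def sum_of_bool_eq)
    moreover have "A \<inter> {u. u \<in> cls A R x} = cls A R x" by (auto simp: cls_def)
    ultimately show ?thesis by (simp add: c_def)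
  qed
  have pos: "c R x > 0" if "x \<in> A" for R x using card_cls_pos that by (simp add: c_def)
  have inner: "(\<Sum>x\<in>A. r P x u * r Q x w / (c (P \<union> Q) x * c (P \<inter> Q) x)) \<le> r (P \<inter> Q) u w / c (P \<inter> Q) u"
    if u: "u \<in> A" and w: "w \<in> A" for u w
  proof (cases "\<exists>z\<in>A. u \<in> cls A P z \<and> w \<in> cls A Q z")
    case False
    then have "r P x u * r Q x w / (c (P \<union> Q) x * c (P \<inter> Q) x) = 0" if "x \<in> A" for x
      using that by (auto simp: r_def)
    then have "(\<Sum>x\<in>A. r P x u * r Q x w / (c (P \<union> Q) x * c (P \<inter> Q) x)) = 0"
      by (rule sum.neutral[rule_format])
    then show ?thesis using pos[OF u, of "P \<inter> Q"] by (simp add: r_def)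
  next
    case True
    then obtain z where z: "z \<in> A" "u \<in> cls A P z" "w \<in> cls A Q z" by auto
    have rw: "r (P \<inter> Q) u w = 1" using z by (auto simp: r_def cls_def)
    have "r P x u * r Q x w / (c (P \<union> Q) x * c (P \<inter> Q) x) = r (P \<union> Q) z x / (c (P \<union> Q) z * c (P \<inter> Q) u)"
      if x: "x \<in> A" for x
    proof (cases "x \<in> cls A (P \<union> Q) z")
      case True
      then have "cls A (P \<union> Q) x = cls A (P \<union> Q) z" by (rule cls_eq)
      moreover have "cls A (P \<inter> Q) x = cls A (P \<inter> Q) u" using True z by (auto simp: cls_def)
      moreover have "u \<in> cls A P x" "w \<in> cls A Q x" using True z by (auto simp: cls_def)
      ultimately show ?thesis using True by (simp add: r_def c_def)
    next
      case False
      then have "\<not> (u \<in> cls A P x \<and> w \<in> cls A Q x)" using x z by (auto simp: cls_def)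
      then show ?thesis using False by (auto simp: r_def)
    qed
    then have "(\<Sum>x\<in>A. r P x u * r Q x w / (c (P \<union> Q) x * c (P \<inter> Q) x))
      = (\<Sum>x\<in>A. r (P \<union> Q) z x / (c (P \<union> Q) z * c (P \<inter> Q) u))"
      by (intro sum.cong) auto
    also have "\<dots> = c (P \<union> Q) z / (c (P \<union> Q) z * c (P \<inter> Q) u)"
      by (simp add: c_sum[of "P \<union> Q" z] sum_divide_distrib)
    also have "\<dots> = r (P \<inter> Q) u w / c (P \<inter> Q) u"
      using pos[OF z(1), of "P \<union> Q"] rw by simp
    finally show ?thesis by simp
  qed
  have "(\<Sum>x\<in>A. c P x * c Q x / (c (P \<union> Q) x * c (P \<inter> Q) x))
    = (\<Sum>x\<in>A. \<Sum>u\<in>A. \<Sum>w\<in>A. r P x u * r Q x w / (c (P \<union> Q) x * c (P \<inter> Q) x))"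
    by (simp add: c_sum[of P] c_sum[of Q] sum_product sum_divide_distrib)
  also have "\<dots> = (\<Sum>u\<in>A. \<Sum>w\<in>A. \<Sum>x\<in>A. r P x u * r Q x w / (c (P \<union> Q) x * c (P \<inter> Q) x))"
    by (subst sum.swap) (intro sum.cong refl sum.swap)
  also have "\<dots> \<le> (\<Sum>u\<in>A. \<Sum>w\<in>A. r (P \<inter> Q) u w / c (P \<inter> Q) u)"
    by (intro sum_mono inner)
  also have "\<dots> = (\<Sum>u\<in>A. c (P \<inter> Q) u / c (P \<inter> Q) u)"
    by (simp add: c_sum[symmetric] sum_divide_distrib[symmetric])
  also have "\<dots> = card A"
    using pos[of _ "P \<inter> Q"] by (simp add: order_less_imp_not_eq2)
  finally show ?thesis by (simp add: c_def)
qed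

text \<open>Nonnegativity of conditional mutual information. The difference of the two sides is a
  sum of logarithms of the ratios in the preceding lemma, so \<open>ln z \<le> z - 1\<close> reduces
  the claim to the bound on the sum of these ratios.\<close>

lemma margent_submodular: "margent A (P \<union> Q) + margent A (P \<inter> Q) \<le> margent A P + margent A Q"
proof -
  define c where "c = (\<lambda>R x. real (card (cls A R x)))"
  define t where "t = (\<lambda>x. c P x * c Q x / (c (P \<union> Q) x * c (P \<inter> Q) x))"
  have pos: "c R x > 0" if "x \<in> A" for R x using card_cls_pos that by (simp add: c_def)
  have "margent A (P \<union> Q) + margent A (P \<inter> Q) - margent A P - margent A Q
    = (\<Sum>x\<in>A. log 2 (card A / c (P \<union> Q) x) + log 2 (card A / c (P \<inter> Q) x) - log 2 (card A / c P x) - log 2 (card A / c Q x))"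
    by (simp add: margent_def c_def sum.distrib sum_subtractf)
  also have "\<dots> = (\<Sum>x\<in>A. ln (t x) / ln 2)"
  proof (rule sum.cong[OF refl])
    fix x assume "x \<in> A"
    then show "log 2 (card A / c (P \<union> Q) x) + log 2 (card A / c (P \<inter> Q) x) - log 2 (card A / c P x) - log 2 (card A / c Q x)
      = ln (t x) / ln 2"
      using pos[of x P] pos[of x Q] pos[of x "P \<union> Q"] pos[of x "P \<inter> Q"] card_A_pos
      by (simp add: log_divide log_mult t_def log_def ln_div ln_mult diff_divide_distrib add_divide_distrib)
  qed
  also have "\<dots> \<le> (\<Sum>x\<in>A. (t x - 1) / ln 2)"
  proof (intro sum_mono divide_right_mono)
    fix x assume "x \<in> A"
    then show "ln (t x) \<le> t x - 1" using pos by (intro ln_le_minus_one) (simp add: t_def)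
  qed simp
  also have "\<dots> = ((\<Sum>x\<in>A. t x) - card A) / ln 2"
    by (simp add: sum_divide_distrib[symmetric] sum_subtractf)
  also have "\<dots> \<le> 0"
    using sum_card_cls_ratio_le[of P Q] by (simp add: t_def c_def divide_le_0_iff)
  finally show ?thesis by simp
qed

lemma margent_empty [simp]: "margent A {} = 0"
  using card_A_pos by (simp add: margent_def cls_empty)

lemma margent_full: "margent A J = card A * log 2 (card A)"
  by (simp add: margent_def cls_full)

text \<open>Given all other coordinates, a point \<open>x\<close> has the completions
  \<open>{x, flip i x} \<inter> A\<close>: one bit of entropy if \<open>x\<close> stays, none
  otherwise.\<close>

lemma margent_minus_single:
  assumes "i \<in> J"
  shows "margent A J - margent A (J - {i}) = card (stay i A)"
proof -
  have "margent A J - margent A (J - {i})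
    = (\<Sum>x\<in>A. log 2 (card A) - log 2 (card A / card (cls A (J - {i}) x)))"
    by (simp add: margent_def cls_full sum_subtractf)
  also have "\<dots> = (\<Sum>x\<in>A. of_bool (flip i x \<in> A))"
  proof (rule sum.cong[OF refl])
    fix x assume x: "x \<in> A"
    have ne: "x \<noteq> flip i x" by (auto simp: flip_def)
    have "cls A (J - {i}) x = {x, flip i x} \<inter> A"
    proof (intro equalityI subsetI)
      fix u assume u: "u \<in> cls A (J - {i}) x"
      then have *: "u \<in> A" "u \<inter> (J - {i}) = x \<inter> (J - {i})" by (auto simp: cls_def)
      have "u \<subseteq> J" "x \<subseteq> J" using * x A_subset by auto
      then have "j \<in> u \<longleftrightarrow> j \<in> x" if "j \<noteq> i" for j using * that by auto
      then have "u = x \<or> u = flip i x" by (auto simp: set_eq_iff mem_flip_iff) metis+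
      then show "u \<in> {x, flip i x} \<inter> A" using * by auto
    next
      fix u assume "u \<in> {x, flip i x} \<inter> A"
      then show "u \<in> cls A (J - {i}) x"
        using flip_Int[of i "J - {i}" x] by (auto simp: cls_def)
    qed
    then have "card (cls A (J - {i}) x) = (if flip i x \<in> A then 2 else 1)"
      using x ne by auto
    then show "log 2 (card A) - log 2 (card A / card (cls A (J - {i}) x)) = of_bool (flip i x \<in> A)"
      using card_A_pos by (simp add: log_divide)
  qed
  also have "\<dots> = card (stay i A)"
    using fin_A by (simp add: sum_of_bool_eq stay_def Int_def)
  finally show ?thesis .
qed

text \<open>Conditioning on \<open>X_R\<close> alone leaves coordinate \<open>i\<close> at least as
  much entropy as conditioning on all others. This is submodularity for \<open>insert i R\<close>
  and \<open>J - {i}\<close>.\<close>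

lemma partial_excess_insert_mono:
  assumes "R \<subseteq> J" "i \<in> J" "i \<notin> R"
  shows "partial_excess A R \<le> partial_excess A (insert i R)"
proof -
  have "insert i R \<union> (J - {i}) = J" "insert i R \<inter> (J - {i}) = R" using assms by auto
  then have "margent A J + margent A R \<le> margent A (insert i R) + margent A (J - {i})"
    using margent_submodular[of "insert i R" "J - {i}"] by simp
  moreover have "finite R" using assms fin_J finite_subset by blast
  ultimately show ?thesis
    using margent_minus_single[OF assms(2)] assms by (simp add: partial_excess_def)
qed

lemma partial_excess_mono:
  assumes "R \<subseteq> S" "S \<subseteq> J"
  shows "partial_excess A R \<le> partial_excess A S"
proof -
  have "finite (S - R)" using assms fin_J finite_subset by blast
  moreover have "S - R \<subseteq> J" using assms by auto
  ultimately have "S - R \<subseteq> J \<longrightarrow> partial_excess A R \<le> partial_excess A (R \<union> (S - R))"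
  proof (induction "S - R" arbitrary: S rule: finite_induct)
    case (insert i F)
    have R: "R \<subseteq> J" using assms by auto
    have *: "R \<union> (S - R) = insert i (R \<union> F)" using insert.hyps(4) by auto
    have e: "(R \<union> F) - R = F" using insert.hyps by auto
    show ?case
    proof
      assume "S - R \<subseteq> J"
      then have FJ: "F \<subseteq> J" "i \<in> J" using insert.hyps(4) by auto
      have "partial_excess A R \<le> partial_excess A (R \<union> F)"
        using insert.hyps(3)[of "R \<union> F"] e FJ by simp
      also have "\<dots> \<le> partial_excess A (insert i (R \<union> F))"
        using partial_excess_insert_mono[of "R \<union> F" i] R FJ insert.hyps by auto
      finally show "partial_excess A R \<le> partial_excess A (R \<union> (S - R))" using * by simp
    qed
  qed (simp add: Un_absorb2)
  moreover have "R \<union> (S - R) = S" using assms by auto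
  ultimately show ?thesis using assms by auto
qed

lemma partial_excess_empty [simp]: "partial_excess A {} = 0"
  by (simp add: partial_excess_def)

lemma partial_excess_full: "partial_excess A J = excess J A"
  by (simp add: partial_excess_def excess_def margent_full)

lemma partial_excess_submodular:
  assumes "P \<subseteq> J" "Q \<subseteq> J"
  shows "partial_excess A (P \<union> Q) + partial_excess A (P \<inter> Q) \<le> partial_excess A P + partial_excess A Q"
proof -
  have "finite P" "finite Q" using assms fin_J finite_subset by blast+
  then show ?thesis
    using margent_submodular[of P Q] sum.union_inter[of P Q "\<lambda>i. real (card (stay i A))"]
    by (simp add: partial_excess_def)
qed

text \<open>The chain rule: the entropy of coordinate \<open>i\<close> given \<open>X_R\<close>
  averages the binary entropies over the fibres. Since \<open>i \<notin> R\<close>, a flip never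
  changes the fibre, so staying in the fibre and staying in \<open>A\<close> coincide. Bounds on
  increments of the partial excess thereby become bounds on gains in a typical fibre.\<close>

lemma sum_gain_cls:
  assumes "i \<notin> R"  "R \<subseteq> J"
  shows "(\<Sum>x\<in>A. gain i (cls A R x)) = partial_excess A (insert i R) - partial_excess A R"
proof -
  have pos: "real (card (cls A R x)) > 0" if "x \<in> A" for R x using card_cls_pos that .
  have ent: "(\<Sum>u\<in>cls A R x. log 2 (card (cls A R u) / card (cls A (insert i R) u)))
      = card (cls A R x) * binent (card {u \<in> cls A R x. i \<in> u} / card (cls A R x))"
    if x: "x \<in> A" for x
  proof -
    define B where "B = cls A R x"
    have fB: "finite B" "B \<noteq> {}" using pos[OF x, of R] by (auto simp: B_def)
    have c1: "cls A (insert i R) u = {w \<in> B. i \<in> w}" if "u \<in> {w \<in> B. i \<in> w}" for u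
      using that by (auto simp: B_def cls_def)
    have c0: "cls A (insert i R) u = {w \<in> B. i \<notin> w}" if "u \<in> {w \<in> B. i \<notin> w}" for u
      using that by (auto simp: B_def cls_def)
    have cB: "cls A R u = B" if "u \<in> B" for u using that unfolding B_def by (rule cls_eq)
    have l: "(\<Sum>u\<in>D. log 2 (card B / card D)) = card D * log 2 (card B) - card D * log 2 (card D)"
      if "D \<subseteq> B" for D
    proof (cases "D = {}")
      case False
      then have "real (card D) > 0" "real (card B) > 0"
        using that fB finite_subset[OF that] by (auto simp: card_gt_0_iff)
      then show ?thesis by (simp add: log_divide algebra_simps)
    qed simp
    have "(\<Sum>u\<in>B. log 2 (card (cls A R u) / card (cls A (insert i R) u)))
      = (\<Sum>u\<in>{w \<in> B. i \<in> w}. log 2 (card (cls A R u) / card (cls A (insert i R) u)))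
      + (\<Sum>u\<in>{w \<in> B. i \<notin> w}. log 2 (card (cls A R u) / card (cls A (insert i R) u)))"
      by (rule sum_split_mem[OF fB(1)])
    also have "(\<Sum>u\<in>{w \<in> B. i \<in> w}. log 2 (card (cls A R u) / card (cls A (insert i R) u)))
      = (\<Sum>u\<in>{w \<in> B. i \<in> w}. log 2 (card B / card {w \<in> B. i \<in> w}))"
      by (intro sum.cong) (auto simp: c1 cB)
    also have "(\<Sum>u\<in>{w \<in> B. i \<notin> w}. log 2 (card (cls A R u) / card (cls A (insert i R) u)))
      = (\<Sum>u\<in>{w \<in> B. i \<notin> w}. log 2 (card B / card {w \<in> B. i \<notin> w}))"
      by (intro sum.cong) (auto simp: c0 cB)
    also have "(\<Sum>u\<in>{w \<in> B. i \<in> w}. log 2 (card B / card {w \<in> B. i \<in> w})) + (\<Sum>u\<in>{w \<in> B. i \<notin> w}. log 2 (card B / card {w \<in> B. i \<notin> w}))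
      = card B * binent (card {u \<in> B. i \<in> u} / card B)"
    proof -
      have "real (card B) = card {w \<in> B. i \<in> w} + real (card {w \<in> B. i \<notin> w})"
        using card_split_mem[OF fB(1), of i] by simp
      then have "real (card B) * log 2 (card B) = card {w \<in> B. i \<in> w} * log 2 (card B) + real (card {w \<in> B. i \<notin> w}) * log 2 (card B)"
        by (simp only: distrib_right[symmetric])
      then show ?thesis
        using l[of "{w \<in> B. i \<in> w}"] l[of "{w \<in> B. i \<notin> w}"] binent_card[OF fB, of i] by simp
    qed
    finally show ?thesis unfolding B_def .
  qed
  have st: "(\<Sum>u\<in>cls A R x. of_bool (flip i u \<in> A)) = real (card (stay i (cls A R x)))" for x
  proof -
    have "stay i (cls A R x) = cls A R x \<inter> {u. flip i u \<in> A}"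
      using flip_Int[OF assms(1)] by (auto simp: stay_def cls_def)
    then show ?thesis by (simp add: sum_of_bool_eq)
  qed
  have "margent A (insert i R) - margent A R = (\<Sum>x\<in>A. log 2 (card (cls A R x) / card (cls A (insert i R) x)))"
    unfolding margent_def sum_subtractf[symmetric]
  proof (rule sum.cong[OF refl])
    fix x assume "x \<in> A"
    then show "log 2 (card A / card (cls A (insert i R) x)) - log 2 (card A / card (cls A R x))
      = log 2 (card (cls A R x) / card (cls A (insert i R) x))"
      using pos[of x R] pos[of x "insert i R"] card_A_pos by (simp add: log_divide_pos)
  qed
  also have "\<dots> = (\<Sum>x\<in>A. binent (card {u \<in> cls A R x. i \<in> u} / card (cls A R x)))"
    by (subst sum_cls[where R = R], rule sum.cong) (use pos in \<open>auto simp: ent order_less_imp_not_eq2\<close>)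
  finally have 1: "margent A (insert i R) - margent A R = (\<Sum>x\<in>A. binent (card {u \<in> cls A R x. i \<in> u} / card (cls A R x)))" .
  have "real (card (stay i A)) = (\<Sum>x\<in>A. of_bool (flip i x \<in> A))"
    using fin_A by (simp add: sum_of_bool_eq stay_def Int_def)
  also have "\<dots> = (\<Sum>x\<in>A. card (stay i (cls A R x)) / card (cls A R x))"
    by (subst sum_cls[where R = R]) (simp add: st)
  finally have 2: "real (card (stay i A)) = (\<Sum>x\<in>A. card (stay i (cls A R x)) / card (cls A R x))" .
  have "finite R" using assms fin_J finite_subset by blast
  then show ?thesis
    using 1 2 assms by (simp add: gain_def sum_subtractf partial_excess_def)
qed

end

text \<open>The edge-isoperimetric inequality of the cube, obtained as monotonicity of the partial
  excess from \<open>{}\<close> to \<open>J\<close>.\<close>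

lemma excess_nonneg:
  assumes "finite J" "A \<subseteq> Pow J"
  shows "0 \<le> excess J A"
proof (cases "A = {}")
  case False
  interpret cube_set J A using assms False by unfold_locales
  show ?thesis using partial_excess_mono[of "{}" J] by (simp add: partial_excess_full)
qed simp

text \<open>In the induction \<open>R\<close> either contains \<open>j\<close> or not. If not, the
  increment at \<open>j\<close> itself is at most \<open>\<Phi> {j} - \<Phi> {}\<close> by
  submodularity, and the term \<open>\<Phi> {j}\<close> is cancelled by the other branch, whose sum
  starts from \<open>\<Phi> {j}\<close>. The bound does not grow with the number of coordinates left
  outside \<open>R\<close>.\<close>

lemma sum_increments_le:
  fixes \<Phi> :: "'a set \<Rightarrow> real"
  assumes "finite J"
    and "\<And>P Q. P \<subseteq> J \<Longrightarrow> Q \<subseteq> J \<Longrightarrow> \<Phi> (P \<union> Q) + \<Phi> (P \<inter> Q) \<le> \<Phi> P + \<Phi> Q"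
    and "\<And>R i. R \<subseteq> J \<Longrightarrow> i \<in> J \<Longrightarrow> \<Phi> R \<le> \<Phi> (insert i R)"
  shows "av J (\<lambda>R. \<Sum>i\<in>J - R. \<Phi> (insert i R) - \<Phi> R) \<le> \<Phi> J - \<Phi> {}"
  using assms
proof (induction J arbitrary: \<Phi> rule: finite_induct)
  case empty
  then show ?case by simp
next
  case (insert j J)
  note sub = insert.prems(1) and mono = insert.prems(2)
  define \<Psi> where "\<Psi> = (\<lambda>R. \<Phi> (insert j R))"
  have 1: "av J (\<lambda>R. \<Sum>i\<in>J - R. \<Phi> (insert i R) - \<Phi> R) \<le> \<Phi> J - \<Phi> {}"
    by (rule insert.IH) (auto intro!: sub mono)
  have 2: "av J (\<lambda>R. \<Sum>i\<in>J - R. \<Psi> (insert i R) - \<Psi> R) \<le> \<Psi> J - \<Psi> {}"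
  proof (rule insert.IH)
    fix P Q assume "P \<subseteq> J" "Q \<subseteq> J"
    then show "\<Psi> (P \<union> Q) + \<Psi> (P \<inter> Q) \<le> \<Psi> P + \<Psi> Q"
      using sub[of "insert j P" "insert j Q"] by (auto simp: \<Psi>_def)
  next
    fix R i assume "R \<subseteq> J" "i \<in> J"
    then show "\<Psi> R \<le> \<Psi> (insert i R)"
      using mono[of "insert j R" i] by (auto simp: \<Psi>_def insert_commute)
  qed
  have 3: "av J (\<lambda>R. \<Phi> (insert j R) - \<Phi> R) \<le> \<Phi> {j} - \<Phi> {}"
  proof -
    have "av J (\<lambda>R. \<Phi> (insert j R) - \<Phi> R) \<le> av J (\<lambda>R. \<Phi> {j} - \<Phi> {})"
    proof (rule av_mono)
      fix R assume "R \<subseteq> J"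
      moreover from this have "{j} \<inter> R = {}" using insert.hyps by auto
      ultimately show "\<Phi> (insert j R) - \<Phi> R \<le> \<Phi> {j} - \<Phi> {}"
        using sub[of "{j}" R] by (auto simp: subset_insertI2)
    qed
    also have "\<dots> = \<Phi> {j} - \<Phi> {}" using insert.hyps by (simp add: av_def card_Pow)
    finally show ?thesis .
  qed
  have 4: "\<Phi> J \<le> \<Phi> (insert j J)" by (rule mono) auto
  have e0: "av J (\<lambda>R. \<Sum>i\<in>insert j J - R. \<Phi> (insert i R) - \<Phi> R)
    = av J (\<lambda>R. \<Sum>i\<in>J - R. \<Phi> (insert i R) - \<Phi> R) + av J (\<lambda>R. \<Phi> (insert j R) - \<Phi> R)"
    unfolding av_add[symmetric]
  proof (rule av_cong)
    fix R assume "R \<subseteq> J"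
    then have "insert j J - R = insert j (J - R)" "j \<notin> J - R" using insert.hyps by auto
    then show "(\<Sum>i\<in>insert j J - R. \<Phi> (insert i R) - \<Phi> R)
      = (\<Sum>i\<in>J - R. \<Phi> (insert i R) - \<Phi> R) + (\<Phi> (insert j R) - \<Phi> R)"
      using insert.hyps by simp
  qed
  have e1: "av J (\<lambda>R. \<Sum>i\<in>insert j J - insert j R. \<Phi> (insert i (insert j R)) - \<Phi> (insert j R))
    = av J (\<lambda>R. \<Sum>i\<in>J - R. \<Psi> (insert i R) - \<Psi> R)"
  proof (rule av_cong)
    fix R assume "R \<subseteq> J"
    then have "insert j J - insert j R = J - R" using insert.hyps by auto
    then show "(\<Sum>i\<in>insert j J - insert j R. \<Phi> (insert i (insert j R)) - \<Phi> (insert j R))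
      = (\<Sum>i\<in>J - R. \<Psi> (insert i R) - \<Psi> R)"
      by (simp add: \<Psi>_def insert_commute)
  qed
  show ?case
    unfolding av_insert[OF insert.hyps] e0 e1 using 1 2 3 4 by (simp add: \<Psi>_def)
qed

section \<open>Sets with small influences have bounded codimension\<close>

context cube_set
begin

text \<open>Every fibre contributes exactly 1, and there are at most \<open>2 ^ card R\<close>
  fibres.\<close>

lemma sum_inverse_card_cls_le:
  assumes "finite R"
  shows "(\<Sum>x\<in>A. 1 / card (cls A R x)) \<le> 2 ^ card R"
proof -
  have "(\<Sum>x\<in>A. 1 / card (cls A R x)) = (\<Sum>y\<in>Pow R. \<Sum>x\<in>{x \<in> A. x \<inter> R = y}. 1 / card (cls A R x))"
    by (rule sum.group[symmetric]) (use fin_A assms in auto)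
  also have "\<dots> \<le> (\<Sum>y\<in>Pow R. 1)"
  proof (rule sum_mono)
    fix y
    have "cls A R x = {x \<in> A. x \<inter> R = y}" if "x \<in> {x \<in> A. x \<inter> R = y}" for x
      using that by (auto simp: cls_def)
    then have "(\<Sum>x\<in>{x \<in> A. x \<inter> R = y}. 1 / card (cls A R x))
      = (\<Sum>x\<in>{x \<in> A. x \<inter> R = y}. 1 / real (card {x \<in> A. x \<inter> R = y}))"
      by (intro sum.cong) auto
    then show "(\<Sum>x\<in>{x \<in> A. x \<inter> R = y}. 1 / card (cls A R x)) \<le> 1" by simp
  qed
  finally show ?thesis using assms by (simp add: card_Pow)
qed

text \<open>At each point the codimension \<open>t\<close> is \<open>f x\<close>, the share of the
  exposed coordinates, plus the codimension of the fibre. So \<open>f\<close> exceeds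
  \<open>t - T0\<close> on three quarters of \<open>A\<close> while its mean is at most
  \<open>t / 2\<close>. Counting fibres shows that the negative part of \<open>f\<close> costs at
  most \<open>3 / 2 * card A\<close>.\<close>

lemma codim_le_of_typical_fibre:
  fixes T0 t :: real
  assumes R: "R \<subseteq> J" and t: "t = card J - log 2 (card A)" and "T0 \<ge> 0"
    and many: "card {x \<in> A. card (J - R) - log 2 (card (cls A R x)) < T0} > 3 / 4 * card A"
    and half: "card A * card R - margent A R \<le> card A * (t / 2)"
  shows "t \<le> 3 * T0 + 6"
proof (cases "t \<le> T0")
  case False
  define G where "G = {x \<in> A. card (J - R) - log 2 (card (cls A R x)) < T0}"
  have G: "G \<subseteq> A" "finite G" using fin_A by (auto simp: G_def)
  have fR: "finite R" using R fin_J finite_subset by blast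
  have cJ: "real (card J) = card R + real (card (J - R))"
    using card_Diff_subset[OF fR R] card_mono[OF fin_J R] by simp
  define f where "f = (\<lambda>x. card R - log 2 (card A / card (cls A R x)))"
  have fG: "f x \<ge> t - T0" if "x \<in> G" for x
  proof -
    have "real (card (cls A R x)) > 0" using that card_cls_pos G by auto
    then show ?thesis using that card_A_pos t cJ by (simp add: G_def f_def log_divide_pos)
  qed
  have fA: "f x \<ge> - (3 / 2 * (card A / 2 ^ card R) * (1 / card (cls A R x)))" if "x \<in> A" for x
  proof -
    have c: "real (card (cls A R x)) > 0" using that card_cls_pos by auto
    then have "log 2 (card A / (2 ^ card R * card (cls A R x))) \<le> 3 / 2 * (card A / (2 ^ card R * card (cls A R x)))"
      using card_A_pos by (intro log2_le) simp
    moreover have "log 2 (card A / (2 ^ card R * card (cls A R x))) = - f x"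
      using c card_A_pos by (simp add: f_def log_divide_pos log_mult_pos log_nat_power)
    moreover have "3 / 2 * (card A / (2 ^ card R * card (cls A R x))) = 3 / 2 * (card A / 2 ^ card R) * (1 / card (cls A R x))"
      by simp
    ultimately show ?thesis by linarith
  qed
  have "card A * card R - margent A R = (\<Sum>x\<in>A. f x)"
    by (simp add: f_def margent_def sum_subtractf)
  also have "\<dots> = (\<Sum>x\<in>G. f x) + (\<Sum>x\<in>A - G. f x)"
    using G fin_A by (simp add: sum.subset_diff add.commute)
  finally have tot: "card A * card R - margent A R = (\<Sum>x\<in>G. f x) + (\<Sum>x\<in>A - G. f x)" .
  have sG: "(\<Sum>x\<in>G. f x) \<ge> card G * (t - T0)"
    using sum_mono[of G "\<lambda>_. t - T0" f] fG by simp
  define a where "a = 3 / 2 * (card A / 2 ^ card R)"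
  have "a * (\<Sum>x\<in>A - G. 1 / card (cls A R x)) \<le> a * 2 ^ card R"
  proof (rule mult_left_mono)
    have "(\<Sum>x\<in>A - G. 1 / card (cls A R x)) \<le> (\<Sum>x\<in>A. 1 / card (cls A R x))"
      using fin_A by (intro sum_mono2) auto
    also have "\<dots> \<le> 2 ^ card R" by (rule sum_inverse_card_cls_le[OF fR])
    finally show "(\<Sum>x\<in>A - G. 1 / card (cls A R x)) \<le> 2 ^ card R" .
  qed (simp add: a_def)
  moreover have "(\<Sum>x\<in>A - G. f x) \<ge> (\<Sum>x\<in>A - G. - (a * (1 / card (cls A R x))))"
    unfolding a_def by (intro sum_mono fA) auto
  ultimately have "(\<Sum>x\<in>A - G. f x) \<ge> - (3 / 2 * card A)"
    by (simp add: sum_distrib_left sum_negf a_def)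
  then have "card A * (t / 2) \<ge> card G * (t - T0) - 3 / 2 * card A"
    using half tot sG by simp
  moreover have "card G * (t - T0) \<ge> 3 / 4 * card A * (t - T0)"
    using many False by (intro mult_right_mono) (auto simp: G_def)
  moreover have "card A * (3 / 4 * (t - T0) - 3 / 2) = 3 / 4 * card A * (t - T0) - 3 / 2 * card A"
    by (simp add: algebra_simps)
  ultimately have "card A * (3 / 4 * (t - T0) - 3 / 2) \<le> card A * (t / 2)"
    by linarith
  then have "3 / 4 * (t - T0) - 3 / 2 \<le> t / 2"
    using card_A_pos by (simp only: mult_le_cancel_left_pos)
  then show ?thesis by (simp add: field_simps)
qed (use assms in auto)

text \<open>Relative entropy of the law of \<open>X - R\<close> given \<open>X \<inter> R = x \<inter> R\<close> with respect to its
  unconditional law, for \<open>X\<close> uniform on \<open>A\<close>.\<close>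

definition relent :: "'a set \<Rightarrow> 'a set \<Rightarrow> real" where
  "relent R x = (\<Sum>u\<in>cls A R x. log 2 (card A / (card (cls A R x) * real (card (cls A (J - R) u))))) / card (cls A R x)"

text \<open>The sum is \<open>card A\<close> times the mutual information between \<open>X_R\<close>
  and the remaining coordinates. Monotonicity of the partial excess from \<open>J - R\<close> to
  \<open>J\<close> bounds it by the partial excess of \<open>R\<close>.\<close>

lemma sum_relent_le:
  assumes R: "R \<subseteq> J"
  shows "(\<Sum>x\<in>A. relent R x) \<le> excess J A"
proof -
  have "(\<Sum>x\<in>A. relent R x) = (\<Sum>x\<in>A. (\<Sum>u\<in>cls A R x. log 2 (card A / (card (cls A R u) * real (card (cls A (J - R) u))))) / card (cls A R x))"
    unfolding relent_def
  proof (rule sum.cong[OF refl])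
    fix x
    have "(\<Sum>u\<in>cls A R x. log 2 (card A / (card (cls A R x) * real (card (cls A (J - R) u)))))
      = (\<Sum>u\<in>cls A R x. log 2 (card A / (card (cls A R u) * real (card (cls A (J - R) u)))))"
      using cls_eq by (intro sum.cong) auto
    then show "(\<Sum>u\<in>cls A R x. log 2 (card A / (card (cls A R x) * real (card (cls A (J - R) u))))) / card (cls A R x)
      = (\<Sum>u\<in>cls A R x. log 2 (card A / (card (cls A R u) * real (card (cls A (J - R) u))))) / card (cls A R x)"
      by simp
  qed
  also have "\<dots> = (\<Sum>x\<in>A. log 2 (card A / (card (cls A R x) * real (card (cls A (J - R) x)))))"
    by (rule sum_cls[symmetric])
  also have "\<dots> = (\<Sum>x\<in>A. log 2 (card A / card (cls A R x)) + log 2 (card A / card (cls A (J - R) x)) - log 2 (card A))"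
  proof (rule sum.cong[OF refl])
    fix x assume "x \<in> A"
    then show "log 2 (card A / (card (cls A R x) * real (card (cls A (J - R) x))))
      = log 2 (card A / card (cls A R x)) + log 2 (card A / card (cls A (J - R) x)) - log 2 (card A)"
      using card_cls_pos[of x R] card_cls_pos[of x "J - R"] card_A_pos
      by (simp add: log_divide_pos log_mult_pos)
  qed
  also have "\<dots> = margent A R + margent A (J - R) - margent A J"
    by (simp add: margent_def margent_full sum.distrib sum_subtractf cls_full)
  also have "\<dots> \<le> partial_excess A R"
  proof -
    have "(\<Sum>i\<in>J. real (card (stay i A))) = (\<Sum>i\<in>J - R. real (card (stay i A))) + (\<Sum>i\<in>R. real (card (stay i A)))"
      using R fin_J by (rule sum.subset_diff)
    then show ?thesis
      using partial_excess_mono[of "J - R" J] by (simp add: partial_excess_def)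
  qed
  also have "\<dots> \<le> excess J A"
    using partial_excess_mono[OF R] by (simp add: partial_excess_full)
  finally show ?thesis .
qed

text \<open>Points of one fibre over \<open>R\<close> differ on \<open>J - R\<close>, so their
  classes over \<open>J - R\<close> are disjoint, and each class keeps the pattern \<open>P\<close>
  because \<open>T\<close> avoids \<open>R\<close>. Thus the unconditional probability of the traces
  of \<open>D\<close> is at most that of the pattern.\<close>

lemma sum_card_cls_complement_le:
  assumes "R \<subseteq> J" "T \<subseteq> J - R" "D \<subseteq> cls A R x" "\<And>u. u \<in> D \<Longrightarrow> u \<inter> T = P"
  shows "(\<Sum>u\<in>D. real (card (cls A (J - R) u))) \<le> card {w \<in> A. w \<inter> T = P}"
proof -
  have fD: "finite D" using finite_subset[OF assms(3)] by simp
  have "(\<Sum>u\<in>D. card (cls A (J - R) u)) = card (\<Union>u\<in>D. cls A (J - R) u)"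
  proof (rule card_UN_disjoint[symmetric])
    show "\<forall>i\<in>D. \<forall>j\<in>D. i \<noteq> j \<longrightarrow> cls A (J - R) i \<inter> cls A (J - R) j = {}"
    proof (intro ballI impI equals0I)
      fix u v w assume u: "u \<in> D" and v: "v \<in> D" and "u \<noteq> v" "w \<in> cls A (J - R) u \<inter> cls A (J - R) v"
      then have e: "u \<inter> (J - R) = v \<inter> (J - R)" by (auto simp: cls_def)
      have "u \<in> cls A R x" "v \<in> cls A R x" using u v assms(3) by auto
      then have "u \<inter> R = v \<inter> R" "u \<subseteq> J" "v \<subseteq> J" using A_subset by (auto simp: cls_def)
      with e have "u = v" by blast
      then show False using \<open>u \<noteq> v\<close> by simp
    qed
  qed (use fD in auto)
  also have "\<dots> \<le> card {w \<in> A. w \<inter> T = P}"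
  proof (rule card_mono)
    show "(\<Union>u\<in>D. cls A (J - R) u) \<subseteq> {w \<in> A. w \<inter> T = P}"
    proof
      fix w assume "w \<in> (\<Union>u\<in>D. cls A (J - R) u)"
      then obtain u where u: "u \<in> D" "w \<in> A" "w \<inter> (J - R) = u \<inter> (J - R)" by (auto simp: cls_def)
      then have "w \<inter> T = u \<inter> T" using assms(2) by blast
      then show "w \<in> {w \<in> A. w \<inter> T = P}" using u assms(4) by auto
    qed
  qed (use fin_A in auto)
  finally show ?thesis by (metis of_nat_le_iff of_nat_sum)
qed

text \<open>An event that is likely in the fibre but has unconditional probability at most \<eta>
  forces a large relative entropy. The bound \<open>log 2 z \<le> 3 / 2 * z\<close> is used once on
  \<open>D\<close> and once on its complement, which together cost 3 per point.\<close>

lemma relent_ge: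
  fixes \<eta> :: real
  assumes R: "R \<subseteq> J" and x: "x \<in> A" and D: "D \<subseteq> cls A R x" and \<eta>: "\<eta> > 0"
    and le: "(\<Sum>u\<in>D. real (card (cls A (J - R) u))) \<le> \<eta> * card A"
  shows "card (cls A R x) * relent R x \<ge> card D * log 2 (1 / \<eta>) - 3 * card (cls A R x)"
proof -
  define B where "B = cls A R x"
  define b where "b = real (card B)"
  define c where "c = (\<lambda>u. real (card (cls A (J - R) u)))"
  define N where "N = real (card A)"
  have N: "N > 0" using card_A_pos by (simp add: N_def)
  have b: "b > 0" using card_cls_pos[OF x] by (simp add: b_def B_def)
  have BA: "B \<subseteq> A" by (auto simp: B_def cls_def)
  have c: "c u > 0" if "u \<in> B" for u using card_cls_pos BA that by (auto simp: c_def)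
  have fB: "finite B" by (simp add: B_def)
  have part: "(\<Sum>u\<in>E. log 2 (N / (b * c u))) \<ge> card E * log 2 (1 / \<theta>) - 3 / 2 * b"
    if E: "E \<subseteq> B" and \<theta>: "\<theta> > 0" and s: "(\<Sum>u\<in>E. c u) \<le> \<theta> * N" for E \<theta>
  proof -
    have "log 2 (N / (b * c u)) \<ge> log 2 (1 / \<theta>) - 3 / 2 * (b / (N * \<theta>)) * c u" if "u \<in> E" for u
    proof -
      have cu: "c u > 0" using c E that by auto
      have "log 2 (b * c u / (N * \<theta>)) \<le> 3 / 2 * (b * c u / (N * \<theta>))"
        using b cu N \<theta> by (intro log2_le) simp
      then show ?thesis using b cu N \<theta> by (simp add: log_divide_pos log_mult_pos)
    qed
    then have "(\<Sum>u\<in>E. log 2 (N / (b * c u))) \<ge> (\<Sum>u\<in>E. log 2 (1 / \<theta>) - 3 / 2 * (b / (N * \<theta>)) * c u)"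
      by (intro sum_mono)
    moreover have "(\<Sum>u\<in>E. log 2 (1 / \<theta>) - 3 / 2 * (b / (N * \<theta>)) * c u)
      = card E * log 2 (1 / \<theta>) - 3 / 2 * (b / (N * \<theta>)) * (\<Sum>u\<in>E. c u)"
      by (simp add: sum_subtractf sum_distrib_left)
    moreover have "3 / 2 * (b / (N * \<theta>)) * (\<Sum>u\<in>E. c u) \<le> 3 / 2 * (b / (N * \<theta>)) * (\<theta> * N)"
      using s b N \<theta> by (intro mult_left_mono) auto
    moreover have "3 / 2 * (b / (N * \<theta>)) * (\<theta> * N) = 3 / 2 * b"
      using N \<theta> by simp
    ultimately show ?thesis by linarith
  qed
  have DB: "D \<subseteq> B" using D by (simp add: B_def)
  have 1: "(\<Sum>u\<in>D. log 2 (N / (b * c u))) \<ge> card D * log 2 (1 / \<eta>) - 3 / 2 * b"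
    by (rule part) (use DB \<eta> le in \<open>auto simp: c_def N_def\<close>)
  \<comment> \<open>Outside \<open>D\<close> the empty pattern gives the trivial probability bound
    1.\<close>
  have "(\<Sum>u\<in>B - D. c u) \<le> card {w \<in> A. w \<inter> {} = {}}"
    unfolding c_def by (rule sum_card_cls_complement_le[where x = x]) (use R in \<open>auto simp: B_def\<close>)
  then have 2: "(\<Sum>u\<in>B - D. log 2 (N / (b * c u))) \<ge> card (B - D) * log 2 (1 / 1) - 3 / 2 * b"
    by (intro part) (auto simp: N_def)
  have "b * relent R x = (\<Sum>u\<in>B. log 2 (N / (b * c u)))"
    using b by (simp add: relent_def b_def B_def c_def N_def)
  also have "\<dots> = (\<Sum>u\<in>B - D. log 2 (N / (b * c u))) + (\<Sum>u\<in>D. log 2 (N / (b * c u)))"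
    using DB fB by (rule sum.subset_diff)
  finally show ?thesis using 1 2 by (simp add: b_def B_def)
qed

text \<open>Flipping one coordinate of the pattern loses only points that leave \<open>A\<close>, at
  most \<open>d\<close> of them; the walk from \<open>P\<close> to \<open>Q\<close> runs through
  their symmetric difference.\<close>

lemma card_pattern_ge:
  fixes d :: real
  assumes T: "T \<subseteq> J" and P: "P \<subseteq> T" and Q: "Q \<subseteq> T"
    and infl: "\<And>i. i \<in> T \<Longrightarrow> card A - real (card (stay i A)) \<le> d" and "d \<ge> 0"
  shows "card {w \<in> A. w \<inter> T = Q} \<ge> card {w \<in> A. w \<inter> T = P} - card T * d"
proof -
  have step: "real (card {w \<in> A. w \<inter> T = flip i S}) \<ge> card {w \<in> A. w \<inter> T = S} - d"
    if i: "i \<in> T" for i S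
  proof -
    have "{w \<in> A. w \<inter> T = S} \<subseteq> flip i ` {w \<in> A. w \<inter> T = flip i S} \<union> (A - stay i A)"
    proof
      fix w assume w: "w \<in> {w \<in> A. w \<inter> T = S}"
      show "w \<in> flip i ` {w \<in> A. w \<inter> T = flip i S} \<union> (A - stay i A)"
      proof (cases "flip i w \<in> A")
        case True
        have "flip i w \<inter> T = flip i S" using w i by (auto simp: flip_def)
        then have "w = flip i (flip i w)" "flip i w \<in> {w \<in> A. w \<inter> T = flip i S}" using True by auto
        then show ?thesis by blast
      qed (use w in \<open>auto simp: stay_def\<close>)
    qed
    then have "card {w \<in> A. w \<inter> T = S} \<le> card (flip i ` {w \<in> A. w \<inter> T = flip i S} \<union> (A - stay i A))"
      using fin_A by (intro card_mono) auto
    also have "\<dots> \<le> card (flip i ` {w \<in> A. w \<inter> T = flip i S}) + card (A - stay i A)"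
      by (rule card_Un_le)
    also have "card (flip i ` {w \<in> A. w \<inter> T = flip i S}) \<le> card {w \<in> A. w \<inter> T = flip i S}"
      using fin_A by (intro card_image_le) auto
    finally have "card {w \<in> A. w \<inter> T = S} \<le> card {w \<in> A. w \<inter> T = flip i S} + card (A - stay i A)" by simp
    moreover have "real (card (A - stay i A)) = card A - real (card (stay i A))"
      using fin_A by (subst card_Diff_subset) (auto simp: stay_def intro!: of_nat_diff card_mono)
    ultimately show ?thesis using infl[OF i] by linarith
  qed
  define U where "U = sym_diff P Q"
  have UT: "U \<subseteq> T" using P Q by (auto simp: U_def)
  have fT: "finite T" using T fin_J finite_subset by blast
  have "finite U" using UT fT finite_subset by blast
  then have "U \<subseteq> T \<longrightarrow> real (card {w \<in> A. w \<inter> T = sym_diff P U}) \<ge> card {w \<in> A. w \<inter> T = P} - card U * d"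
  proof (induction U rule: finite_induct)
    case (insert i U)
    show ?case
    proof
      assume a: "insert i U \<subseteq> T"
      have "sym_diff P (insert i U) = flip i (sym_diff P U)"
        using insert.hyps by (auto simp: flip_def)
      then show "real (card {w \<in> A. w \<inter> T = sym_diff P (insert i U)}) \<ge> card {w \<in> A. w \<inter> T = P} - card (insert i U) * d"
        using step[of i "sym_diff P U"] insert a by (simp add: algebra_simps)
    qed
  qed simp
  moreover have "sym_diff P U = Q" by (auto simp: U_def)
  moreover have "card U * d \<le> card T * d"
    using card_mono[OF fT UT] assms(5) by (intro mult_right_mono) auto
  ultimately show ?thesis using UT by simp
qed

text \<open>All \<open>2 ^ card T\<close> patterns are almost as frequent as \<open>P\<close>, and
  together they count \<open>A\<close>.\<close>

lemma card_pattern_le: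
  fixes d :: real
  assumes T: "T \<subseteq> J" and P: "P \<subseteq> T"
    and infl: "\<And>i. i \<in> T \<Longrightarrow> card A - real (card (stay i A)) \<le> d" and "d \<ge> 0"
  shows "2 ^ card T * (card {w \<in> A. w \<inter> T = P} - card T * d) \<le> card A"
proof -
  have fT: "finite T" using T fin_J finite_subset by blast
  have "(\<Sum>w\<in>A. 1::real) = (\<Sum>Q\<in>Pow T. \<Sum>w\<in>{w \<in> A. w \<inter> T = Q}. 1)"
    by (rule sum.group[symmetric]) (use fin_A fT in auto)
  then have "real (card A) = (\<Sum>Q\<in>Pow T. real (card {w \<in> A. w \<inter> T = Q}))" by simp
  also have "\<dots> \<ge> (\<Sum>Q\<in>Pow T. card {w \<in> A. w \<inter> T = P} - card T * d)"
    using card_pattern_ge[OF T P _ infl \<open>d \<ge> 0\<close>] by (intro sum_mono) auto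
  finally show ?thesis using fT by (simp add: card_Pow)
qed

text \<open>\<open>R\<close> is found by averaging over all subsets of \<open>J\<close>; the last condition then holds for \<open>R\<close> or for
  its complement, since \<open>H(X\<^sub>R) + H(X\<^bsub>J-R\<^esub>) \<ge> H(X)\<close>.\<close>

lemma exists_balanced_exposure:
  assumes t: "t = card J - log 2 (card A)"
  obtains R where "R \<subseteq> J" "(\<Sum>i\<in>J - R. partial_excess A (insert i R) - partial_excess A R) \<le> 2 * excess J A"
    "card A * card R - margent A R \<le> card A * (t / 2)"
proof -
  define g where "g = (\<lambda>R. \<Sum>i\<in>J - R. partial_excess A (insert i R) - partial_excess A R)"
  have g0: "g R \<ge> 0" if "R \<subseteq> J" for R
    unfolding g_def using that by (intro sum_nonneg) (auto intro!: partial_excess_insert_mono)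
  have a: "av J g \<le> excess J A"
  proof -
    have "av J g \<le> partial_excess A J - partial_excess A {}"
      unfolding g_def
    proof (rule sum_increments_le[OF fin_J])
      fix R i assume "R \<subseteq> J" "i \<in> J"
      then show "partial_excess A R \<le> partial_excess A (insert i R)"
        by (intro partial_excess_mono) auto
    qed (rule partial_excess_submodular)
    then show ?thesis by (simp add: partial_excess_full)
  qed
  have "bij_betw (\<lambda>R. J - R) (Pow J) (Pow J)"
    by (rule bij_betw_byWitness[where f' = "\<lambda>R. J - R"]) auto
  then have "av J (\<lambda>R. g (J - R)) = av J g"
    unfolding av_def using sum.reindex_bij_betw[of "\<lambda>R. J - R" "Pow J" "Pow J" g] by simp
  \<comment> \<open>Both \<open>R\<close> and its complement must have small increments, since it is
    decided only later which of them satisfies the entropy condition.\<close>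
  then have "av J (\<lambda>R. g R + g (J - R)) \<le> 2 * excess J A"
    using a by (simp add: av_add)
  have "\<exists>R\<subseteq>J. g R + g (J - R) \<le> 2 * excess J A"
  proof (rule ccontr)
    assume "\<not> ?thesis"
    then have "(\<Sum>R\<in>Pow J. g R + g (J - R)) > (\<Sum>R\<in>Pow J. 2 * excess J A)"
      using fin_J by (intro sum_strict_mono) auto
    then have "av J (\<lambda>R. g R + g (J - R)) > 2 * excess J A"
      using fin_J by (simp add: av_def card_Pow field_simps)
    then show False using \<open>av J (\<lambda>R. g R + g (J - R)) \<le> 2 * excess J A\<close> by simp
  qed
  then obtain R where R: "R \<subseteq> J" "g R + g (J - R) \<le> 2 * excess J A" by auto
  have fR: "finite R" using R fin_J finite_subset by blast
  have cJ: "real (card J) = card R + real (card (J - R))"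
    using card_Diff_subset[OF fR R(1)] card_mono[OF fin_J R(1)] by simp
  have "R \<union> (J - R) = J" "R \<inter> (J - R) = {}" using R by auto
  then have "margent A J \<le> margent A R + margent A (J - R)"
    using margent_submodular[of R "J - R"] by simp
  then have "(card A * card R - margent A R) + (card A * card (J - R) - margent A (J - R)) \<le> card A * t"
    using cJ by (simp add: t margent_full algebra_simps)
  then consider "card A * card R - margent A R \<le> card A * (t / 2)"
    | "card A * card (J - R) - margent A (J - R) \<le> card A * (t / 2)"
    by fastforce
  then show thesis
  proof cases
    case 1
    then show thesis using that[of R] R g0[of "J - R"] by (simp add: g_def)
  next
    case 2
    then show thesis using that[of "J - R"] R g0[of R] by (simp add: g_def)
  qed
qed

text \<open>By \<open>codim_le_of_typical_fibre\<close> at least a quarter of the points lie in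
  fibres of codimension at least \<open>T0\<close>. Per point of \<open>A\<close>, relative entropy
  costs \<open>K\<close>, the gains \<open>2 * K\<close> and the shift 3 on average, so on that
  quarter some point has at most \<open>4 * (3 * K + 3)\<close>.\<close>

lemma exists_good_fibre:
  fixes T0 t K :: real
  assumes t: "t = card J - log 2 (card A)" and "T0 \<ge> 0" and large: "t > 3 * T0 + 6"
    and K: "excess J A \<le> K * card A" "K \<ge> 0"
  obtains R x where "R \<subseteq> J" "x \<in> A" "card (J - R) - log 2 (card (cls A R x)) \<ge> T0"
    "relent R x + 3 \<le> 12 * K + 12" "(\<Sum>i\<in>J - R. gain i (cls A R x)) \<le> 12 * K + 12"
proof -
  obtain R where R: "R \<subseteq> J"
    and gR: "(\<Sum>i\<in>J - R. partial_excess A (insert i R) - partial_excess A R) \<le> 2 * excess J A"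
    and dR: "card A * card R - margent A R \<le> card A * (t / 2)"
    using exists_balanced_exposure[OF t] .
  define N where "N = real (card A)"
  have N: "N > 0" using card_A_pos by (simp add: N_def)
  define F where "F = (\<lambda>x. \<Sum>i\<in>J - R. gain i (cls A R x))"
  define Q where "Q = (\<lambda>x. relent R x + 3 + F x)"
  have ne: "cls A R x \<noteq> {}" if "x \<in> A" for x using that by (auto simp: cls_def)
  have F0: "F x \<ge> 0" if "x \<in> A" for x
    unfolding F_def using that by (intro sum_nonneg gain_nonneg) (auto simp: ne)
  have rel0: "relent R x + 3 \<ge> 0" if "x \<in> A" for x
  proof -
    have "card (cls A R x) * relent R x \<ge> - 3 * card (cls A R x)"
      using relent_ge[OF R that, of "{}" 1] by simp
    then have "card (cls A R x) * (relent R x + 3) \<ge> 0" by (simp add: algebra_simps)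
    then show ?thesis using card_cls_pos[OF that, of R] ne[OF that] by (auto simp: zero_le_mult_iff)
  qed
  have "(\<Sum>x\<in>A. F x) = (\<Sum>i\<in>J - R. \<Sum>x\<in>A. gain i (cls A R x))"
    unfolding F_def by (rule sum.swap)
  also have "\<dots> = (\<Sum>i\<in>J - R. partial_excess A (insert i R) - partial_excess A R)"
    by (rule sum.cong) (use R in \<open>auto simp: sum_gain_cls\<close>)
  finally have "(\<Sum>x\<in>A. F x) \<le> 2 * K * N" using gR K by (simp add: N_def)
  moreover have "(\<Sum>x\<in>A. relent R x) \<le> K * N" using sum_relent_le[OF R] K by (simp add: N_def)
  ultimately have sumQ: "(\<Sum>x\<in>A. Q x) \<le> (3 * K + 3) * N"
    by (simp add: Q_def sum.distrib N_def algebra_simps)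
  define G where "G = {x \<in> A. card (J - R) - log 2 (card (cls A R x)) < T0}"
  have G: "G \<subseteq> A" "finite G" using fin_A by (auto simp: G_def)
  have "\<not> card G > 3 / 4 * card A"
    using codim_le_of_typical_fibre[OF R t \<open>T0 \<ge> 0\<close> _ dR] large by (auto simp: G_def)
  moreover have "real (card (A - G)) = N - card G"
    using G card_mono[OF fin_A G(1)] by (simp add: card_Diff_subset N_def)
  ultimately have cG: "real (card (A - G)) \<ge> N / 4" by (simp add: N_def)
  have "\<exists>x\<in>A - G. Q x \<le> 12 * K + 12"
  proof (rule ccontr)
    assume "\<not> ?thesis"
    then have q: "Q x > 12 * K + 12" if "x \<in> A - G" for x using that by (meson not_le)
    have "card (A - G) \<noteq> 0" using cG N by (intro notI) simp
    then have "A - G \<noteq> {}" by (metis card.empty)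
    have "(3 * K + 3) * N = N / 4 * (12 * K + 12)" by (simp add: algebra_simps)
    also have "\<dots> \<le> card (A - G) * (12 * K + 12)" using cG K by (intro mult_right_mono) auto
    also have "\<dots> = (\<Sum>x\<in>A - G. 12 * K + 12)" by simp
    also have "\<dots> < (\<Sum>x\<in>A - G. Q x)"
      using q \<open>A - G \<noteq> {}\<close> fin_A by (intro sum_strict_mono) auto
    also have "\<dots> \<le> (\<Sum>x\<in>A. Q x)"
      using fin_A rel0 F0 by (intro sum_mono2) (auto simp: Q_def intro!: add_nonneg_nonneg)
    finally show False using sumQ by simp
  qed
  then obtain x where x: "x \<in> A - G" "Q x \<le> 12 * K + 12" by auto
  then show thesis
    using that[OF R, of x] F0[of x] rel0[of x] by (auto simp: G_def Q_def F_def)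
qed

text \<open>\<open>T0\<close> pays for three kinds of unexposed coordinates of the fibre
  \<open>B\<close>: those of small influence, with total influence at most \<open>4 * Q0\<close>;
  those of large gain, at most \<open>8 * k * Q0\<close> many; and \<open>k\<close> more. The latter
  are nearly constant on \<open>B\<close>, and the small relative entropy gives their common pattern
  probability at least \<open>2 powr (1 - k)\<close> in \<open>A\<close>, whereas small influences
  allow only less.\<close>

theorem codim_le_of_small_influences:
  fixes K \<delta> t :: real and k :: nat
  assumes t: "t = card J - log 2 (card A)"
    and K: "excess J A \<le> K * card A" "K \<ge> 0"
    and infl: "\<And>i. i \<in> J \<Longrightarrow> card A - real (card (stay i A)) \<le> \<delta> * card A" and "\<delta> \<ge> 0"
    and k: "real k \<ge> 14 * K + 15" and small: "\<delta> * k * 2 ^ k < 1"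
  shows "t \<le> 3 * ((4 + 8 * k) * (12 * K + 12) + k) + 6"
proof (rule ccontr)
  define Q0 where "Q0 = 12 * K + 12"
  define T0 where "T0 = (4 + 8 * k) * Q0 + k"
  have Q0: "Q0 \<ge> 12" using K by (simp add: Q0_def)
  have k0: "real k \<ge> 15" using k K by simp
  assume "\<not> t \<le> 3 * ((4 + 8 * k) * (12 * K + 12) + k) + 6"
  then have "t > 3 * T0 + 6" by (simp add: T0_def Q0_def)
  moreover have "T0 \<ge> 0" using Q0 by (simp add: T0_def)
  ultimately obtain R x where R: "R \<subseteq> J" and x: "x \<in> A"
    and tx: "card (J - R) - log 2 (card (cls A R x)) \<ge> T0"
    and rel: "relent R x + 3 \<le> Q0" and gx: "(\<Sum>i\<in>J - R. gain i (cls A R x)) \<le> Q0"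
    using exists_good_fibre[OF t _ _ K] unfolding Q0_def by metis
  define B where "B = cls A R x"
  define b where "b = real (card B)"
  have fB: "finite B" "B \<noteq> {}" and BJ: "B \<subseteq> Pow J" and BA: "B \<subseteq> A"
    using x A_subset fin_cls[of R x] unfolding B_def by (auto simp: cls_def)
  have b: "b > 0" using fB by (simp add: b_def card_gt_0_iff)
  define \<pi> where "\<pi> = (\<lambda>i. 1 - card (stay i B) / b)"
  define q where "q = (\<lambda>i. card {u \<in> B. i \<in> u} / b)"
  have gh: "0 \<le> q i" "q i \<le> 1" "1 - \<pi> i \<le> 2 * q i" "1 - \<pi> i \<le> 2 * (1 - q i)"
    "gain i B = binent (q i) - (1 - \<pi> i)" "0 \<le> \<pi> i" "\<pi> i \<le> 1" for i
    using gain_bounds[OF fB refl refl, of i] by (auto simp: q_def \<pi>_def b_def)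
  have g0: "gain i B \<ge> 0" for i using gain_nonneg[OF fB] .
  define D where "D = J - R"
  have fD: "finite D" using fin_J by (simp add: D_def)
  \<comment> \<open>Isoperimetry inside the fibre: its total influence in the unexposed directions
    is at least its codimension.\<close>
  have sumpi: "(\<Sum>i\<in>D. \<pi> i) \<ge> T0"
  proof -
    have "(\<Sum>i\<in>D. real (card (stay i B))) \<le> (\<Sum>i\<in>J. real (card (stay i B)))"
      using fin_J by (intro sum_mono2) (auto simp: D_def)
    also have "\<dots> \<le> b * log 2 b"
      using excess_nonneg[OF fin_J BJ] by (simp add: excess_def b_def)
    finally have "(\<Sum>i\<in>D. real (card (stay i B))) / b \<le> log 2 b"
      using b by (simp add: divide_le_eq mult.commute)
    then have "(\<Sum>i\<in>D. \<pi> i) \<ge> card D - log 2 b"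
      by (simp add: \<pi>_def sum_subtractf sum_divide_distrib)
    then show ?thesis using tx by (simp add: D_def b_def B_def)
  qed
  define D1 D2 D3 where "D1 = {i \<in> D. \<pi> i < 1 / 2}"
    and "D2 = {i \<in> D. \<pi> i \<ge> 1 / 2 \<and> gain i B \<ge> 1 / (8 * k)}"
    and "D3 = {i \<in> D. \<pi> i \<ge> 1 / 2 \<and> gain i B < 1 / (8 * k)}"
  have DD: "D = D1 \<union> D2 \<union> D3" "D1 \<inter> D2 = {}" "(D1 \<union> D2) \<inter> D3 = {}" "finite D1" "finite D2" "finite D3"
    using fD by (auto simp: D1_def D2_def D3_def)
  have gD: "(\<Sum>i\<in>E. gain i B) \<le> Q0" if "E \<subseteq> D" for E
  proof -
    have "(\<Sum>i\<in>E. gain i B) \<le> (\<Sum>i\<in>D. gain i B)"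
      using fD that g0 by (intro sum_mono2) auto
    then show ?thesis using gx by (simp add: D_def B_def)
  qed
  have "(\<Sum>i\<in>D1. \<pi> i) \<le> (\<Sum>i\<in>D1. 4 * gain i B)"
  proof (rule sum_mono)
    fix i assume "i \<in> D1"
    then show "\<pi> i \<le> 4 * gain i B"
      using gain_ge_of_small_influence[OF gh(1-4)[of i]] gh(5)[of i] by (simp add: D1_def)
  qed
  then have s1: "(\<Sum>i\<in>D1. \<pi> i) \<le> 4 * Q0"
    using gD[of D1] by (simp add: sum_distrib_left[symmetric] D1_def)
  have "card D2 * (1 / (8 * k)) \<le> (\<Sum>i\<in>D2. gain i B)"
    by (rule order_trans[OF _ sum_mono[where f = "\<lambda>_. 1 / (8 * real k)"]]) (auto simp: D2_def)
  also have "\<dots> \<le> Q0" using gD[of D2] by (simp add: D2_def)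
  finally have s2: "card D2 \<le> 8 * k * Q0" using k0 by (simp add: field_simps)
  have "(\<Sum>i\<in>D. \<pi> i) = (\<Sum>i\<in>D1. \<pi> i) + (\<Sum>i\<in>D2. \<pi> i) + (\<Sum>i\<in>D3. \<pi> i)"
    using DD by (simp add: sum.union_disjoint)
  also have "(\<Sum>i\<in>D2. \<pi> i) \<le> (\<Sum>i\<in>D2. 1)" by (intro sum_mono gh)
  also have "(\<Sum>i\<in>D3. \<pi> i) \<le> (\<Sum>i\<in>D3. 1)" by (intro sum_mono gh)
  finally have "T0 \<le> 4 * Q0 + 8 * k * Q0 + card D3" using sumpi s1 s2 by simp
  then have "k \<le> card D3" by (simp add: T0_def algebra_simps)
  then obtain T where T: "T \<subseteq> D3" "card T = k" "finite T"
    using obtain_subset_with_card_n by metis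
  have TJ: "T \<subseteq> J" and TR: "T \<subseteq> J - R" using T by (auto simp: D3_def D_def)
  define P where "P = {i \<in> T. q i > 1 / 2}"
  have mis: "card {u \<in> B. (i \<in> u) \<noteq> (i \<in> P)} \<le> b / (8 * k)" if i: "i \<in> T" for i
  proof -
    have gi: "gain i B < 1 / (8 * k)" "\<pi> i \<ge> 1 / 2" using i T by (auto simp: D3_def)
    have "1 / (8 * real k) \<le> 1 / 8" using k0 by (simp add: field_simps)
    then have "min (q i) (1 - q i) \<le> gain i B"
      using min_le_gain_of_large_influence[OF gh(1-4)[of i] gi(2)] gi(1) gh(5)[of i] by simp
    then have m: "min (q i) (1 - q i) \<le> 1 / (8 * k)" using gi by simp
    have "real (card {u \<in> B. (i \<in> u) \<noteq> (i \<in> P)}) = b * min (q i) (1 - q i)"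
    proof (cases "i \<in> P")
      case True
      have "real (card {u \<in> B. i \<notin> u}) = b * (1 - q i)"
        using card_split_mem[OF fB(1), of i] b by (simp add: b_def q_def field_simps)
      then show ?thesis using True by (simp add: P_def min_def)
    next
      case False
      have "real (card {u \<in> B. i \<in> u}) = b * q i" using b by (simp add: q_def)
      then show ?thesis using False i by (simp add: P_def min_def)
    qed
    also have "\<dots> \<le> b * (1 / (8 * k))" using m b by (intro mult_left_mono) auto
    finally show ?thesis by simp
  qed
  define E where "E = {u \<in> B. u \<inter> T = P}"
  \<comment> \<open>A union bound over the \<open>k\<close> coordinates; the threshold
    \<open>1 / (8 * k)\<close> keeps the loss at an eighth of \<open>B\<close>.\<close>
  have "B \<subseteq> E \<union> (\<Union>i\<in>T. {u \<in> B. (i \<in> u) \<noteq> (i \<in> P)})"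
    by (auto simp: E_def P_def)
  then have "card B \<le> card (E \<union> (\<Union>i\<in>T. {u \<in> B. (i \<in> u) \<noteq> (i \<in> P)}))"
    using fB T by (intro card_mono) (auto simp: E_def)
  also have "\<dots> \<le> card E + card (\<Union>i\<in>T. {u \<in> B. (i \<in> u) \<noteq> (i \<in> P)})" by (rule card_Un_le)
  also have "card (\<Union>i\<in>T. {u \<in> B. (i \<in> u) \<noteq> (i \<in> P)}) \<le> (\<Sum>i\<in>T. card {u \<in> B. (i \<in> u) \<noteq> (i \<in> P)})"
    by (rule card_UN_le[OF T(3)])
  finally have "b \<le> card E + (\<Sum>i\<in>T. real (card {u \<in> B. (i \<in> u) \<noteq> (i \<in> P)}))"
    by (simp add: b_def flip: of_nat_sum of_nat_add)
  also have "(\<Sum>i\<in>T. real (card {u \<in> B. (i \<in> u) \<noteq> (i \<in> P)})) \<le> (\<Sum>i\<in>T. b / (8 * k))"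
    by (intro sum_mono mis)
  also have "\<dots> = b / 8" using T k0 by simp
  finally have cE: "card E \<ge> 7 / 8 * b" by simp
  define \<eta> where "\<eta> = card {w \<in> A. w \<inter> T = P} / real (card A)"
  have "E \<noteq> {}" using cE b by auto
  moreover have "E \<subseteq> {w \<in> A. w \<inter> T = P}" using BA by (auto simp: E_def)
  ultimately have "{w \<in> A. w \<inter> T = P} \<noteq> {}" by auto
  then have \<eta>: "\<eta> > 0" using fin_A card_A_pos by (simp add: \<eta>_def card_gt_0_iff)
  have "card {w \<in> A. w \<inter> T = P} \<le> card A" using fin_A by (intro card_mono) auto
  then have \<eta>1: "\<eta> \<le> 1" using card_A_pos by (simp add: \<eta>_def)
  have "(\<Sum>u\<in>E. real (card (cls A (J - R) u))) \<le> card {w \<in> A. w \<inter> T = P}"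
    by (rule sum_card_cls_complement_le[OF R TR, of _ x]) (auto simp: E_def B_def)
  then have "(\<Sum>u\<in>E. real (card (cls A (J - R) u))) \<le> \<eta> * card A"
    using card_A_pos by (simp add: \<eta>_def)
  then have "b * relent R x \<ge> card E * log 2 (1 / \<eta>) - 3 * b"
    using relent_ge[OF R x _ \<eta>, of E] by (auto simp: E_def B_def b_def)
  moreover have "card E * log 2 (1 / \<eta>) \<ge> 7 / 8 * b * log 2 (1 / \<eta>)"
    using cE \<eta> \<eta>1 by (intro mult_right_mono) auto
  ultimately have "b * (7 / 8 * log 2 (1 / \<eta>)) \<le> b * (relent R x + 3)" by (simp add: algebra_simps)
  then have "7 / 8 * log 2 (1 / \<eta>) \<le> relent R x + 3" using b by (simp add: mult_le_cancel_left_pos)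
  then have "log 2 (1 / \<eta>) \<le> 8 / 7 * Q0" using rel by simp
  \<comment> \<open>Since \<open>8 / 7 * 12 \<le> 14\<close>, the lower bound
    \<open>14 * K + 15\<close> on \<open>k\<close> leaves one bit to spare.\<close>
  also have "\<dots> \<le> real k - 1" using k K by (simp add: Q0_def)
  finally have "1 / \<eta> \<le> 2 powr (real k - 1)" using \<eta> by (simp add: log_le_iff)
  then have l: "2 \<le> 2 ^ k * \<eta>"
    using \<eta> by (simp add: powr_diff powr_realpow field_simps)
  have "2 ^ card T * (card {w \<in> A. w \<inter> T = P} - card T * (\<delta> * card A)) \<le> card A"
    by (rule card_pattern_le[OF TJ]) (use infl TJ \<open>\<delta> \<ge> 0\<close> in \<open>auto simp: P_def\<close>)
  then have "card A * (2 ^ k * \<eta> - \<delta> * k * 2 ^ k) \<le> real (card A) * 1"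
    using T card_A_pos by (simp add: \<eta>_def algebra_simps)
  then have "2 ^ k * \<eta> - \<delta> * k * 2 ^ k \<le> 1" using card_A_pos by (simp only: mult_le_cancel_left_pos)
  then show False using l small by simp
qed

end

section \<open>A split with large gain\<close>

text \<open>\<open>m\<close> collects the fixed coordinates with value 1;
  \<open>m \<subseteq> T\<close> keeps every such set nonempty.\<close>

definition scube :: "'a set \<Rightarrow> 'a set set \<Rightarrow> bool" where
  "scube J C \<longleftrightarrow> (\<exists>T m. m \<subseteq> T \<and> T \<subseteq> J \<and> C = {x \<in> Pow J. x \<inter> T = m})"

text \<open>Coordinates are fixed one at a time. Discarding the minority part \<open>F\<close> of
  \<open>D\<close> lowers the excess by at least \<open>l * card F\<close>: with
  \<open>q = card F / card D \<le> 2 * \<gamma>\<close> the entropy is at least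
  \<open>q * log 2 (1 / q)\<close>, and at most \<open>2 * card F\<close> points stay, whence the
  \<open>- 2\<close> in \<open>l\<close>. The bound on the excess keeps \<open>D\<close> at least
  half as large as \<open>B\<close>, whence the factor 2 before \<gamma>.\<close>

lemma restrict_to_majority:
  fixes \<gamma> l :: real
  assumes J: "finite J" and B: "B \<subseteq> Pow J" "B \<noteq> {}" and S: "S \<subseteq> J"
    and mis: "\<And>i. i \<in> S \<Longrightarrow> card {x \<in> B. (i \<in> x) \<noteq> (i \<in> m)} \<le> \<gamma> * card B"
    and \<gamma>: "\<gamma> > 0" and l: "l = log 2 (1 / (2 * \<gamma>)) - 2" "l > 0"
    and small: "excess J B \<le> l * card B / 2"
  shows "excess J {x \<in> B. x \<inter> S = m \<inter> S} + l * (real (card B) - card {x \<in> B. x \<inter> S = m \<inter> S}) \<le> excess J B"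
proof -
  have fB: "finite B" using B J finite_subset by auto
  have cB: "real (card B) > 0" using B fB by (simp add: card_gt_0_iff)
  have "finite S" using S J finite_subset by blast
  then show ?thesis using S mis
  proof (induction S rule: finite_induct)
    case (insert i U)
    define D where "D = {x \<in> B. x \<inter> U = m \<inter> U}"
    define E where "E = {x \<in> D. (i \<in> x) = (i \<in> m)}"
    define F where "F = {x \<in> D. (i \<in> x) \<noteq> (i \<in> m)}"
    have IH: "excess J D + l * (real (card B) - card D) \<le> excess J B"
      unfolding D_def by (rule insert.IH) (use insert.prems in auto)
    have D: "finite D" "D \<subseteq> Pow J" using fB B by (auto simp: D_def)
    have "l * (real (card B) - card D) \<le> l * (card B / 2)"
      using IH excess_nonneg[OF J D(2)] small by simp
    then have half: "real (card D) \<ge> card B / 2" using l(2) by simp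
    then have cD: "real (card D) > 0" "D \<noteq> {}" using cB by auto
    have split: "excess J D = excess J E + excess J F + card D * gain i D"
      and card: "real (card D) = card E + card F"
      and stay: "card (stay i D) \<le> 2 * card F"
      and bin: "binent (card {x \<in> D. i \<in> x} / card D) = binent (card F / card D)"
    proof -
      have iJ: "i \<in> J" using insert.prems by auto
      show "excess J D = excess J E + excess J F + card D * gain i D"
        using excess_split[OF J iJ D(1) cD(2)] by (cases "i \<in> m") (auto simp: E_def F_def)
      show c: "real (card D) = card E + card F"
        using card_split_mem[OF D(1), of i] by (cases "i \<in> m") (auto simp: E_def F_def)
      show "card (stay i D) \<le> 2 * card F"
        using card_stay_le[OF D(1), of i] by (cases "i \<in> m") (auto simp: F_def)
      show "binent (card {x \<in> D. i \<in> x} / card D) = binent (card F / card D)"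
      proof (cases "i \<in> m")
        case True
        have "{x \<in> D. i \<in> x} = E" using True by (auto simp: E_def)
        moreover have "card E / card D = 1 - card F / card D" using c cD by (simp add: field_simps)
        ultimately show ?thesis by (simp add: binent_sym)
      qed (auto simp: F_def)
    qed
    have "card F \<le> card {x \<in> B. (i \<in> x) \<noteq> (i \<in> m)}"
      using fB by (intro card_mono) (auto simp: F_def D_def)
    also have "\<dots> \<le> \<gamma> * card B" using insert.prems by auto
    also have "\<dots> \<le> \<gamma> * (2 * card D)" using half \<gamma> by (intro mult_left_mono) auto
    finally have q: "card F / card D \<le> 2 * \<gamma>" using cD by (simp add: field_simps)
    have "card D * gain i D \<ge> l * card F"
    proof (cases "card F = 0")
      case True
      then show ?thesis using gain_nonneg[OF D(1) cD(2)] by simp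
    next
      case False
      define q where "q = card F / real (card D)"
      have q0: "q > 0" "q \<le> 1" "q \<le> 2 * \<gamma>" using False cD card q by (auto simp: q_def)
      have "log 2 (1 / (2 * \<gamma>)) \<le> log 2 (1 / q)"
        using q0 \<gamma> by (subst log_le_cancel_iff) (auto simp: frac_le)
      then have "q * log 2 (1 / (2 * \<gamma>)) \<le> binent q"
        using binent_ge_log[OF q0(1,2)] q0 by (meson less_imp_le mult_left_mono order_trans)
      moreover have "card (stay i D) / card D \<le> 2 * q"
      proof -
        have "real (card (stay i D)) \<le> 2 * card F" using stay by simp
        then show ?thesis using cD by (simp add: q_def divide_right_mono)
      qed
      moreover have "log 2 (1 / (2 * \<gamma>)) = l + 2" using l(1) by simp
      moreover have "q * (l + 2) = q * l + 2 * q" by (simp add: algebra_simps)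
      moreover have "gain i D = binent q - card (stay i D) / card D" by (simp add: gain_def bin q_def)
      ultimately have "gain i D \<ge> q * l" by simp
      then have "card D * (q * l) \<le> card D * gain i D" by (intro mult_left_mono) auto
      then show ?thesis using cD by (simp add: q_def mult.commute)
    qed
    moreover have "excess J F \<ge> 0" using D by (intro excess_nonneg J) (auto simp: F_def)
    ultimately have "excess J E + l * card F \<le> excess J D" using split by simp
    then have "excess J E + l * (real (card B) - card E) \<le> excess J B"
      using IH card by (simp add: algebra_simps)
    moreover have "E = {x \<in> B. x \<inter> insert i U = m \<inter> insert i U}"
      unfolding E_def D_def by auto
    ultimately show ?case by simp
  qed simp
qed

text \<open>The case of an indicator function of mean \<mu>: the variance is
  \<open>\<mu> * v\<close>, the energy at most \<open>2 * \<mu> * W\<close>, and the squared L1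
  norms sum to at most \<open>4 * \<mu>\<^sup>2 * \<delta> * W\<close>.\<close>

lemma Falik_Samorodnitsky_set:
  fixes \<delta> v W :: real
  assumes J: "finite J" and A: "A \<subseteq> Pow J" "A \<noteq> {}"
    and v: "v = 1 - card A / 2 ^ card J" "v > 0"
    and infl: "\<And>i. i \<in> J \<Longrightarrow> card A - real (card (stay i A)) \<le> \<delta> * card A" and \<delta>: "\<delta> > 0"
    and W: "(\<Sum>i\<in>J. card A - real (card (stay i A))) \<le> W * card A" "W > 0"
  shows "v * ln (v / (\<delta> * W)) \<le> 2 * W"
proof -
  define \<mu> where "\<mu> = card A / 2 ^ card J"
  have fA: "finite A" using A J finite_subset by auto
  have N: "real (card A) > 0" using A fA by (simp add: card_gt_0_iff)
  have \<mu>: "\<mu> > 0" "\<mu> < 1" using v N by (auto simp: \<mu>_def)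
  define f where "f = (\<lambda>x. of_bool (x \<in> A) :: real)"
  define I where "I = (\<lambda>j. (card A - real (card (stay j A))) / card A)"
  have av_ind: "av J (\<lambda>x. of_bool (x \<in> E)) = card E / 2 ^ card J" if "E \<subseteq> A" for E
  proof -
    have "Pow J \<inter> {x. x \<in> E} = E" using that A by auto
    then show ?thesis using J by (simp add: av_def sum_of_bool_eq)
  qed
  have f2: "(\<lambda>x. (f x)\<^sup>2) = f" by (auto simp: f_def)
  have avf: "av J f = \<mu>" unfolding f_def \<mu>_def by (rule av_ind) simp
  have I: "I j \<ge> 0" "card (A - stay j A) / 2 ^ card J = \<mu> * I j" for j
  proof -
    have s: "stay j A \<subseteq> A" by (auto simp: stay_def)
    have "card (stay j A) \<le> card A" using fA s by (intro card_mono)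
    then show "I j \<ge> 0" by (simp add: I_def)
    have "real (card (A - stay j A)) = card A - real (card (stay j A))"
      using fA s \<open>card (stay j A) \<le> card A\<close> by (subst card_Diff_subset) (auto intro: finite_subset)
    then show "card (A - stay j A) / 2 ^ card J = \<mu> * I j" using N by (simp add: I_def \<mu>_def)
  qed
  have \<beta>: "av J (\<lambda>x. \<bar>f x - f (flip j x)\<bar>) = 2 * \<mu> * I j" if "j \<in> J" for j
  proof -
    define a where "a = (\<lambda>x. of_bool (x \<in> A - stay j A) :: real)"
    have "(\<lambda>x. \<bar>f x - f (flip j x)\<bar>) = (\<lambda>x. a x + a (flip j x))"
      by (auto simp: f_def a_def stay_def fun_eq_iff)
    then have "av J (\<lambda>x. \<bar>f x - f (flip j x)\<bar>) = 2 * av J a"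
      using av_flip[OF that, of a] by (simp add: av_add)
    also have "av J a = \<mu> * I j" unfolding a_def by (subst av_ind) (auto simp: I)
    finally show ?thesis by simp
  qed
  have "(\<lambda>x. (f x - f (flip j x))\<^sup>2) = (\<lambda>x. \<bar>f x - f (flip j x)\<bar>)" for j
    by (auto simp: f_def)
  then have "energy J f = (\<Sum>j\<in>J. 2 * \<mu> * I j)"
    unfolding energy_def by (intro sum.cong) (auto simp: \<beta>)
  also have "\<dots> = 2 * \<mu> * (\<Sum>j\<in>J. I j)" by (simp add: sum_distrib_left)
  also have sI: "(\<Sum>j\<in>J. I j) \<le> W"
    using W(1) N by (simp add: I_def sum_divide_distrib[symmetric] divide_le_eq)
  finally have en: "energy J f \<le> 2 * \<mu> * W" using \<mu> by (simp add: mult_left_mono)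
  have "(\<Sum>j\<in>J. (av J (\<lambda>x. \<bar>f x - f (flip j x)\<bar>))\<^sup>2) = (\<Sum>j\<in>J. 4 * \<mu>\<^sup>2 * (I j * I j))"
    by (intro sum.cong) (auto simp: \<beta> power2_eq_square)
  also have "\<dots> \<le> (\<Sum>j\<in>J. 4 * \<mu>\<^sup>2 * (\<delta> * I j))"
  proof (intro sum_mono mult_left_mono mult_right_mono)
    fix i assume "i \<in> J"
    then show "I i \<le> \<delta>" using infl[of i] N by (simp add: I_def divide_le_eq)
  qed (use I in auto)
  also have "\<dots> = 4 * \<mu>\<^sup>2 * \<delta> * (\<Sum>j\<in>J. I j)" by (simp add: sum_distrib_left mult.assoc)
  also have "\<dots> \<le> 4 * \<mu>\<^sup>2 * \<delta> * W" using sI \<delta> by (intro mult_left_mono) auto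
  finally have sb: "(\<Sum>j\<in>J. (av J (\<lambda>x. \<bar>f x - f (flip j x)\<bar>))\<^sup>2) \<le> 4 * \<mu>\<^sup>2 * \<delta> * W" .
  \<comment> \<open>With this value the subtracted term equals the variance and cancels the
    \<open>1\<close> next to \<open>ln s\<close>.\<close>
  define s where "s = v / (\<mu> * \<delta> * W)"
  have s: "s > 0" using v \<mu> \<delta> W by (simp add: s_def)
  have "(\<mu> - \<mu>\<^sup>2) * (ln s + 1) - s / 4 * (4 * \<mu>\<^sup>2 * \<delta> * W)
    \<le> (\<mu> - \<mu>\<^sup>2) * (ln s + 1) - s / 4 * (\<Sum>j\<in>J. (av J (\<lambda>x. \<bar>f x - f (flip j x)\<bar>))\<^sup>2)"
    using sb s by (simp add: mult_left_mono)
  also have "\<dots> \<le> energy J f"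
    using Falik_Samorodnitsky[OF J s, of f] by (simp add: f2 avf)
  also have "\<dots> \<le> 2 * \<mu> * W" by (rule en)
  finally have "(\<mu> - \<mu>\<^sup>2) * (ln s + 1) - s / 4 * (4 * \<mu>\<^sup>2 * \<delta> * W) \<le> 2 * \<mu> * W" .
  moreover have "s / 4 * (4 * \<mu>\<^sup>2 * \<delta> * W) = \<mu> * v"
    using \<mu> \<delta> W by (simp add: s_def power2_eq_square)
  moreover have "\<mu> - \<mu>\<^sup>2 = \<mu> * v" by (simp add: v \<mu>_def power2_eq_square algebra_simps)
  ultimately have "\<mu> * (v * ln s) \<le> \<mu> * (2 * W)" by (simp add: algebra_simps)
  then have "v * ln s \<le> 2 * W" using \<mu> by (simp add: mult_le_cancel_left_pos)
  moreover have "v / (\<delta> * W) \<le> s"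
    using v \<mu> \<delta> W unfolding s_def by (intro divide_left_mono) auto
  then have "v * ln (v / (\<delta> * W)) \<le> v * ln s"
    using v \<delta> W s by (intro mult_left_mono) (auto simp: ln_le_cancel_iff)
  ultimately show ?thesis by simp
qed

text \<open>On a face no point stays in a fixed direction, so these directions contribute nothing
  and can be deleted. Afterwards density and codimension are measured relative to the face.\<close>

lemma restrict_to_face:
  assumes J: "finite J" and S: "S \<subseteq> J" and B: "B \<subseteq> {x \<in> Pow J. x \<inter> S = m}"
  defines "A \<equiv> (\<lambda>x. x - S) ` B"
  shows "A \<subseteq> Pow (J - S)" "card A = card B"
    "\<And>i. i \<in> J - S \<Longrightarrow> card (stay i A) = card (stay i B)"
    "excess (J - S) A = excess J B"
proof -
  show "A \<subseteq> Pow (J - S)" using B by (auto simp: A_def)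
  have inj: "inj_on (\<lambda>x. x - S) B"
  proof (rule inj_onI)
    fix x y assume "x \<in> B" "y \<in> B" "x - S = y - S"
    moreover from this B have "x \<inter> S = m" "y \<inter> S = m" by blast+
    ultimately show "x = y" by blast
  qed
  show cA: "card A = card B" unfolding A_def by (rule card_image[OF inj])
  show cs: "card (stay i A) = card (stay i B)" if i: "i \<in> J - S" for i
  proof -
    have fl: "flip i (x - S) = flip i x - S" for x using i by (auto simp: flip_def)
    have mem: "y - S \<in> A \<longleftrightarrow> y \<in> B" if "y \<inter> S = m" for y
    proof
      assume "y - S \<in> A"
      then obtain z where z: "z \<in> B" "y - S = z - S" by (auto simp: A_def)
      moreover have "z \<inter> S = m" using z B by auto
      ultimately have "y = z" using that by blast
      then show "y \<in> B" using z by simp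
    qed (auto simp: A_def)
    have fm: "flip i x - S \<in> A \<longleftrightarrow> flip i x \<in> B" if "x \<in> B" for x
      by (rule mem) (use that B i in \<open>auto simp: flip_Int\<close>)
    have "stay i A = (\<lambda>x. x - S) ` stay i B"
    proof (intro equalityI subsetI)
      fix y assume "y \<in> stay i A"
      then obtain x where "x \<in> B" "y = x - S" "flip i (x - S) \<in> A" by (auto simp: stay_def A_def)
      then show "y \<in> (\<lambda>x. x - S) ` stay i B" using fm by (auto simp: stay_def fl)
    next
      fix y assume "y \<in> (\<lambda>x. x - S) ` stay i B"
      then obtain x where "x \<in> B" "flip i x \<in> B" "y = x - S" by (auto simp: stay_def)
      then show "y \<in> stay i A" using fm by (auto simp: stay_def fl A_def)
    qed
    moreover have "inj_on (\<lambda>x. x - S) (stay i B)" using inj by (rule inj_on_subset) (auto simp: stay_def)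
    ultimately show ?thesis by (simp add: card_image)
  qed
  have "stay i B = {}" if "i \<in> S" for i
  proof (rule equals0I)
    fix x assume "x \<in> stay i B"
    then have "x \<inter> S = flip i x \<inter> S" using B by (auto simp: stay_def)
    then show False using that by (auto simp: flip_def split: if_splits)
  qed
  then have "(\<Sum>i\<in>J. real (card (stay i B))) = (\<Sum>i\<in>J - S. real (card (stay i B)))"
    using J by (intro sum.mono_neutral_right) auto
  also have "\<dots> = (\<Sum>i\<in>J - S. real (card (stay i A)))"
    by (intro sum.cong) (auto simp: cs)
  finally show "excess (J - S) A = excess J B" by (simp add: excess_def cA)
qed

lemma card_face:
  assumes J: "finite J" and S: "S \<subseteq> J" "m \<subseteq> S"
  shows "card {x \<in> Pow J. x \<inter> S = m} = 2 ^ card (J - S)"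
proof -
  have "bij_betw (\<lambda>y. y \<union> m) (Pow (J - S)) {x \<in> Pow J. x \<inter> S = m}"
    by (rule bij_betw_byWitness[where f' = "\<lambda>x. x - S"]) (use S in auto)
  then have "card (Pow (J - S)) = card {x \<in> Pow J. x \<inter> S = m}" by (rule bij_betw_same_card)
  then show ?thesis using J by (simp add: card_Pow)
qed

text \<open>The case of density at least 1/2: \<open>W\<close> is proportional to \<open>v\<close>,
  which cancels and leaves \<Gamma> against a linear function of \<open>M\<close>.\<close>

lemma large_density_contradiction:
  fixes M \<Gamma> v W :: real
  assumes "M > 0" and \<Gamma>: "\<Gamma> \<ge> 1000000 * M\<^sup>2 + 1000000" and v: "v > 0" and W: "W = (3 + 6 * M) * v"
    and FS: "v * ln (v / (5 * 2 powr (- \<Gamma>) * W)) \<le> 2 * W"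
  shows False
proof -
  have "v / (5 * 2 powr (- \<Gamma>) * (c * v)) = 2 powr \<Gamma> / (5 * c)" if "c > 0" for c
    using v that by (simp add: powr_minus field_simps)
  then have "v / (5 * 2 powr (- \<Gamma>) * W) = 2 powr \<Gamma> / (5 * (3 + 6 * M))"
    using assms(1) by (simp add: W)
  moreover have "ln (2 powr \<Gamma> / (5 * (3 + 6 * M))) = \<Gamma> * ln 2 - ln (5 * (3 + 6 * M))"
    using assms(1) by (subst ln_div) auto
  ultimately have "v * (\<Gamma> * ln 2 - ln (5 * (3 + 6 * M))) \<le> v * (2 * (3 + 6 * M))"
    using FS by (simp add: W mult.commute mult.left_commute)
  then have "\<Gamma> * ln 2 - ln (5 * (3 + 6 * M)) \<le> 2 * (3 + 6 * M)"
    using v by (simp only: mult_le_cancel_left_pos)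
  moreover have "ln (5 * (3 + 6 * M)) \<le> 5 * (3 + 6 * M) - 1"
    using assms(1) by (intro ln_le_minus_one) simp
  ultimately have 1: "\<Gamma> * ln 2 \<le> 20 + 42 * M" by simp
  have "\<Gamma> \<ge> 0" using \<Gamma> zero_le_power2[of M] by linarith
  then have 3: "\<Gamma> * (2 / 3) \<le> \<Gamma> * ln 2"
    using ln2_ge_two_thirds by (intro mult_left_mono) auto
  have "(M - 1)\<^sup>2 \<ge> 0" by simp
  then have "2 * M \<le> M\<^sup>2 + 1" by (simp add: power2_eq_square algebra_simps)
  then show False using 1 3 \<Gamma> zero_le_power2[of M] by linarith
qed

text \<open>The case of density at most 1/2, where \<open>W\<close> is of the order of the
  codimension bound. It dictates the quadratic growth of \<Gamma>, and the factor 1000000 is chosen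
  so that \<open>2 * 14 * 16508\<close> stays below two thirds of it.\<close>

lemma small_density_contradiction:
  fixes M \<Gamma> v W :: real
  assumes "M > 0" and \<Gamma>: "\<Gamma> \<ge> 1000000 * M\<^sup>2 + 1000000" and v: "v \<ge> 1 / 2" and W: "W = 16508 * (M + 1)\<^sup>2"
    and FS: "v * ln (v / (5 * 2 powr (- \<Gamma>) * W)) \<le> 2 * W"
  shows False
proof -
  have W0: "W > 0" using assms(1) by (simp add: W)
  define y where "y = v / (5 * 2 powr (- \<Gamma>) * W)"
  have y0: "y > 0" using v W0 by (simp add: y_def)
  have "ln y \<le> 4 * W"
  proof (cases "ln y \<ge> 0")
    case True
    then have "1 / 2 * ln y \<le> v * ln y" using v by (intro mult_right_mono)
    then show ?thesis using FS by (simp add: y_def)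
  qed (use W0 in auto)
  moreover have "2 powr \<Gamma> / (10 * W) \<le> y"
    using v W0 by (simp add: y_def powr_minus field_simps)
  then have "ln (2 powr \<Gamma> / (10 * W)) \<le> ln y" using y0 W0 by (subst ln_le_cancel_iff) auto
  moreover have "ln (2 powr \<Gamma> / (10 * W)) = \<Gamma> * ln 2 - ln (10 * W)"
    using W0 by (subst ln_div) auto
  moreover have "ln (10 * W) \<le> 10 * W - 1" using W0 by (intro ln_le_minus_one) simp
  ultimately have 1: "\<Gamma> * ln 2 \<le> 14 * W" by linarith
  have "\<Gamma> \<ge> 0" using \<Gamma> zero_le_power2[of M] by linarith
  then have 3: "\<Gamma> * (2 / 3) \<le> \<Gamma> * ln 2"
    using ln2_ge_two_thirds by (intro mult_left_mono) auto
  have "(M - 1)\<^sup>2 \<ge> 0" by simp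
  then have "(M + 1)\<^sup>2 \<le> 2 * M\<^sup>2 + 2" by (simp add: power2_eq_square algebra_simps)
  then show False using 1 3 \<Gamma> zero_le_power2[of M] unfolding W by linarith
qed

text \<open>\<open>k\<close> is the pattern length of \<open>codim_le_of_small_influences\<close>
  for the excess bound \<open>2 * M\<close> and influences \<open>5 * 2 powr (- \<Gamma>)\<close>.
  The second property amounts to \<open>2 * k + 3 < \<Gamma>\<close>; in the third,
  \<open>16508 = 3 * 228 * 24 + 92\<close>, where 92 absorbs the terms linear in \<open>k\<close>
  and \<open>M\<close>.\<close>

lemma exists_exponent:
  fixes M \<Gamma> :: real
  assumes "M > 0" and \<Gamma>: "\<Gamma> \<ge> 1000000 * M\<^sup>2 + 1000000"
  obtains k :: nat where "real k \<ge> 14 * (2 * M) + 15" "5 * 2 powr (- \<Gamma>) * k * 2 ^ k < 1"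
    "3 * ((4 + 8 * k) * (12 * (2 * M) + 12) + k) + 6 + 2 * M \<le> 16508 * (M + 1)\<^sup>2"
proof -
  define k where "k = nat \<lceil>28 * M + 15\<rceil>"
  have k: "real k \<ge> 28 * M + 15" "real k < 28 * M + 16"
    unfolding k_def using assms(1) by (auto simp: of_nat_nat) linarith+
  have m: "(M - 1)\<^sup>2 \<ge> 0" by simp
  then have m2: "2 * M \<le> M\<^sup>2 + 1" by (simp add: power2_eq_square algebra_simps)
  have "real k \<le> 2 ^ k" by (metis less_exp less_imp_le of_nat_le_iff of_nat_numeral of_nat_power)
  then have "5 * 2 powr (- \<Gamma>) * k * 2 ^ k \<le> 2 powr 3 * 2 powr (- \<Gamma>) * 2 ^ k * 2 ^ k"
    by (intro mult_right_mono mult_mono) auto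
  also have "\<dots> = 2 powr 3 * 2 powr (- \<Gamma>) * 2 powr k * 2 powr k"
    by (simp add: powr_realpow)
  also have "\<dots> = 2 powr (3 + - \<Gamma> + k + k)"
    by (simp only: powr_add)
  also have "\<dots> < 2 powr 0"
  proof (rule powr_less_mono)
    show "3 + - \<Gamma> + k + k < 0" using k m2 \<Gamma> zero_le_power2[of M] by linarith
  qed simp
  finally have 1: "5 * 2 powr (- \<Gamma>) * k * 2 ^ k < 1" by simp
  have "(4 + 8 * k) * (12 * (2 * M) + 12) \<le> (228 * (M + 1)) * (24 * (M + 1))"
    using k assms(1) by (intro mult_mono) auto
  also have "\<dots> = 5472 * (M + 1)\<^sup>2" by (simp add: power2_eq_square algebra_simps)
  finally have a: "(4 + 8 * k) * (12 * (2 * M) + 12) \<le> 5472 * (M + 1)\<^sup>2" .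
  have "(M + 1)\<^sup>2 = M\<^sup>2 + 2 * M + 1" by (simp add: power2_eq_square algebra_simps)
  then have "3 * ((4 + 8 * k) * (12 * (2 * M) + 12)) + 3 * k + 6 + 2 * M \<le> 16508 * (M + 1)\<^sup>2"
    using a k assms(1) zero_le_power2[of M] by linarith
  then have "3 * ((4 + 8 * k) * (12 * (2 * M) + 12) + k) + 6 + 2 * M \<le> 16508 * (M + 1)\<^sup>2"
    by (simp only: distrib_left)
  then show thesis using that[of k] k(1) 1 by simp
qed

text \<open>The lower bound is proportional to \<open>r\<close>, so \<open>card B\<close> times the
  gain is at least a fixed multiple of the distance of \<open>B\<close> from subcubes. Such bounds
  add up over the parts of a round.\<close>

lemma exists_gain:
  fixes M r :: real
  assumes J: "finite J" and B: "B \<subseteq> Pow J" "B \<noteq> {}" and M: "M > 0" and r: "r > 0"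
    and far: "\<And>C. scube J C \<Longrightarrow> r * card B \<le> card (sym_diff B C)"
    and exc: "excess J B \<le> M * r * card B"
  shows "\<exists>i\<in>J. 2 powr (- (1000000 * M\<^sup>2 + 1000000)) * r \<le> gain i B"
proof (rule ccontr)
  define \<Gamma> where "\<Gamma> = 1000000 * M\<^sup>2 + 1000000"
  define \<gamma> where "\<gamma> = 2 powr (- \<Gamma>)"
  assume "\<not> ?thesis"
  then have g: "gain i B < \<gamma> * r" if "i \<in> J" for i
    using that by (auto simp: \<gamma>_def \<Gamma>_def not_le)
  have fB: "finite B" using B J finite_subset by auto
  define b where "b = real (card B)"
  have b: "b > 0" using B fB by (simp add: b_def card_gt_0_iff)
  \<comment> \<open>A single point of \<open>B\<close> is a subcube at distance less than
    \<open>card B\<close>.\<close>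
  have r1: "r \<le> 1"
  proof -
    obtain x where x: "x \<in> B" using B by auto
    have "scube J {x}" unfolding scube_def using B x by (intro exI[of _ J] exI[of _ x]) auto
    then have "r * card B \<le> card (sym_diff B {x})" by (rule far)
    also have "sym_diff B {x} = B - {x}" using x by auto
    also have "card (B - {x}) \<le> card B" using fB by (intro card_mono) auto
    finally have "b * r \<le> b * 1" by (simp add: b_def mult.commute)
    then show ?thesis using b by (simp only: mult_le_cancel_left_pos)
  qed
  have "(M - 1)\<^sup>2 \<ge> 0" by simp
  then have m2: "2 * M \<le> M\<^sup>2 + 1" by (simp add: power2_eq_square algebra_simps)
  have \<Gamma>8: "\<Gamma> - 3 \<ge> 8 * M + 10" using m2 zero_le_power2[of M] unfolding \<Gamma>_def by linarith
  have \<gamma>: "\<gamma> > 0" by (simp add: \<gamma>_def)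
  have "\<gamma> < 2 powr (- 3)" unfolding \<gamma>_def using \<Gamma>8 M by (intro powr_less_mono) auto
  then have \<gamma>8: "\<gamma> < 1 / 8" by (simp add: powr_minus)
  have gr: "\<gamma> * r \<le> \<gamma>" using \<gamma> r1 by simp
  define \<pi> where "\<pi> = (\<lambda>i. 1 - card (stay i B) / b)"
  define q where "q = (\<lambda>i. card {u \<in> B. i \<in> u} / b)"
  have gh: "0 \<le> q i" "q i \<le> 1" "1 - \<pi> i \<le> 2 * q i" "1 - \<pi> i \<le> 2 * (1 - q i)"
    "gain i B = binent (q i) - (1 - \<pi> i)" for i
    using gain_bounds[OF fB B(2) refl refl, of i] by (auto simp: q_def \<pi>_def b_def)
  \<comment> \<open>By the two gain lemmas the coordinates of \<open>S\<close> are biased up to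
    \<gamma>, and all others have influence at most \<open>4 * \<gamma>\<close>.\<close>
  define S where "S = {i \<in> J. \<pi> i \<ge> 1 / 2}"
  define m where "m = {i \<in> S. q i > 1 / 2}"
  have SJ: "S \<subseteq> J" and mS: "m \<subseteq> S" by (auto simp: S_def m_def)
  have mis: "card {x \<in> B. (i \<in> x) \<noteq> (i \<in> m)} \<le> \<gamma> * card B" if i: "i \<in> S" for i
  proof -
    have gi: "gain i B < \<gamma>" "\<pi> i \<ge> 1 / 2" using g[of i] i gr by (auto simp: S_def)
    then have "min (q i) (1 - q i) \<le> gain i B"
      using min_le_gain_of_large_influence[OF gh(1-4)[of i] gi(2)] \<gamma>8 gh(5)[of i] by simp
    then have mn: "min (q i) (1 - q i) \<le> \<gamma>" using gi by simp
    have "real (card {x \<in> B. (i \<in> x) \<noteq> (i \<in> m)}) = b * min (q i) (1 - q i)"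
    proof (cases "i \<in> m")
      case True
      have "real (card {u \<in> B. i \<notin> u}) = b * (1 - q i)"
        using card_split_mem[OF fB(1), of i] b by (simp add: b_def q_def field_simps)
      then show ?thesis using True by (simp add: m_def min_def)
    next
      case False
      have "real (card {u \<in> B. i \<in> u}) = b * q i" using b by (simp add: q_def)
      then show ?thesis using False i by (simp add: m_def min_def)
    qed
    also have "\<dots> \<le> b * \<gamma>" using mn b by (intro mult_left_mono) auto
    finally show ?thesis by (simp add: b_def mult.commute)
  qed
  have infl: "b - card (stay i B) \<le> 4 * \<gamma> * b" if i: "i \<in> J - S" for i
  proof -
    have "\<pi> i < 1 / 2" using i by (auto simp: S_def)
    then have "\<pi> i \<le> 4 * gain i B"
      using gain_ge_of_small_influence[OF gh(1-4)[of i]] gh(5)[of i] by simp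
    also have "\<dots> \<le> 4 * \<gamma>" using g[of i] gr i by simp
    finally show ?thesis using b by (simp add: \<pi>_def field_simps)
  qed
  define B' where "B' = {x \<in> B. x \<inter> S = m \<inter> S}"
  define N where "N = real (card B')"
  define l where "l = \<Gamma> - 3"
  have l: "l > 0" "8 * M \<le> l" using \<Gamma>8 M by (auto simp: l_def)
  have "1 / (2 * \<gamma>) = 2 powr (\<Gamma> - 1)" by (simp add: \<gamma>_def powr_diff powr_minus field_simps)
  then have "log 2 (1 / (2 * \<gamma>)) = \<Gamma> - 1" by simp
  then have l': "l = log 2 (1 / (2 * \<gamma>)) - 2" by (simp add: l_def)
  have "M * r * b \<le> l * b / 2"
  proof -
    have "M * r \<le> M * 1" using M r1 by (intro mult_left_mono) auto
    then have "M * r \<le> l / 2" using l M by linarith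
    then have "M * r * b \<le> l / 2 * b" using b by (intro mult_right_mono) auto
    then show ?thesis by simp
  qed
  then have sm: "excess J B \<le> l * card B / 2" using exc by (simp add: b_def)
  have res: "excess J B' + l * (b - N) \<le> excess J B"
    using restrict_to_majority[OF J B SJ mis \<gamma> l' l(1) sm] by (simp add: B'_def b_def N_def)
  have B'J: "B' \<subseteq> Pow J" using B by (auto simp: B'_def)
  have B'B: "B' \<subseteq> B" by (auto simp: B'_def)
  have NB: "N \<le> b" using card_mono[OF fB B'B] by (simp add: N_def b_def)
  have e0: "excess J B' \<ge> 0" by (rule excess_nonneg[OF J B'J])
  have e1: "excess J B' \<le> M * r * b"
  proof -
    have "0 \<le> l * (b - N)" using l(1) NB by simp
    then show ?thesis using res exc by (simp add: b_def)
  qed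
  \<comment> \<open>As \<open>8 * M \<le> l\<close>, the excess \<open>M * r * b\<close> can pay for
    discarding at most \<open>r * b / 8\<close> points, a fraction of the distance to
    subcubes.\<close>
  have lost: "b - N \<le> r * b / 8"
  proof -
    have "8 * M * (b - N) \<le> l * (b - N)" using l(2) NB by (intro mult_right_mono) auto
    also have "\<dots> \<le> M * r * b" using res e0 exc by (simp add: b_def)
    finally have "M * (8 * (b - N)) \<le> M * (r * b)" by (simp add: algebra_simps)
    then have "8 * (b - N) \<le> r * b" using M by (simp only: mult_le_cancel_left_pos)
    then show ?thesis by simp
  qed
  have "r * b \<le> 1 * b" using r1 b by (intro mult_right_mono) auto
  then have N78: "N \<ge> 7 / 8 * b" using lost by simp
  then have N: "N > 0" using b by simp
  define C where "C = {x \<in> Pow J. x \<inter> S = m \<inter> S}"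
  have mSS: "m \<inter> S = m" using mS by auto
  have cC: "real (card C) = 2 ^ card (J - S)"
    using card_face[OF J SJ, of m] mS by (simp add: C_def mSS)
  have B'C: "B' \<subseteq> C" using B'J by (auto simp: B'_def C_def)
  have fC: "finite C" using J by (simp add: C_def)
  \<comment> \<open>The face is itself a subcube, so a set far from it must leave many points of it
    uncovered.\<close>
  have far': "real (card C) - N \<ge> 7 / 8 * r * b"
  proof -
    have "scube J C" unfolding scube_def C_def using SJ mS by (intro exI[of _ S] exI[of _ "m \<inter> S"]) auto
    then have "r * b \<le> card (sym_diff B C)" using far by (simp add: b_def)
    also have "sym_diff B C = (B - B') \<union> (C - B')" using B by (auto simp: B'_def C_def)
    also have "card ((B - B') \<union> (C - B')) \<le> card (B - B') + card (C - B')" by (rule card_Un_le)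
    also have "real (card (B - B') + card (C - B')) = (b - N) + (card C - N)"
      using card_mono[OF fB B'B] card_mono[OF fC B'C] fB fC finite_subset[OF B'B fB]
      by (simp add: card_Diff_subset B'B B'C b_def N_def)
    finally show ?thesis using lost by simp
  qed
  define A where "A = (\<lambda>x. x - S) ` B'"
  define I where "I = J - S"
  have fI: "finite I" using J by (simp add: I_def)
  have B'm: "B' \<subseteq> {x \<in> Pow J. x \<inter> S = m \<inter> S}" using B'C by (simp add: C_def)
  note rf = restrict_to_face[OF J SJ B'm, folded A_def I_def]
  have A: "A \<subseteq> Pow I" "card A = card B'" by (fact rf(1,2))+
  have A0: "A \<noteq> {}" using N by (auto simp: A_def N_def)
  define v where "v = 1 - card A / 2 ^ card I"
  have rN: "r * N \<le> r * b" using NB r by simp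
  have vN: "v \<ge> 7 / 8 * r * (N / 2 ^ card I)"
  proof -
    have "v = (card C - N) / 2 ^ card I" using cC by (simp add: v_def A N_def I_def field_simps)
    also have "\<dots> \<ge> (7 / 8 * r * N) / 2 ^ card I"
      using far' rN by (intro divide_right_mono) auto
    finally show ?thesis by simp
  qed
  moreover have "7 / 8 * r * (N / 2 ^ card I) > 0" using r N by simp
  ultimately have v0: "v > 0" by linarith
  \<comment> \<open>Directions outside \<open>S\<close> preserve the face, so a point that leaves
    \<open>B'\<close> also leaves \<open>B\<close>. The factor 4 becomes 5 because \<open>B'\<close>
    has at least 7/8 of the points.\<close>
  have inflA: "card A - real (card (stay i A)) \<le> 5 * \<gamma> * card A" if i: "i \<in> I" for i
  proof -
    have "B' - stay i B' \<subseteq> B - stay i B"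
      using i flip_Int[of i S] by (auto simp: B'_def stay_def I_def)
    then have "card (B' - stay i B') \<le> card (B - stay i B)" using fB by (intro card_mono) auto
    moreover have "real (card (E - stay i E)) = card E - real (card (stay i E))" if "finite E" for E
      using that by (subst card_Diff_subset) (auto simp: stay_def intro!: of_nat_diff card_mono)
    ultimately have "N - card (stay i B') \<le> b - card (stay i B)"
      using fB finite_subset[OF B'B fB] by (simp add: N_def b_def) (metis of_nat_le_iff)
    also have "\<dots> \<le> 4 * \<gamma> * b" using infl i by (simp add: I_def)
    also have "\<dots> \<le> 4 * \<gamma> * (5 / 4 * N)" using N78 N \<gamma> by (intro mult_left_mono) auto
    finally show ?thesis using rf(3)[OF i] A(2) by (simp add: N_def)
  qed
  define t where "t = card I - log 2 (card A)"
  have eA: "excess I A \<le> 2 * M * r * card A"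
  proof -
    have "excess I A \<le> M * r * b" using e1 rf(4) by simp
    also have "\<dots> \<le> M * r * (2 * N)" using N78 M r NB by (intro mult_left_mono) auto
    finally show ?thesis by (simp add: A N_def)
  qed
  have sumI: "(\<Sum>i\<in>I. card A - real (card (stay i A))) \<le> (t + 2 * M * r) * card A"
    using eA by (simp add: excess_def t_def sum_subtractf algebra_simps)
  have FS: "v * ln (v / (5 * \<gamma> * W)) \<le> 2 * W" if "W > 0" "t + 2 * M * r \<le> W" for W
  proof (rule Falik_Samorodnitsky_set[OF fI A(1) A0 v_def v0 inflA])
    show "(\<Sum>i\<in>I. card A - real (card (stay i A))) \<le> W * card A"
      using sumI that(2) by (meson mult_right_mono of_nat_0_le_iff order_trans)
  qed (use \<gamma> that in auto)
  have mu: "1 - v = N / 2 ^ card I" by (simp add: v_def A N_def)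
  have mu0: "1 - v > 0" using mu N by simp
  have t: "t = log 2 (1 / (1 - v))" using N by (simp add: t_def mu A N_def log_divide_pos log_nat_power)
  show False
  proof (cases "v \<le> 1 / 2")
    \<comment> \<open>Density at least 1/2: the codimension and \<open>r\<close> are both at most
      \<open>3 * v\<close>, the latter because uncovered points are at least a fixed multiple of
      \<open>r\<close>. The total influence is then linear in \<open>v\<close>.\<close>
    case True
    have "ln (1 / (1 - v)) \<le> 1 / (1 - v) - 1" using mu0 by (intro ln_le_minus_one) simp
    also have "\<dots> \<le> 2 * v"
    proof -
      have "v * (2 * v) \<le> v * 1" using True v0 by (intro mult_left_mono) auto
      then have "1 \<le> (1 + 2 * v) * (1 - v)" by (simp add: algebra_simps)
      then have "1 / (1 - v) \<le> 1 + 2 * v" using mu0 by (simp add: pos_divide_le_eq)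
      then show ?thesis by simp
    qed
    also have "\<dots> \<le> 3 * v * ln 2" using ln2_ge_two_thirds v0 by simp
    finally have t3: "t \<le> 3 * v" unfolding t log_def by (simp add: pos_divide_le_eq)
    have "7 / 8 * r * (1 / 2) \<le> 7 / 8 * r * (1 - v)" using True r by (intro mult_left_mono) auto
    then have "r \<le> 3 * v" using vN v0 unfolding mu by linarith
    then have "M * r \<le> M * (3 * v)" using M by (intro mult_left_mono) auto
    then have "t + 2 * M * r \<le> (3 + 6 * M) * v" using t3 by (simp add: algebra_simps)
    moreover have "(3 + 6 * M) * v > 0" using M v0 by simp
    ultimately have "v * ln (v / (5 * \<gamma> * ((3 + 6 * M) * v))) \<le> 2 * ((3 + 6 * M) * v)" by (intro FS)
    then show False
      using large_density_contradiction[OF M _ v0 refl, of \<Gamma>] by (simp add: \<Gamma>_def \<gamma>_def)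
  next
    case False
    \<comment> \<open>Density below 1/2: the codimension is bounded first, with \<open>2 * M\<close>
      as bound for the excess per point since \<open>r \<le> 1\<close>.\<close>
    interpret cube_set I A using fI A(1) A0 by unfold_locales
    obtain k :: nat where k: "real k \<ge> 14 * (2 * M) + 15" "5 * 2 powr (- \<Gamma>) * k * 2 ^ k < 1"
      "3 * ((4 + 8 * k) * (12 * (2 * M) + 12) + k) + 6 + 2 * M \<le> 16508 * (M + 1)\<^sup>2"
      using exists_exponent[OF M, of \<Gamma>] by (auto simp: \<Gamma>_def)
    have Mr: "M * r \<le> M * 1" using M r1 by (intro mult_left_mono) auto
    then have "2 * M * r * card A \<le> 2 * M * card A" by (intro mult_right_mono) auto
    then have "excess I A \<le> 2 * M * card A" using eA by linarith
    then have "t \<le> 3 * ((4 + 8 * k) * (12 * (2 * M) + 12) + k) + 6"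
      by (rule codim_le_of_small_influences[OF t_def _ _ inflA _ k(1)])
        (use M \<gamma> k(2) in \<open>auto simp: \<gamma>_def\<close>)
    then have "t + 2 * M * r \<le> 16508 * (M + 1)\<^sup>2" using k(3) Mr by linarith
    moreover have "16508 * (M + 1)\<^sup>2 > 0" using M by simp
    ultimately have "v * ln (v / (5 * \<gamma> * (16508 * (M + 1)\<^sup>2))) \<le> 2 * (16508 * (M + 1)\<^sup>2)" by (intro FS)
    then show False
      using small_density_contradiction[OF M _ _ refl, of \<Gamma> v] False by (simp add: \<Gamma>_def \<gamma>_def)
  qed
qed

section \<open>Approximation by disjoint subcubes\<close>

lemma scube_subset: "scube J C \<Longrightarrow> C \<subseteq> Pow J"
  by (auto simp: scube_def)

lemma scube_Int:
  assumes "scube J C" "scube J D"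
  shows "scube J (C \<inter> D) \<or> C \<inter> D = {}"
proof (cases "C \<inter> D = {}")
  case False
  then obtain z where z: "z \<in> C" "z \<in> D" by auto
  obtain T m U p where C: "m \<subseteq> T" "T \<subseteq> J" "C = {x \<in> Pow J. x \<inter> T = m}"
    and D: "p \<subseteq> U" "U \<subseteq> J" "D = {x \<in> Pow J. x \<inter> U = p}"
    using assms by (auto simp: scube_def)
  have "C \<inter> D = {x \<in> Pow J. x \<inter> (T \<union> U) = z \<inter> (T \<union> U)}"
    using z C(3) D(3) by auto
  then have "scube J (C \<inter> D)"
    unfolding scube_def using C D by (intro exI[of _ "T \<union> U"] exI[of _ "z \<inter> (T \<union> U)"]) auto
  then show ?thesis by simp
qed simp

lemma scube_half:
  assumes "i \<in> J"
  shows "scube J {x \<in> Pow J. i \<in> x}" "scube J {x \<in> Pow J. i \<notin> x}"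
  unfolding scube_def using assms
  by (intro exI[of _ "{i}"] exI[of _ "{i}"], auto)
    (intro exI[of _ "{i}"] exI[of _ "{}"], auto)

definition dist_scube :: "'a set \<Rightarrow> 'a set set \<Rightarrow> nat" where
  "dist_scube J B = Min ((\<lambda>C. card (sym_diff B C)) ` insert {} {C. scube J C})"

lemma finite_scubes: "finite J \<Longrightarrow> finite {C. scube J C}"
  by (rule finite_subset[of _ "Pow (Pow J)"]) (auto simp: scube_def)

lemma dist_scube_le:
  assumes "finite J" "scube J C \<or> C = {}"
  shows "dist_scube J B \<le> card (sym_diff B C)"
  unfolding dist_scube_def using assms finite_scubes by (intro Min_le) auto

lemma dist_scube_witness:
  assumes "finite J"
  obtains C where "scube J C \<or> C = {}" "card (sym_diff B C) = dist_scube J B"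
proof -
  have "dist_scube J B \<in> (\<lambda>C. card (sym_diff B C)) ` insert {} {C. scube J C}"
    unfolding dist_scube_def using assms finite_scubes by (intro Min_in) auto
  then obtain C where "dist_scube J B = card (sym_diff B C)" "C \<in> insert {} {C. scube J C}"
    by (rule imageE)
  then show thesis using that[of C] by auto
qed

text \<open>The two halves of an optimal subcube are candidates for the two halves of
  \<open>B\<close>, and the symmetric difference splits along \<open>i\<close>.\<close>

lemma dist_scube_split:
  assumes J: "finite J" and B: "B \<subseteq> Pow J" and i: "i \<in> J"
  shows "dist_scube J {x \<in> B. i \<in> x} + dist_scube J {x \<in> B. i \<notin> x} \<le> dist_scube J B"
proof -
  obtain C where C: "scube J C \<or> C = {}" "card (sym_diff B C) = dist_scube J B"
    using dist_scube_witness[OF J] .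
  define H1 H0 where "H1 = {x \<in> Pow J. i \<in> x}" and "H0 = {x \<in> Pow J. i \<notin> x}"
  have CJ: "C \<subseteq> Pow J" using C(1) scube_subset by auto
  have s: "scube J (C \<inter> H1) \<or> C \<inter> H1 = {}" "scube J (C \<inter> H0) \<or> C \<inter> H0 = {}"
    using C(1) scube_Int scube_half[OF i] unfolding H1_def H0_def by blast+
  have fin: "finite (sym_diff B C)" using J B CJ finite_subset[of _ "Pow J"] by auto
  have "card (sym_diff {x \<in> B. i \<in> x} (C \<inter> H1)) + card (sym_diff {x \<in> B. i \<notin> x} (C \<inter> H0))
    = card {x \<in> sym_diff B C. i \<in> x} + card {x \<in> sym_diff B C. i \<notin> x}"
    using B CJ by (intro arg_cong2[where f = "(+)"] arg_cong[where f = card]) (auto simp: H1_def H0_def)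
  also have "\<dots> = dist_scube J B"
    using card_split_mem[OF fin, of i] C(2) by simp
  finally show ?thesis
    using dist_scube_le[OF J s(1), of "{x \<in> B. i \<in> x}"] dist_scube_le[OF J s(2), of "{x \<in> B. i \<notin> x}"] by simp
qed

text \<open>Cutting an optimal subcube down to the cell \<open>D\<close> cannot increase the error,
  as \<open>B \<subseteq> D\<close>. Staying inside the cell keeps the families of different parts
  disjoint.\<close>

lemma exists_single_approximation:
  assumes J: "finite J" and D: "scube J D \<or> D = {}" and B: "B \<subseteq> D"
  shows "\<exists>\<C>. finite \<C> \<and> card \<C> \<le> 1 \<and> (\<forall>C\<in>\<C>. scube J C \<and> C \<subseteq> D) \<and> disjoint \<C>
    \<and> card (sym_diff B (\<Union>\<C>)) \<le> dist_scube J B"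
proof -
  obtain C where C: "scube J C \<or> C = {}" "card (sym_diff B C) = dist_scube J B"
    using dist_scube_witness[OF J] .
  have CD: "scube J (C \<inter> D) \<or> C \<inter> D = {}" using C(1) D scube_Int by blast
  define \<C> where "\<C> = {C \<inter> D} - {{}}"
  have U: "\<Union>\<C> = C \<inter> D" by (auto simp: \<C>_def)
  have "B \<subseteq> Pow J" "C \<subseteq> Pow J" using B D C(1) scube_subset by blast+
  then have "finite (sym_diff B C)" using J finite_subset[of _ "Pow J"] by auto
  then have "card (sym_diff B (\<Union>\<C>)) \<le> card (sym_diff B C)"
    unfolding U using B by (intro card_mono) auto
  moreover have "card \<C> \<le> 1" unfolding \<C>_def by (rule order_trans[OF card_Diff1_le]) simp
  moreover have "\<forall>C\<in>\<C>. scube J C \<and> C \<subseteq> D" using CD by (auto simp: \<C>_def)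
  moreover have "finite \<C>" "disjoint \<C>" by (auto simp: \<C>_def disjoint_def)
  ultimately show ?thesis using C(2) by auto
qed

text \<open>\<open>n\<close> bounds the depth of splitting. A part is left alone once its distance
  is at most \<open>excess / (2 * M)\<close>; by superadditivity of the excess all such errors fit
  into one allowance \<open>excess J B / (2 * M)\<close>. A part that is split loses \<gamma> times
  its distance in excess, hence at least \<gamma> times its final error, so \<open>n\<close> rounds
  consume \<open>n * \<gamma>\<close> times whatever error exceeds the allowance.\<close>

lemma exists_approximation:
  fixes M \<gamma> :: real
  assumes J: "finite J" and M: "M > 0" and \<gamma>: "\<gamma> = 2 powr (- (1000000 * (2 * M)\<^sup>2 + 1000000))"
    and D: "scube J D \<or> D = {}" and B: "B \<subseteq> D"
  shows "\<exists>\<C>. finite \<C> \<and> card \<C> \<le> 2 ^ n \<and> (\<forall>C\<in>\<C>. scube J C \<and> C \<subseteq> D) \<and> disjoint \<C>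
    \<and> card (sym_diff B (\<Union>\<C>)) \<le> dist_scube J B
    \<and> n * \<gamma> * (card (sym_diff B (\<Union>\<C>)) - excess J B / (2 * M)) \<le> excess J B"
  using D B
proof (induction n arbitrary: D B)
  case 0
  then show ?case
    using exists_single_approximation[OF J 0] excess_nonneg[OF J, of B] scube_subset[of J D] by fastforce
next
  case (Suc n)
  have BJ: "B \<subseteq> Pow J" using Suc.prems scube_subset by blast
  have e0: "excess J B \<ge> 0" by (rule excess_nonneg[OF J BJ])
  have fB: "finite B" using BJ J finite_subset by auto
  have \<gamma>0: "\<gamma> > 0" by (simp add: \<gamma>)
  show ?case
  proof (cases "dist_scube J B > 0 \<and> excess J B \<le> 2 * M * dist_scube J B")
    case False
    obtain \<C> where \<C>: "finite \<C>" "card \<C> \<le> 1" "\<forall>C\<in>\<C>. scube J C \<and> C \<subseteq> D" "disjoint \<C>"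
      "card (sym_diff B (\<Union>\<C>)) \<le> dist_scube J B"
      using exists_single_approximation[OF J Suc.prems] by blast
    have "real (dist_scube J B) \<le> excess J B / (2 * M)"
      using False M e0 by (cases "dist_scube J B = 0") (auto simp: pos_le_divide_eq mult.commute mult.left_commute)
    then have "real (card (sym_diff B (\<Union>\<C>))) - excess J B / (2 * M) \<le> 0"
      using \<C>(5) by linarith
    then have "Suc n * \<gamma> * (card (sym_diff B (\<Union>\<C>)) - excess J B / (2 * M)) \<le> 0"
      using \<gamma>0 by (intro mult_nonneg_nonpos) auto
    then have "Suc n * \<gamma> * (card (sym_diff B (\<Union>\<C>)) - excess J B / (2 * M)) \<le> excess J B"
      using e0 by linarith
    moreover have "card \<C> \<le> 2 ^ Suc n" using \<C>(2) by (meson le_trans one_le_numeral one_le_power)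
    ultimately show ?thesis using \<C> by blast
  next
    case True
    define r where "r = dist_scube J B / real (card B)"
    have "B \<noteq> {}"
    proof
      assume "B = {}"
      then have "dist_scube J B \<le> 0" using dist_scube_le[OF J, of "{}" B] by simp
      then show False using True by simp
    qed
    then have cB: "real (card B) > 0" using fB by (simp add: card_gt_0_iff)
    have r0: "r > 0" using True cB by (simp add: r_def)
    have rB: "r * card B = dist_scube J B" using cB by (simp add: r_def)
    obtain i where i: "i \<in> J" "\<gamma> * r \<le> gain i B"
    proof -
      have "\<exists>i\<in>J. 2 powr (- (1000000 * (2 * M)\<^sup>2 + 1000000)) * r \<le> gain i B"
      proof (rule exists_gain[OF J BJ \<open>B \<noteq> {}\<close>])
        fix C assume "scube J C"
        then show "r * card B \<le> card (sym_diff B C)"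
          unfolding rB using dist_scube_le[OF J, of C B] by simp
      next
        show "excess J B \<le> 2 * M * r * card B" using True rB by (simp add: mult.assoc)
      qed (use M r0 in auto)
      then show thesis using that \<gamma> by auto
    qed
    define H1 H0 where "H1 = {x \<in> Pow J. i \<in> x}" and "H0 = {x \<in> Pow J. i \<notin> x}"
    define B1 B0 where "B1 = {x \<in> B. i \<in> x}" and "B0 = {x \<in> B. i \<notin> x}"
    have D1: "scube J (D \<inter> H1) \<or> D \<inter> H1 = {}" and D0: "scube J (D \<inter> H0) \<or> D \<inter> H0 = {}"
      using Suc.prems(1) scube_Int scube_half[OF i(1)] unfolding H1_def H0_def by blast+
    have B1: "B1 \<subseteq> D \<inter> H1" and B0: "B0 \<subseteq> D \<inter> H0"
      using Suc.prems(2) BJ by (auto simp: B1_def B0_def H1_def H0_def)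
    obtain \<C>1 where C1: "finite \<C>1" "card \<C>1 \<le> 2 ^ n" "\<forall>C\<in>\<C>1. scube J C \<and> C \<subseteq> D \<inter> H1" "disjoint \<C>1"
      "card (sym_diff B1 (\<Union>\<C>1)) \<le> dist_scube J B1"
      "n * \<gamma> * (card (sym_diff B1 (\<Union>\<C>1)) - excess J B1 / (2 * M)) \<le> excess J B1"
      using Suc.IH[OF D1 B1] by blast
    obtain \<C>0 where C0: "finite \<C>0" "card \<C>0 \<le> 2 ^ n" "\<forall>C\<in>\<C>0. scube J C \<and> C \<subseteq> D \<inter> H0" "disjoint \<C>0"
      "card (sym_diff B0 (\<Union>\<C>0)) \<le> dist_scube J B0"
      "n * \<gamma> * (card (sym_diff B0 (\<Union>\<C>0)) - excess J B0 / (2 * M)) \<le> excess J B0"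
      using Suc.IH[OF D0 B0] by blast
    define \<C> where "\<C> = \<C>1 \<union> \<C>0"
    have U1: "\<Union>\<C>1 \<subseteq> H1" and U0: "\<Union>\<C>0 \<subseteq> H0" using C1(3) C0(3) by blast+
    have dis: "disjoint \<C>"
      unfolding \<C>_def
    proof (rule disjoint_union[OF C1(4) C0(4)])
      show "\<Union>\<C>1 \<inter> \<Union>\<C>0 = {}" using U1 U0 by (auto simp: H1_def H0_def)
    qed
    have "card \<C> \<le> card \<C>1 + card \<C>0" unfolding \<C>_def by (rule card_Un_le)
    then have cC: "card \<C> \<le> 2 ^ Suc n" using C1(2) C0(2) by simp
    have UJ: "\<Union>\<C> \<subseteq> Pow J" using U1 U0 by (auto simp: \<C>_def H1_def H0_def)
    have "finite (sym_diff B (\<Union>\<C>))" using J BJ UJ finite_subset[of _ "Pow J"] by auto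
    then have "card (sym_diff B (\<Union>\<C>)) = card {x \<in> sym_diff B (\<Union>\<C>). i \<in> x} + card {x \<in> sym_diff B (\<Union>\<C>). i \<notin> x}"
      by (rule card_split_mem)
    also have "{x \<in> sym_diff B (\<Union>\<C>). i \<in> x} = sym_diff B1 (\<Union>\<C>1)"
      using U1 U0 by (auto simp: \<C>_def B1_def H1_def H0_def)
    also have "{x \<in> sym_diff B (\<Union>\<C>). i \<notin> x} = sym_diff B0 (\<Union>\<C>0)"
      using U1 U0 by (auto simp: \<C>_def B0_def H1_def H0_def)
    finally have cs: "card (sym_diff B (\<Union>\<C>)) = card (sym_diff B1 (\<Union>\<C>1)) + card (sym_diff B0 (\<Union>\<C>0))" .
    then have le: "card (sym_diff B (\<Union>\<C>)) \<le> dist_scube J B"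
      using C1(5) C0(5) dist_scube_split[OF J BJ i(1)] by (simp add: B1_def B0_def)
    define \<delta> where "\<delta> = real (card (sym_diff B (\<Union>\<C>)))"
    have ex: "excess J B = excess J B1 + excess J B0 + card B * gain i B"
      unfolding B1_def B0_def by (rule excess_split[OF J i(1) fB \<open>B \<noteq> {}\<close>])
    \<comment> \<open>The gain is proportional to the distance of \<open>B\<close> itself, which
      dominates the error left after all further splits.\<close>
    have gB: "card B * gain i B \<ge> \<gamma> * \<delta>"
    proof -
      have "\<gamma> * \<delta> \<le> \<gamma> * (r * card B)" using le \<gamma>0 unfolding rB \<delta>_def by (intro mult_left_mono) auto
      also have "\<dots> = card B * (\<gamma> * r)" by simp
      also have "\<dots> \<le> card B * gain i B" using i(2) by (intro mult_left_mono) auto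
      finally show ?thesis .
    qed
    have "\<gamma> * \<delta> \<ge> 0" using \<gamma>0 by (simp add: \<delta>_def)
    then have "excess J B1 + excess J B0 \<le> excess J B" using ex gB by linarith
    then have "(excess J B1 + excess J B0) / (2 * M) \<le> excess J B / (2 * M)"
      using M by (intro divide_right_mono) auto
    then have "n * \<gamma> * (\<delta> - excess J B / (2 * M)) \<le> n * \<gamma> * (\<delta> - (excess J B1 + excess J B0) / (2 * M))"
      using \<gamma>0 by (intro mult_left_mono) auto
    also have "\<dots> = n * \<gamma> * (card (sym_diff B1 (\<Union>\<C>1)) - excess J B1 / (2 * M))
      + n * \<gamma> * (card (sym_diff B0 (\<Union>\<C>0)) - excess J B0 / (2 * M))"
      by (simp add: \<delta>_def cs add_divide_distrib algebra_simps)
    also have "\<dots> \<le> excess J B1 + excess J B0" using C1(6) C0(6) by (rule add_mono)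
    also have "\<dots> \<le> excess J B - \<gamma> * \<delta>" using ex gB by linarith
    also have "\<dots> \<le> excess J B - \<gamma> * (\<delta> - excess J B / (2 * M))"
      using \<gamma>0 e0 M by (simp add: mult_left_mono)
    finally have "n * \<gamma> * (\<delta> - excess J B / (2 * M)) + \<gamma> * (\<delta> - excess J B / (2 * M)) \<le> excess J B"
      by simp
    then have "Suc n * \<gamma> * (\<delta> - excess J B / (2 * M)) \<le> excess J B"
      by (simp only: of_nat_Suc distrib_right mult_1)
    moreover have "\<forall>C\<in>\<C>. scube J C \<and> C \<subseteq> D" using C1(3) C0(3) by (auto simp: \<C>_def)
    moreover have "finite \<C>" using C1(1) C0(1) by (simp add: \<C>_def)
    ultimately show ?thesis using cC dis le unfolding \<delta>_def by blast
  qed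
qed

text \<open>The exponent \<open>C * M\<^sup>2\<close> vanishes as \<open>M\<close> tends to 0, so
  constants can be absorbed only while \<open>M\<close> is bounded below; for smaller
  \<open>M\<close> the quotient is below 1 and the depth is exactly 1.\<close>

lemma depth_bound:
  fixes a :: real
  assumes a: "a > 0"
  obtains C :: real where "C > 0"
    "\<And>M \<gamma> :: real. M > 0 \<Longrightarrow> \<gamma> = 2 powr (- (a * (2 * M)\<^sup>2 + a)) \<Longrightarrow>
      real (nat \<lfloor>2 * M / \<gamma>\<rfloor> + 1) \<le> 2 powr (C * M\<^sup>2)"
proof -
  \<comment> \<open>A quotient \<open>2 * M / \<gamma>\<close> of at least 1 forces
    \<open>M \<ge> c\<close>.\<close>
  define c :: real where "c = 2 powr (- (5 * a + 1))"
  have "c \<le> 2 powr 0" unfolding c_def using a by (intro powr_mono) auto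
  then have c: "c > 0" "c \<le> 1" by (auto simp: c_def)
  \<comment> \<open>For \<open>M \<ge> c\<close> the last summand turns the additive constant
    \<open>a + 2\<close> into a multiple of the square of \<open>M\<close>.\<close>
  define C where "C = 4 * a + 1 + (a + 2) / c\<^sup>2"
  have "real (nat \<lfloor>2 * M / \<gamma>\<rfloor> + 1) \<le> 2 powr (C * M\<^sup>2)"
    if M: "M > 0" and \<gamma>: "\<gamma> = 2 powr (- (a * (2 * M)\<^sup>2 + a))" for M \<gamma> :: real
  proof -
    define x where "x = 2 * M / \<gamma>"
    have x: "x = 2 * M * 2 powr (4 * a * M\<^sup>2 + a)"
      unfolding x_def \<gamma> powr_minus divide_inverse inverse_inverse_eq by (simp add: power_mult_distrib mult.commute mult.left_commute)
    have x0: "x > 0" using M by (simp add: x)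
    have C0: "C > 0" using a c by (simp add: C_def add_pos_nonneg)
    show ?thesis
    proof (cases "x < 1")
      \<comment> \<open>Rounding down and adding 1 gives depth 1 here, which is below every
        admissible bound.\<close>
      case True
      then have "nat \<lfloor>x\<rfloor> = 0" by simp
      moreover have "1 \<le> 2 powr (C * M\<^sup>2)" using C0 by (intro ge_one_powr_ge_zero) auto
      ultimately show ?thesis by (simp add: x_def)
    next
      case False
      have cM: "c \<le> M"
      proof (cases "M \<le> 1")
        case True
        then have "M\<^sup>2 \<le> 1\<^sup>2" using M by (intro power_mono) auto
        then have "2 powr (4 * a * M\<^sup>2 + a) \<le> 2 powr (5 * a)" using a by (intro powr_mono) auto
        then have "x \<le> 2 * M * 2 powr (5 * a)" unfolding x using M by (intro mult_left_mono) auto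
        then have "1 \<le> M * (2 powr 1 * 2 powr (5 * a))" using False by simp
        also have "2 powr 1 * 2 powr (5 * a) = (2 powr (5 * a + 1) :: real)" by (subst powr_add[symmetric]) (simp add: add.commute)
        finally show ?thesis unfolding c_def powr_minus by (simp add: divide_simps)
      qed (use c in auto)
      have "c\<^sup>2 \<le> M\<^sup>2" using cM c by (intro power_mono) auto
      then have "1 \<le> M\<^sup>2 / c\<^sup>2" using c by (simp add: pos_le_divide_eq)
      then have "(a + 2) * 1 \<le> (a + 2) * (M\<^sup>2 / c\<^sup>2)" using a by (intro mult_left_mono) auto
      then have CM: "4 * a * M\<^sup>2 + M\<^sup>2 + (a + 2) \<le> C * M\<^sup>2" by (simp add: C_def algebra_simps)
      have M2: "M \<le> 2 powr (M\<^sup>2)"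
      proof -
        have "(M - 1)\<^sup>2 \<ge> 0" by simp
        then have "2 * M \<le> M\<^sup>2 + 1" by (simp add: power2_eq_square algebra_simps)
        moreover have "1 + M\<^sup>2 * ln 2 \<le> 2 powr (M\<^sup>2)"
          unfolding powr_def using exp_ge_add_one_self[of "M\<^sup>2 * ln 2"] by simp
        moreover have "M\<^sup>2 * (2 / 3) \<le> M\<^sup>2 * ln 2"
          using ln2_ge_two_thirds by (intro mult_left_mono) auto
        ultimately show ?thesis using zero_le_power2[of M] by linarith
      qed
      have "nat \<lfloor>x\<rfloor> + 1 \<le> x + 1" using x0 by (simp add: of_nat_nat)
      also have "\<dots> \<le> 2 * x" using False by simp
      also have "\<dots> = 2 powr 2 * M * 2 powr (4 * a * M\<^sup>2 + a)" by (simp add: x)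
      also have "\<dots> \<le> 2 powr 2 * 2 powr (M\<^sup>2) * 2 powr (4 * a * M\<^sup>2 + a)"
        using M2 by (intro mult_right_mono mult_left_mono) auto
      also have "\<dots> = 2 powr (2 + M\<^sup>2 + (4 * a * M\<^sup>2 + a))" by (simp only: powr_add)
      also have "\<dots> \<le> 2 powr (C * M\<^sup>2)" using CM by (intro powr_mono) auto
      finally show ?thesis by (simp add: x_def)
    qed
  qed
  moreover have "C > 0" using a c by (simp add: C_def add_pos_nonneg)
  ultimately show thesis using that by blast
qed

text \<open>For \<open>M = K / \<epsilon>\<close> the allowance \<open>excess / (2 * M)\<close> is
  at most half of the permitted error, and depth at least \<open>2 * M / \<gamma>\<close> limits the
  error beyond it to the same amount.\<close>

lemma exists_disjoint_scubes:
  fixes K \<epsilon> \<gamma> :: real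
  assumes J: "finite J" and A: "A \<subseteq> Pow J" and K: "K > 0" and \<epsilon>: "\<epsilon> > 0" and exc: "excess J A \<le> K * card A"
    and \<gamma>: "\<gamma> = 2 powr (- (1000000 * (2 * (K / \<epsilon>))\<^sup>2 + 1000000))"
  obtains \<C> where "finite \<C>" "card \<C> \<le> 2 ^ (nat \<lfloor>2 * (K / \<epsilon>) / \<gamma>\<rfloor> + 1)" "\<And>C. C \<in> \<C> \<Longrightarrow> scube J C"
    "disjoint \<C>" "card (sym_diff A (\<Union>\<C>)) \<le> \<epsilon> * card A"
proof -
  define M where "M = K / \<epsilon>"
  have M: "M > 0" using K \<epsilon> by (simp add: M_def)
  have \<gamma>0: "\<gamma> > 0" by (simp add: \<gamma>)
  define n where "n = nat \<lfloor>2 * M / \<gamma>\<rfloor> + 1"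
  have "scube J (Pow J)" unfolding scube_def by (intro exI[of _ "{}"]) auto
  then obtain \<C> where C: "finite \<C>" "card \<C> \<le> 2 ^ n" "\<forall>C\<in>\<C>. scube J C \<and> C \<subseteq> Pow J" "disjoint \<C>"
    "n * \<gamma> * (card (sym_diff A (\<Union>\<C>)) - excess J A / (2 * M)) \<le> excess J A"
    using exists_approximation[OF J M, of \<gamma> "Pow J" A n] A \<gamma> unfolding M_def by blast
  define \<delta> where "\<delta> = real (card (sym_diff A (\<Union>\<C>)))"
  have "2 * M / \<gamma> \<le> n" unfolding n_def by linarith
  then have n\<gamma>: "2 * M \<le> n * \<gamma>" using \<gamma>0 by (simp add: pos_divide_le_eq)
  have e2: "excess J A / (2 * M) \<le> \<epsilon> * card A / 2"
  proof -
    have "excess J A / (2 * M) \<le> K * card A / (2 * M)" using exc M by (intro divide_right_mono) auto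
    also have "\<dots> = \<epsilon> * card A / 2" using K \<epsilon> by (simp add: M_def)
    finally show ?thesis .
  qed
  have "\<delta> \<le> \<epsilon> * card A"
  proof (cases "\<delta> - excess J A / (2 * M) \<le> 0")
    case True
    moreover have "\<epsilon> * card A / 2 \<le> \<epsilon> * card A" using \<epsilon> by simp
    ultimately show ?thesis using e2 by linarith
  next
    case False
    then have "2 * M * (\<delta> - excess J A / (2 * M)) \<le> n * \<gamma> * (\<delta> - excess J A / (2 * M))"
      using n\<gamma> by (intro mult_right_mono) auto
    then have "2 * M * (\<delta> - excess J A / (2 * M)) \<le> excess J A" using C(5) by (simp add: \<delta>_def)
    then have "\<delta> - excess J A / (2 * M) \<le> excess J A / (2 * M)"
      using M by (simp add: pos_le_divide_eq mult.commute)
    then show ?thesis using e2 by linarith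
  qed
  then show thesis
    using that[of \<C>] C by (auto simp: \<delta>_def n_def M_def)
qed

section \<open>Transfer to extensional functions\<close>

definition supp :: "nat \<Rightarrow> (nat \<Rightarrow> nat) \<Rightarrow> nat set" where
  "supp n x = {i \<in> {1..n}. x i = 1}"

definition charfun :: "nat \<Rightarrow> nat set \<Rightarrow> nat \<Rightarrow> nat" where
  "charfun n y = (\<lambda>i\<in>{1..n}. if i \<in> y then 1 else 0)"

lemma charfun_in_cube: "charfun n y \<in> cube n"
  unfolding charfun_def cube_def by (subst restrict_PiE_iff) simp

lemma charfun_supp:
  assumes "x \<in> cube n"
  shows "charfun n (supp n x) = x"
proof (rule ext)
  fix i
  show "charfun n (supp n x) i = x i"
  proof (cases "i \<in> {1..n}")
    case True
    then have "x i \<in> {0, 1}" using assms PiE_mem[of x "{1..n}" "\<lambda>_. {0, 1}" i] by (simp add: cube_def)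
    then show ?thesis using True by (auto simp: charfun_def supp_def)
  next
    case False
    then show ?thesis using assms PiE_arb[of x "{1..n}" "\<lambda>_. {0, 1}" i] by (auto simp: cube_def charfun_def)
  qed
qed

lemma supp_charfun: "y \<subseteq> {1..n} \<Longrightarrow> supp n (charfun n y) = y"
  by (auto simp: charfun_def supp_def)

lemma supp_subset: "supp n x \<subseteq> {1..n}"
  by (auto simp: supp_def)

lemma inj_on_charfun: "inj_on (charfun n) (Pow {1..n})"
  by (rule inj_on_inverseI[where g = "supp n"]) (simp add: supp_charfun)

lemma subcube_charfun_image:
  assumes "scube {1..n} C"
  shows "subcube n (charfun n ` C)"
proof -
  obtain T m where T: "m \<subseteq> T" "T \<subseteq> {1..n}" "C = {x \<in> Pow {1..n}. x \<inter> T = m}"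
    using assms by (auto simp: scube_def)
  define a where "a = (\<lambda>i\<in>T. if i \<in> m then 1 else 0 :: nat)"
  have "charfun n ` C = {x \<in> cube n. \<forall>i\<in>T. x i = a i}"
  proof (intro equalityI subsetI)
    fix x assume "x \<in> charfun n ` C"
    then obtain y where y: "x = charfun n y" "y \<inter> T = m" using T by auto
    have "x i = a i" if "i \<in> T" for i
      using that y T by (auto simp: a_def charfun_def)
    then show "x \<in> {x \<in> cube n. \<forall>i\<in>T. x i = a i}" using y charfun_in_cube by simp
  next
    fix x assume x: "x \<in> {x \<in> cube n. \<forall>i\<in>T. x i = a i}"
    have st: "supp n x \<inter> T = m"
    proof (rule set_eqI)
      fix i
      show "i \<in> supp n x \<inter> T \<longleftrightarrow> i \<in> m"
      proof (cases "i \<in> T")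
        case True
        then have "x i = (if i \<in> m then 1 else 0)" "i \<in> {1..n}" using x T(2) by (auto simp: a_def)
        then show ?thesis using True by (simp add: supp_def)
      qed (use T(1) in auto)
    qed
    have "supp n x \<in> C" unfolding T(3) by (intro CollectI conjI PowI supp_subset st)
    moreover have "x = charfun n (supp n x)" using x by (simp add: charfun_supp)
    ultimately show "x \<in> charfun n ` C" by (rule rev_image_eqI)
  qed
  moreover have "a \<in> T \<rightarrow>\<^sub>E {0, 1}" by (auto simp: a_def)
  ultimately show ?thesis unfolding subcube_def using T(2) by blast
qed

lemma charfun_flip_edge:
  assumes "y \<subseteq> {1..n}" "i \<in> {1..n}"
  shows "{charfun n y, charfun n (flip i y)} \<in> cube_edges n"
proof -
  have "{j \<in> {1..n}. charfun n y j \<noteq> charfun n (flip i y) j} = {i}"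
    using assms by (auto simp: charfun_def mem_flip_iff split: if_splits)
  then have "card {j \<in> {1..n}. charfun n y j \<noteq> charfun n (flip i y) j} = 1" by simp
  then show ?thesis unfolding cube_edges_def using charfun_in_cube by blast
qed

lemma finite_cube: "finite (cube n)"
  unfolding cube_def by (rule finite_PiE) simp_all

text \<open>A boundary edge has exactly one endpoint in \<open>A\<close>, so it determines the point
  \<open>y\<close> and then the direction \<open>i\<close>; the map from exits to edges is
  injective.\<close>

lemma sum_exits_le_edge_boundary:
  assumes A: "A \<subseteq> cube n"
  defines "B \<equiv> supp n ` A"
  shows "(\<Sum>i\<in>{1..n}. card (B - stay i B)) \<le> card (edge_boundary n A)"
proof -
  define g where "g = (\<lambda>(i, y). {charfun n y, charfun n (flip i y)})"
  have B: "B \<subseteq> Pow {1..n}" using supp_subset by (auto simp: B_def)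
  have fB: "finite B" using B finite_subset[of B "Pow {1..n}"] by simp
  have mem: "charfun n y \<in> A \<longleftrightarrow> y \<in> B" if "y \<subseteq> {1..n}" for y
  proof
    assume "charfun n y \<in> A"
    then have "supp n (charfun n y) \<in> B" by (simp add: B_def)
    then show "y \<in> B" using supp_charfun[OF that] by simp
  next
    assume "y \<in> B"
    then show "charfun n y \<in> A" using A charfun_supp by (auto simp: B_def)
  qed
  have exit: "y \<subseteq> {1..n}" "flip i y \<subseteq> {1..n}" "charfun n y \<in> A" "charfun n (flip i y) \<notin> A"
    if "i \<in> {1..n}" "y \<in> B - stay i B" for i y
  proof -
    show y: "y \<subseteq> {1..n}" using that B by auto
    show f: "flip i y \<subseteq> {1..n}" using flip_subset[OF y that(1)] .
    show "charfun n y \<in> A" "charfun n (flip i y) \<notin> A"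
      using that mem[OF y] mem[OF f] by (auto simp: stay_def)
  qed
  have "inj_on g (SIGMA i:{1..n}. B - stay i B)"
  proof (rule inj_onI)
    fix p p' assume p: "p \<in> (SIGMA i:{1..n}. B - stay i B)" "p' \<in> (SIGMA i:{1..n}. B - stay i B)" "g p = g p'"
    obtain i y j z where ij: "p = (i, y)" "p' = (j, z)" by fastforce
    have a: "i \<in> {1..n}" "y \<in> B - stay i B" "j \<in> {1..n}" "z \<in> B - stay j B" using p ij by auto
    note e1 = exit[OF a(1,2)] and e2 = exit[OF a(3,4)]
    have "{charfun n y, charfun n (flip i y)} = {charfun n z, charfun n (flip j z)}"
      using p(3) ij by (simp add: g_def)
    then have "charfun n y = charfun n z" "charfun n (flip i y) = charfun n (flip j z)"
      using e1 e2 by (auto simp: doubleton_eq_iff)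
    then have yz: "y = z" "flip i y = flip j z"
      using e1(1,2) e2(1,2) inj_onD[OF inj_on_charfun] by (metis PowI)+
    have "i \<in> flip i y \<longleftrightarrow> i \<notin> y" by (simp add: mem_flip_iff)
    then have "i = j" using yz by (auto simp: mem_flip_iff split: if_splits)
    then show "p = p'" using yz ij by simp
  qed
  then have "card (g ` (SIGMA i:{1..n}. B - stay i B)) = card (SIGMA i:{1..n}. B - stay i B)"
    by (rule card_image)
  also have "\<dots> = (\<Sum>i\<in>{1..n}. card (B - stay i B))"
    using fB by (intro card_SigmaI) auto
  finally have c: "(\<Sum>i\<in>{1..n}. card (B - stay i B)) = card (g ` (SIGMA i:{1..n}. B - stay i B))" by simp
  have "g ` (SIGMA i:{1..n}. B - stay i B) \<subseteq> edge_boundary n A"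
  proof
    fix e assume "e \<in> g ` (SIGMA i:{1..n}. B - stay i B)"
    then obtain i y where iy: "i \<in> {1..n}" "y \<in> B - stay i B" "e = {charfun n y, charfun n (flip i y)}"
      by (auto simp: g_def)
    then show "e \<in> edge_boundary n A"
      using exit[OF iy(1,2)] charfun_flip_edge[of y n i] unfolding edge_boundary_def by blast
  qed
  moreover have "edge_boundary n A \<subseteq> cube_edges n" "cube_edges n \<subseteq> Pow (cube n)"
    by (auto simp: edge_boundary_def cube_edges_def)
  then have "finite (edge_boundary n A)"
    using finite_cube finite_subset by (metis finite_Pow_iff)
  ultimately show ?thesis unfolding c by (intro card_mono)
qed

text \<open>Counting exits produces \<open>n * card A\<close>, which cancels against
  \<open>log 2 (2 ^ n)\<close>. The hypothesis on the boundary becomes a bound on the excess without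
  the dimension.\<close>

lemma excess_le_of_edge_boundary:
  assumes A: "A \<subseteq> cube n" "A \<noteq> {}"
    and K: "real (card (edge_boundary n A)) \<le> real (card A) * (log 2 (2 ^ n / real (card A)) + K)"
  shows "excess {1..n} (supp n ` A) \<le> K * card (supp n ` A)"
proof -
  define B where "B = supp n ` A"
  have fA: "finite A" using A finite_cube finite_subset by blast
  have "inj_on (supp n) A"
    by (rule inj_on_inverseI[where g = "charfun n"]) (use A charfun_supp in auto)
  then have cB: "card B = card A" unfolding B_def by (rule card_image)
  have N: "real (card A) > 0" using A fA by (simp add: card_gt_0_iff)
  have fB: "finite B" using fA by (simp add: B_def)
  have "real (card (B - stay i B)) = card B - real (card (stay i B))" for i
    using fB by (subst card_Diff_subset) (auto simp: stay_def intro!: of_nat_diff card_mono)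
  then have "(\<Sum>i\<in>{1..n}. real (card (stay i B))) = n * real (card A) - (\<Sum>i\<in>{1..n}. real (card (B - stay i B)))"
    by (simp add: sum_subtractf cB)
  moreover have "(\<Sum>i\<in>{1..n}. real (card (B - stay i B))) \<le> card (edge_boundary n A)"
    using sum_exits_le_edge_boundary[OF A(1)] unfolding B_def by (metis of_nat_le_iff of_nat_sum)
  ultimately have "excess {1..n} B \<le> card A * log 2 (card A) - n * real (card A) + card (edge_boundary n A)"
    by (simp add: excess_def cB)
  also have "\<dots> \<le> card A * log 2 (card A) - n * real (card A) + card A * (n - log 2 (card A) + K)"
    using K N by (simp add: log_divide_pos log_nat_power)
  also have "\<dots> = K * card A" by (simp add: algebra_simps)
  finally show ?thesis using cB by (simp add: B_def)
qed

theorem theorem1p4: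
  shows "\<exists>C::real. C > 0 \<and>
    (\<forall>(K::real) (\<epsilon>::real) (n::nat) (A :: (nat \<Rightarrow> nat) set).
      K > 0 \<longrightarrow> \<epsilon> > 0 \<longrightarrow> n \<ge> 1 \<longrightarrow> A \<subseteq> cube n \<longrightarrow> A \<noteq> {} \<longrightarrow>
      real (card (edge_boundary n A)) \<le> real (card A) * (log 2 (2 ^ n / real (card A)) + K) \<longrightarrow>
      (\<exists>(L::nat) (S :: nat \<Rightarrow> (nat \<Rightarrow> nat) set).
        (\<forall>i\<in>{1..L}. subcube n (S i)) \<and>
        disjoint_family_on S {1..L} \<and>
        real (card (sym_diff A (\<Union>i\<in>{1..L}. S i))) \<le> \<epsilon> * real (card A) \<and>
        real L \<le> 2 powr (2 powr (C * (K / \<epsilon>)\<^sup>2))))"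
proof -
  obtain C :: real where C: "C > 0"
    "\<And>M \<gamma> :: real. M > 0 \<Longrightarrow> \<gamma> = 2 powr (- (1000000 * (2 * M)\<^sup>2 + 1000000)) \<Longrightarrow>
      real (nat \<lfloor>2 * M / \<gamma>\<rfloor> + 1) \<le> 2 powr (C * M\<^sup>2)"
    using depth_bound[of 1000000] by auto
  show ?thesis
  proof (intro exI[of _ C] conjI allI impI)
    fix K \<epsilon> :: real and n :: nat and A :: "(nat \<Rightarrow> nat) set"
    assume K: "K > 0" and \<epsilon>: "\<epsilon> > 0" and A: "A \<subseteq> cube n" "A \<noteq> {}"
      and bd: "real (card (edge_boundary n A)) \<le> real (card A) * (log 2 (2 ^ n / real (card A)) + K)"
    define B where "B = supp n ` A"
    define \<gamma> :: real where "\<gamma> = 2 powr (- (1000000 * (2 * (K / \<epsilon>))\<^sup>2 + 1000000))"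
    define d where "d = nat \<lfloor>2 * (K / \<epsilon>) / \<gamma>\<rfloor> + 1"
    have B: "B \<subseteq> Pow {1..n}" using supp_subset by (auto simp: B_def)
    have AB: "A = charfun n ` B"
      using A charfun_supp by (force simp: B_def image_image)
    have cB: "card B = card A"
      unfolding AB using card_image[OF inj_on_subset[OF inj_on_charfun B]] by simp
    have "excess {1..n} B \<le> K * card B"
      unfolding B_def by (rule excess_le_of_edge_boundary[OF A bd])
    then obtain \<C> where c: "finite \<C>" "card \<C> \<le> 2 ^ d" "\<And>C. C \<in> \<C> \<Longrightarrow> scube {1..n} C"
      "disjoint \<C>" "card (sym_diff B (\<Union>\<C>)) \<le> \<epsilon> * card B"
      using exists_disjoint_scubes[OF _ B K \<epsilon> _ \<gamma>_def] unfolding d_def by auto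
    obtain f where f: "bij_betw f {1..card \<C>} \<C>"
      using ex_bij_betw_nat_finite_1[OF c(1)] by blast
    have fC: "f i \<in> \<C>" if "i \<in> {1..card \<C>}" for i using f that by (auto simp: bij_betw_def)
    have fP: "f i \<subseteq> Pow {1..n}" if "i \<in> {1..card \<C>}" for i
      using c(3)[OF fC[OF that]] by (rule scube_subset)
    define S where "S = (\<lambda>i. charfun n ` f i)"
    have "f ` {1..card \<C>} = \<C>" using f by (simp add: bij_betw_def)
    then have U: "(\<Union>i\<in>{1..card \<C>}. S i) = charfun n ` \<Union>\<C>"
      unfolding S_def image_UN[symmetric] by simp
    have UP: "\<Union>\<C> \<subseteq> Pow {1..n}" using c(3) scube_subset by blast
    have "sym_diff A (\<Union>i\<in>{1..card \<C>}. S i) = charfun n ` sym_diff B (\<Union>\<C>)"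
      unfolding U AB using B UP by (subst image_Un, subst (1 2) inj_on_image_set_diff[OF inj_on_charfun]) auto
    then have sd: "card (sym_diff A (\<Union>i\<in>{1..card \<C>}. S i)) = card (sym_diff B (\<Union>\<C>))"
    proof -
      have "sym_diff B (\<Union>\<C>) \<subseteq> Pow {1..n}" using B UP by blast
      then have "inj_on (charfun n) (sym_diff B (\<Union>\<C>))" by (rule inj_on_subset[OF inj_on_charfun])
      then show ?thesis
        using \<open>sym_diff A (\<Union>i\<in>{1..card \<C>}. S i) = charfun n ` sym_diff B (\<Union>\<C>)\<close> by (simp only: card_image)
    qed
    have disj: "disjoint_family_on S {1..card \<C>}"
      unfolding disjoint_family_on_def
    proof (intro ballI impI)
      fix i j assume ij: "i \<in> {1..card \<C>}" "j \<in> {1..card \<C>}" "i \<noteq> j"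
      then have "f i \<noteq> f j" using inj_on_eq_iff[OF bij_betw_imp_inj_on[OF f]] by blast
      then have "f i \<inter> f j = {}" using c(4) fC ij by (auto simp: disjoint_def)
      then show "S i \<inter> S j = {}"
        unfolding S_def using inj_on_image_Int[OF inj_on_charfun fP[OF ij(1)] fP[OF ij(2)]] by simp
    qed
    have "real (card \<C>) \<le> 2 powr d" using c(2) by (simp add: powr_realpow)
    also have "real d \<le> 2 powr (C * (K / \<epsilon>)\<^sup>2)"
      unfolding d_def by (rule C(2)) (use K \<epsilon> \<gamma>_def in auto)
    then have "2 powr d \<le> 2 powr (2 powr (C * (K / \<epsilon>)\<^sup>2))" by (intro powr_mono) auto
    finally have L: "real (card \<C>) \<le> 2 powr (2 powr (C * (K / \<epsilon>)\<^sup>2))" .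
    show "\<exists>L S. (\<forall>i\<in>{1..L}. subcube n (S i)) \<and> disjoint_family_on S {1..L} \<and>
        real (card (sym_diff A (\<Union>i\<in>{1..L}. S i))) \<le> \<epsilon> * real (card A) \<and>
        real L \<le> 2 powr (2 powr (C * (K / \<epsilon>)\<^sup>2))"
      using disj L c(5) sd cB fC c(3) subcube_charfun_image
      by (intro exI[of _ "card \<C>"] exI[of _ S]) (auto simp: S_def)
  qed (rule C(1))
qed

end
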